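(* Let $K:\mathbb{C}\times\mathbb{C}\to\mathbb{C}$ be a Hermitian symmetric reproducing kernel acting on $L^2(\mathbb{C},dA)$. Suppose that $$|K(z,w)|=\phi(z-w),\qquad z,w\in\mathbb{C},$$ for a bounded continuous function $\phi:\mathbb{C}\to[0,\infty)$ such that $$\int_{\mathbb{C}}(1+|z|^3)\phi(z)\,dA(z)<\infty.$$ For $\rho>0$ define the dilated kernel $K_\rho(z,w)=\rho\,K(\sqrt\rho\,z,\sqrt\rho\,w)$, let $\mathcal{X}_\rho$ be the determinantal point process on $\mathbb{C}$ with correlation kernel $K_\rho$, and for a function $f$ on $\mathbb{C}$ let $\mathrm{Tr}_\rho(f)=\sum_{x\in\mathcal{X}_\rho}f(x)$. For a compactly supported, real-valued $C^3$ function $f$ on $\mathbb{C}$ set $$\mu_f:=\phi(0)\int_{\mathbb{C}}f(z)\,dA(z),\qquad \sigma_f^2:=\frac12\int_{\mathbb{C}}\int_{\mathbb{C}}\big(\nabla f(z)\cdot w\big)^2\phi(w)^2\,dA(z)\,dA(w).$$ Then $\mathrm{Tr}_\rho(f)-\rho\,\mu_f\to\mathcal{N}(0,\sigma_f^2)$ in distribution as $\rho\to\infty$.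
   Context: $dA$ is the Lebesgue (area) measure on $\mathbb{C}\simeq\mathbb{R}^2$; $\nabla f(z)\cdot w$ is the real inner product in $\mathbb{R}^2$ of the gradient of $f$ at $z$ with $w\in\mathbb{C}\simeq\mathbb{R}^2$. $\mathcal{N}(0,0)$ denotes the law of the random variable that is almost surely zero. A Hermitian symmetric reproducing kernel acting on $L^2(\mathbb{C},dA)$ is a function $K:\mathbb{C}\times\mathbb{C}\to\mathbb{C}$ that is the reproducing kernel of a closed subspace $\mathcal{H}\subset L^2(\mathbb{C},dA)$ of functions on which point evaluations are continuous functionals; that is, $K$ is the integral kernel of the orthogonal projection $L^2(\mathbb{C},dA)\to\mathcal{H}$. In particular $K(z,w)=\overline{K(w,z)}$ and $K(z,w)=\int_{\mathbb{C}}K(z,u)K(u,w)\,dA(u)$ for all $z,w\in\mathbb{C}$. A simple point process $\mathcal{X}$ on $\mathbb{C}$ (a random integer-valued positive Radon measure $E\mapsto\mathcal{X}(E)$, almost surely assigning mass at most one to each singleton, identified with the random set of its points) is determinantal with correlation kernel $K$ if for each $n\in\mathbb{N}$ it has $n$-point correlation function (joint intensity) with respect to Lebesgue measure $\rho_n(x_1,\dots,x_n)=\det\big(K(x_k,x_j)\big)_{k,j=1,\dots,n}$; that is, $\mathbb{E}\big[\prod_{j=1}^n\mathcal{X}(E_j)\big]=\int_{E_1\times\cdots\times E_n}\rho_n\,dA(x_1)\cdots dA(x_n)$ for all mutually disjoint Borel sets $E_1,\dots,E_n$. Under the stated assumptions the operator with kernel $K_\rho$ is locally trace class and there is a unique determinantal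 point process $\mathcal{X}_\rho$ with correlation kernel $K_\rho$ (Macchi–Soshnikov theorem). *)

theory Defs
  imports "HOL-Probability.Probability" "Jordan_Normal_Form.Determinant"
begin

section \<open>Reproducing kernels in the space of square integrable functions on the plane\<close>

text \<open>
  Area measure on the complex plane is \<^term>\<open>lborel :: complex measure\<close>. The elements of a
  reproducing kernel space are functions, not classes modulo null sets, so the ambient space is
  rendered as the set of all Borel representatives.
\<close>

definition L2_functions :: "(complex \<Rightarrow> complex) set" where
  "L2_functions =
     {f \<in> borel_measurable lborel. integrable lborel (\<lambda>z. (norm (f z))\<^sup>2)}"

definition L2_norm :: "(complex \<Rightarrow> complex) \<Rightarrow> real" where
  "L2_norm f = sqrt (LINT z|lborel. (norm (f z))\<^sup>2)"

text \<open>
  In the closedness clause a limit is only determined up to a null set, hence the limit is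
  required to agree almost everywhere with an element of the space. Continuity of point
  evaluations makes that element unique.
\<close>

definition closed_function_subspace :: "(complex \<Rightarrow> complex) set \<Rightarrow> bool" where
  "closed_function_subspace H \<longleftrightarrow>
     H \<subseteq> L2_functions \<and>
     (\<lambda>z. 0) \<in> H \<and>
     (\<forall>f\<in>H. \<forall>g\<in>H. (\<lambda>z. f z + g z) \<in> H) \<and>
     (\<forall>c. \<forall>f\<in>H. (\<lambda>z. c * f z) \<in> H) \<and>
     (\<forall>F. \<forall>f\<in>L2_functions.
        (\<forall>n::nat. F n \<in> H) \<and> (\<lambda>n. L2_norm (\<lambda>z. F n z - f z)) \<longlonglongrightarrow> 0 \<longrightarrow>
        (\<exists>g\<in>H. AE z in lborel. g z = f z))"

definition continuous_point_evaluations :: "(complex \<Rightarrow> complex) set \<Rightarrow> bool" where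
  "continuous_point_evaluations H \<longleftrightarrow>
     (\<forall>z. \<exists>C. \<forall>f\<in>H. norm (f z) \<le> C * L2_norm f)"

definition reproducing_kernel_of ::
  "(complex \<Rightarrow> complex) set \<Rightarrow> (complex \<Rightarrow> complex \<Rightarrow> complex) \<Rightarrow> bool" where
  "reproducing_kernel_of H K \<longleftrightarrow>
     (\<forall>w. (\<lambda>z. K z w) \<in> H) \<and>
     (\<forall>f\<in>H. \<forall>w. f w = (LINT z|lborel. f z * cnj (K z w)))"

definition hermitian_reproducing_kernel :: "(complex \<Rightarrow> complex \<Rightarrow> complex) \<Rightarrow> bool" where
  "hermitian_reproducing_kernel K \<longleftrightarrow>
     (\<exists>H. closed_function_subspace H \<and> continuous_point_evaluations H \<and>
          reproducing_kernel_of H K)"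

definition dilated_kernel ::
  "real \<Rightarrow> (complex \<Rightarrow> complex \<Rightarrow> complex) \<Rightarrow> complex \<Rightarrow> complex \<Rightarrow> complex" where
  "dilated_kernel \<rho> K z w =
     of_real \<rho> * K (of_real (sqrt \<rho>) * z) (of_real (sqrt \<rho>) * w)"

section \<open>Determinantal point processes\<close>

text \<open>
  A Borel measure on the plane that is finite on compact sets is automatically regular, so these
  are exactly the integer-valued positive Radon measures.
\<close>

definition point_measure :: "complex measure \<Rightarrow> bool" where
  "point_measure N \<longleftrightarrow>
     sets N = sets borel \<and>
     (\<forall>C. compact C \<longrightarrow> emeasure N C < \<infinity>) \<and>
     (\<forall>E\<in>sets borel. emeasure N E \<in> range ennreal_of_enat)"

definition point_process :: "'w measure \<Rightarrow> ('w \<Rightarrow> complex measure) \<Rightarrow> bool" where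
  "point_process M X \<longleftrightarrow>
     prob_space M \<and>
     (\<forall>\<omega>\<in>space M. point_measure (X \<omega>)) \<and>
     (\<forall>E\<in>sets borel. (\<lambda>\<omega>. emeasure (X \<omega>) E) \<in> borel_measurable M)"

definition simple_point_process :: "'w measure \<Rightarrow> ('w \<Rightarrow> complex measure) \<Rightarrow> bool" where
  "simple_point_process M X \<longleftrightarrow>
     point_process M X \<and> (AE \<omega> in M. \<forall>x. emeasure (X \<omega>) {x} \<le> 1)"

definition correlation_function ::
  "'w measure \<Rightarrow> ('w \<Rightarrow> complex measure) \<Rightarrow> nat \<Rightarrow> ((nat \<Rightarrow> complex) \<Rightarrow> real) \<Rightarrow> bool" where
  "correlation_function M X n r \<longleftrightarrow>
     r \<in> borel_measurable (\<Pi>\<^sub>M j\<in>{..<n}. lborel) \<and>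
     (\<forall>x. 0 \<le> r x) \<and>
     (\<forall>E. (\<forall>j<n. E j \<in> sets borel) \<and> disjoint_family_on E {..<n} \<longrightarrow>
        (\<integral>\<^sup>+\<omega>. (\<Prod>j<n. emeasure (X \<omega>) (E j)) \<partial>M) =
        (\<integral>\<^sup>+x\<in>(\<Pi>\<^sub>E j\<in>{..<n}. E j). ennreal (r x) \<partial>(\<Pi>\<^sub>M j\<in>{..<n}. lborel)))"

text \<open>
  The determinant is a complex number; asking it to equal a nonnegative real correlation function
  is no restriction for a Hermitian positive semidefinite kernel.
\<close>

definition determinantal_process ::
  "'w measure \<Rightarrow> ('w \<Rightarrow> complex measure) \<Rightarrow> (complex \<Rightarrow> complex \<Rightarrow> complex) \<Rightarrow> bool" where
  "determinantal_process M X K \<longleftrightarrow>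
     simple_point_process M X \<and>
     (\<forall>n\<ge>1. \<exists>r. correlation_function M X n r \<and>
        (\<forall>x. of_real (r x) = Determinant.det (mat n n (\<lambda>(k, j). K (x k) (x j)))))"

definition points :: "complex measure \<Rightarrow> complex set" where
  "points N = {x. emeasure N {x} \<noteq> 0}"

text \<open>For compactly supported \<^term>\<open>f\<close> the sum below has finitely many nonzero terms.\<close>

definition linear_statistic :: "(complex \<Rightarrow> real) \<Rightarrow> complex measure \<Rightarrow> real" where
  "linear_statistic f N = (\<Sum>\<^sub>\<infinity>x\<in>points N. f x)"

section \<open>Test functions\<close>

fun C_k :: "nat \<Rightarrow> ('a::euclidean_space \<Rightarrow> real) \<Rightarrow> bool" where
  "C_k 0 f \<longleftrightarrow> continuous_on UNIV f"
| "C_k (Suc k) f \<longleftrightarrow>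
     (\<forall>x. f differentiable (at x)) \<and>
     (\<forall>b\<in>Basis. C_k k (\<lambda>x. frechet_derivative f (at x) b))"

definition compactly_supported :: "('a::topological_space \<Rightarrow> real) \<Rightarrow> bool" where
  "compactly_supported f \<longleftrightarrow> compact (closure {x. f x \<noteq> 0})"

definition gradient :: "(complex \<Rightarrow> real) \<Rightarrow> complex \<Rightarrow> complex" where
  "gradient f z = Complex (frechet_derivative f (at z) 1) (frechet_derivative f (at z) \<i>)"

definition limit_mean :: "(complex \<Rightarrow> real) \<Rightarrow> (complex \<Rightarrow> real) \<Rightarrow> real" where
  "limit_mean \<phi> f = \<phi> 0 * (LINT z|lborel. f z)"

definition limit_variance :: "(complex \<Rightarrow> real) \<Rightarrow> (complex \<Rightarrow> real) \<Rightarrow> real" where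
  "limit_variance \<phi> f =
     1 / 2 * (LINT w|lborel. LINT z|lborel. (inner (gradient f z) w)\<^sup>2 * (\<phi> w)\<^sup>2)"

section \<open>Convergence in distribution\<close>

definition normal_law :: "real \<Rightarrow> real \<Rightarrow> real measure" where
  "normal_law m v =
     (if v = 0 then return borel m else density lborel (normal_density m (sqrt v)))"

text \<open>
  Convergence along an arbitrary filter in the sense of \<^const>\<open>weak_conv_m\<close>, which is only
  available for sequences. The random variables may live on different probability spaces. The
  measurability clause is needed because \<^const>\<open>distr\<close> is junk for a nonmeasurable function.
\<close>

definition converges_in_distribution ::
  "('i \<Rightarrow> 'w measure) \<Rightarrow> ('i \<Rightarrow> 'w \<Rightarrow> real) \<Rightarrow> real measure \<Rightarrow> 'i filter \<Rightarrow> bool" where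
  "converges_in_distribution M Y \<nu> F \<longleftrightarrow>
     (\<forall>\<^sub>F i in F. Y i \<in> borel_measurable (M i)) \<and>
     (\<forall>x. isCont (cdf \<nu>) x \<longrightarrow>
        ((\<lambda>i. cdf (distr (M i) borel (Y i)) x) \<longlongrightarrow> cdf \<nu> x) F)"

end

theory Submission
  imports Defs "HOL-Complex_Analysis.Complex_Analysis"
begin

text \<open>
  Let \<open>g = exp (t f) - 1\<close> with \<open>\<bar>t\<bar>\<close> so small that \<open>\<bar>g\<bar> \<le> 1 / 2\<close>, and let \<open>P\<close> be the projection with kernel
  \<open>dilated_kernel \<rho> K\<close>. The Laplace functional \<open>E exp (t Tr f)\<close> is the Fredholm determinant of \<open>1 + g P\<close>;
  by Newton's identities it equals \<open>exp (\<Sum>m. - (- 1) ^ m / m * Tr ((g P) ^ m))\<close>.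
  If \<open>(g P) ^ m\<close> were \<open>g ^ m P\<close>, the exponent would be \<open>Tr (ln (1 + g) P) = t \<rho> \<mu>\<close>.
  The difference is quadratic in the commutator \<open>[g, P]\<close>, whose Hilbert--Schmidt norm stays bounded
  while its operator norm is of order \<open>1 / sqrt \<rho>\<close>, so all further commutators are negligible and summing over \<open>m\<close>
  the correction is a quarter of the double integral of \<open>((g z - g w) / (1 + g z))\<^sup>2 \<bar>K z w\<bar>\<^sup>2\<close>, which tends to
  \<open>t\<^sup>2 \<sigma>\<^sup>2 / 2\<close>. Hence the Laplace transforms converge on a real interval around \<open>0\<close>, by Vitali's
  theorem on a complex strip, in particular on the imaginary axis, and Levy's theorem applies.
\<close>

section \<open>Kernels with uniformly integrable sections\<close>

text \<open>Operators appear throughout as concrete integral kernels. \<open>schur\<close> kernels,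
  whose compositions converge absolutely at every pair of points, stand for bounded operators; a
  trace is taken only under an integrable weight; Hilbert--Schmidt norms occur as explicit upper
  bounds \<open>hsb\<close>. Three numbers govern the error: \<open>A\<close> for the commutator and
  \<open>E\<close> for the double commutator in Hilbert--Schmidt norm, and \<epsilon> for the row
  integrals of the commutator. After dilation they have order 1, \<rho> to the power -1/4 and \<rho>
  to the power -1/2, and every error term contains \<open>E\<close> or \<epsilon>. The quarter and
  the weight 1 / (1 + g z)^2 have one source: the m-th trace deviates by m (m - 1) / 4 times a form
  in g ^ (m - 2), and multiplying by (-1) ^ m / m and summing gives a quarter of the differentiated
  geometric series. Two obstacles lie outside this computation. Correlation functions describe
  disjoint sets only, so the Laplace functional is reached through fine grids. And only the modulus
  of \<open>K\<close> is continuous, so joint measurability of \<open>K\<close> has to be derived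
  from the reproducing property.\<close>

lemma borel_measurable_cnj[measurable (raw)]:
  "f \<in> borel_measurable M \<Longrightarrow> (\<lambda>x. cnj (f x)) \<in> borel_measurable M"
  by (rule measurable_compose[OF _ borel_measurable_continuous_onI]) (auto intro: continuous_intros)

locale kernel_space = sigma_finite_measure M for M :: "'a measure" +
  assumes space_UNIV: "space M = UNIV"
begin

sublocale pair: pair_sigma_finite M M ..

definition bfun :: "('a \<Rightarrow> complex) \<Rightarrow> bool" where
  "bfun a \<longleftrightarrow> a \<in> borel_measurable M \<and> (\<exists>b. \<forall>x. norm (a x) \<le> b)"

text \<open>Boundedness at every point, rather than almost everywhere, gives the diagonal values and
  hence traces a meaning. Together with the uniform bounds on row and column integrals it makes
  every composition converge absolutely and keeps the class closed under composition.\<close>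

definition schur :: "('a \<Rightarrow> 'a \<Rightarrow> complex) \<Rightarrow> bool" where
  "schur k \<longleftrightarrow> case_prod k \<in> borel_measurable (M \<Otimes>\<^sub>M M) \<and>
     (\<exists>b\<ge>0. (\<forall>z w. norm (k z w) \<le> b) \<and>
        (\<forall>z. (\<integral>\<^sup>+w. ennreal (norm (k z w)) \<partial>M) \<le> ennreal b) \<and>
        (\<forall>w. (\<integral>\<^sup>+z. ennreal (norm (k z w)) \<partial>M) \<le> ennreal b))"

definition comp :: "('a \<Rightarrow> 'a \<Rightarrow> complex) \<Rightarrow> ('a \<Rightarrow> 'a \<Rightarrow> complex) \<Rightarrow> 'a \<Rightarrow> 'a \<Rightarrow> complex"
    (infixl "\<bullet>\<bullet>" 70) where
  "(k \<bullet>\<bullet> l) z w = (LINT u|M. k z u * l u w)"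

definition lmul :: "('a \<Rightarrow> complex) \<Rightarrow> ('a \<Rightarrow> 'a \<Rightarrow> complex) \<Rightarrow> 'a \<Rightarrow> 'a \<Rightarrow> complex"
    (infixr "\<star>" 75) where
  "(a \<star> k) z w = a z * k z w"

definition rmul :: "('a \<Rightarrow> 'a \<Rightarrow> complex) \<Rightarrow> ('a \<Rightarrow> complex) \<Rightarrow> 'a \<Rightarrow> 'a \<Rightarrow> complex" where
  "rmul k a z w = k z w * a w"

definition trace :: "('a \<Rightarrow> 'a \<Rightarrow> complex) \<Rightarrow> complex" where
  "trace k = (LINT x|M. k x x)"

section \<open>Closure properties of bounded multipliers and Schur kernels\<close>

lemma bfun_measurable[measurable_dest]: "bfun a \<Longrightarrow> a \<in> borel_measurable M"
  by (simp add: bfun_def)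

lemma bfunE:
  assumes "bfun a"
  obtains b where "b \<ge> 0" "\<And>x. norm (a x) \<le> b"
proof -
  obtain b where b: "\<And>x. norm (a x) \<le> b" using assms by (auto simp: bfun_def)
  have "0 \<le> b" using b[of undefined] norm_ge_zero order_trans by blast
  with b show ?thesis using that by blast
qed

lemma schur_measurable: "schur k \<Longrightarrow> case_prod k \<in> borel_measurable (M \<Otimes>\<^sub>M M)"
  by (simp add: schur_def)

lemma schur_measurable':
  assumes "schur k" "f \<in> N \<rightarrow>\<^sub>M M" "g \<in> N \<rightarrow>\<^sub>M M"
  shows "(\<lambda>x. k (f x) (g x)) \<in> borel_measurable N"
proof -
  have "(\<lambda>x. case_prod k (f x, g x)) \<in> borel_measurable N"
    by (rule measurable_compose[OF _ schur_measurable[OF assms(1)]]) (use assms in measurable)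
  then show ?thesis by simp
qed

lemma schurE:
  assumes "schur k"
  obtains b where "b \<ge> 0" "\<And>z w. norm (k z w) \<le> b"
    "\<And>z. (\<integral>\<^sup>+w. ennreal (norm (k z w)) \<partial>M) \<le> ennreal b"
    "\<And>w. (\<integral>\<^sup>+z. ennreal (norm (k z w)) \<partial>M) \<le> ennreal b"
  using assms unfolding schur_def by blast

lemma schur_row_measurable[measurable_dest]: "schur k \<Longrightarrow> k z \<in> borel_measurable M"
  by (rule schur_measurable'[of k]) (auto simp: space_UNIV)

lemma schur_col_measurable: "schur k \<Longrightarrow> (\<lambda>z. k z w) \<in> borel_measurable M"
  by (rule schur_measurable'[of k]) (auto simp: space_UNIV)

lemma bfun_mult: assumes "bfun a" "bfun c" shows "bfun (\<lambda>x. a x * c x)"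
proof -
  obtain b1 where 1: "b1 \<ge> 0" "\<And>x. norm (a x) \<le> b1" using assms bfunE by metis
  obtain b2 where 2: "b2 \<ge> 0" "\<And>x. norm (c x) \<le> b2" using assms bfunE by metis
  have "norm (a x * c x) \<le> b1 * b2" for x
    unfolding norm_mult using 1 2 by (intro mult_mono) auto
  moreover have [measurable]: "a \<in> borel_measurable M" "c \<in> borel_measurable M"
    using assms by (auto simp: bfun_def)
  ultimately show ?thesis unfolding bfun_def by (auto intro!: exI[of _ "b1*b2"])
qed

lemma bfun_const: "bfun (\<lambda>x. c)"
  by (auto simp: bfun_def)

lemma bfun_power: "bfun a \<Longrightarrow> bfun (\<lambda>x. a x ^ n)"
  by (induction n) (auto simp: bfun_const intro: bfun_mult)

lemma schur_bound_intro:
  assumes "case_prod k \<in> borel_measurable (M \<Otimes>\<^sub>M M)"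
    and "schur l" "c \<ge> 0" "\<And>z w. norm (k z w) \<le> c * norm (l z w)"
  shows "schur k"
proof -
  obtain b where b: "b \<ge> 0" "\<And>z w. norm (l z w) \<le> b"
    "\<And>z. (\<integral>\<^sup>+w. ennreal (norm (l z w)) \<partial>M) \<le> ennreal b"
    "\<And>w. (\<integral>\<^sup>+z. ennreal (norm (l z w)) \<partial>M) \<le> ennreal b"
    using schurE[OF assms(2)] by metis
  note [measurable] = schur_row_measurable[OF assms(2)] schur_col_measurable[OF assms(2)]
  have 1: "norm (k z w) \<le> c * b" for z w
    using assms(4)[of z w] b(2)[of z w] assms(3) by (meson mult_left_mono order_trans)
  have 2: "(\<integral>\<^sup>+w. ennreal (norm (k z w)) \<partial>M) \<le> ennreal (c * b)" for z
  proof -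
    have "(\<integral>\<^sup>+w. ennreal (norm (k z w)) \<partial>M) \<le> (\<integral>\<^sup>+w. ennreal c * ennreal (norm (l z w)) \<partial>M)"
      using assms(3,4) by (intro nn_integral_mono) (auto simp: ennreal_mult[symmetric] intro!: ennreal_leI)
    also have "\<dots> = ennreal c * (\<integral>\<^sup>+w. ennreal (norm (l z w)) \<partial>M)"
      by (subst nn_integral_cmult) auto
    also have "\<dots> \<le> ennreal c * ennreal b" using b by (intro mult_left_mono) auto
    finally show ?thesis using assms b by (simp add: ennreal_mult)
  qed
  have 3: "(\<integral>\<^sup>+z. ennreal (norm (k z w)) \<partial>M) \<le> ennreal (c * b)" for w
  proof -
    have "(\<integral>\<^sup>+z. ennreal (norm (k z w)) \<partial>M) \<le> (\<integral>\<^sup>+z. ennreal c * ennreal (norm (l z w)) \<partial>M)"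
      using assms(3,4) by (intro nn_integral_mono) (auto simp: ennreal_mult[symmetric] intro!: ennreal_leI)
    also have "\<dots> = ennreal c * (\<integral>\<^sup>+z. ennreal (norm (l z w)) \<partial>M)"
      by (subst nn_integral_cmult) auto
    also have "\<dots> \<le> ennreal c * ennreal b" using b by (intro mult_left_mono) auto
    finally show ?thesis using assms b by (simp add: ennreal_mult)
  qed
  show ?thesis unfolding schur_def using assms b 1 2 3 by (intro conjI exI[of _ "c*b"]) auto
qed

lemma schur_lmul: assumes "bfun a" "schur k" shows "schur (a \<star> k)"
proof -
  obtain b where b: "b \<ge> 0" "\<And>x. norm (a x) \<le> b" using assms bfunE by metis
  note [measurable (raw)] = schur_measurable'[OF assms(2)]
  note [measurable] = bfun_measurable[OF assms(1)]
  have "case_prod (a \<star> k) = (\<lambda>x. a (fst x) * k (fst x) (snd x))"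
    by (auto simp: lmul_def fun_eq_iff)
  then show ?thesis
    using assms b by (intro schur_bound_intro[OF _ assms(2) b(1)]) (auto simp: lmul_def norm_mult intro!: mult_right_mono)
qed

lemma schur_rmul: assumes "bfun a" "schur k" shows "schur (rmul k a)"
proof -
  obtain b where b: "b \<ge> 0" "\<And>x. norm (a x) \<le> b" using assms bfunE by metis
  note [measurable (raw)] = schur_measurable'[OF assms(2)]
  note [measurable] = bfun_measurable[OF assms(1)]
  have "case_prod (rmul k a) = (\<lambda>x. k (fst x) (snd x) * a (snd x))"
    by (auto simp: rmul_def fun_eq_iff)
  then show ?thesis
    using assms b by (intro schur_bound_intro[OF _ assms(2) b(1)])
      (auto simp: rmul_def norm_mult mult.commute intro!: mult_right_mono)
qed

lemma schur_add: assumes "schur k" "schur l" shows "schur (\<lambda>z w. k z w + l z w)"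
proof -
  note [measurable (raw)] = schur_measurable'[OF assms(1)] schur_measurable'[OF assms(2)]
  note [measurable] = schur_row_measurable[OF assms(1)] schur_col_measurable[OF assms(1)]
    schur_row_measurable[OF assms(2)] schur_col_measurable[OF assms(2)]
  obtain b where b: "b \<ge> 0" "\<And>z w. norm (k z w) \<le> b"
    "\<And>z. (\<integral>\<^sup>+w. ennreal (norm (k z w)) \<partial>M) \<le> ennreal b"
    "\<And>w. (\<integral>\<^sup>+z. ennreal (norm (k z w)) \<partial>M) \<le> ennreal b"
    using schurE[OF assms(1)] by metis
  obtain c where c: "c \<ge> 0" "\<And>z w. norm (l z w) \<le> c"
    "\<And>z. (\<integral>\<^sup>+w. ennreal (norm (l z w)) \<partial>M) \<le> ennreal c"
    "\<And>w. (\<integral>\<^sup>+z. ennreal (norm (l z w)) \<partial>M) \<le> ennreal c"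
    using schurE[OF assms(2)] by metis
  have 1: "norm (k z w + l z w) \<le> b + c" for z w
    using b(2)[of z w] c(2)[of z w] norm_triangle_ineq[of "k z w" "l z w"] by linarith
  have 2: "(\<integral>\<^sup>+w. ennreal (norm (k z w + l z w)) \<partial>M) \<le> ennreal (b + c)" for z
  proof -
    have "(\<integral>\<^sup>+w. ennreal (norm (k z w + l z w)) \<partial>M) \<le> (\<integral>\<^sup>+w. ennreal (norm (k z w)) + ennreal (norm (l z w)) \<partial>M)"
      by (intro nn_integral_mono) (auto simp: ennreal_plus[symmetric] norm_triangle_ineq simp del: ennreal_plus intro!: ennreal_leI)
    also have "\<dots> = (\<integral>\<^sup>+w. ennreal (norm (k z w)) \<partial>M) + (\<integral>\<^sup>+w. ennreal (norm (l z w)) \<partial>M)"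
      by (subst nn_integral_add) auto
    also have "\<dots> \<le> ennreal b + ennreal c" using b c by (intro add_mono) auto
    finally show ?thesis using b c by simp
  qed
  have 3: "(\<integral>\<^sup>+z. ennreal (norm (k z w + l z w)) \<partial>M) \<le> ennreal (b + c)" for w
  proof -
    have "(\<integral>\<^sup>+z. ennreal (norm (k z w + l z w)) \<partial>M) \<le> (\<integral>\<^sup>+z. ennreal (norm (k z w)) + ennreal (norm (l z w)) \<partial>M)"
      by (intro nn_integral_mono) (auto simp: ennreal_plus[symmetric] norm_triangle_ineq simp del: ennreal_plus intro!: ennreal_leI)
    also have "\<dots> = (\<integral>\<^sup>+z. ennreal (norm (k z w)) \<partial>M) + (\<integral>\<^sup>+z. ennreal (norm (l z w)) \<partial>M)"
      by (subst nn_integral_add) auto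
    also have "\<dots> \<le> ennreal b + ennreal c" using b c by (intro add_mono) auto
    finally show ?thesis using b c by simp
  qed
  have [simp]: "case_prod (\<lambda>z w. k z w + l z w) = (\<lambda>x. k (fst x) (snd x) + l (fst x) (snd x))"
    by auto
  show ?thesis unfolding schur_def using b c 1 2 3
    by (intro conjI exI[of _ "b+c"]) auto
qed

lemma schur_cmult: "schur k \<Longrightarrow> schur (\<lambda>z w. c * k z w)"
  using schur_lmul[OF bfun_const[of c], of k] by (simp add: lmul_def[abs_def])

lemma schur_diff: assumes "schur k" "schur l" shows "schur (\<lambda>z w. k z w - l z w)"
  using schur_add[OF assms(1) schur_cmult[OF assms(2), of "-1"]] by simp

lemma integrable_row: assumes "schur k" shows "integrable M (\<lambda>w. k z w)"
proof (rule integrableI_bounded)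
  note [measurable (raw)] = schur_measurable'[OF assms]
  show "(\<lambda>w. k z w) \<in> borel_measurable M"
    by (rule schur_measurable'[OF assms]) (auto simp: space_UNIV)
  show "(\<integral>\<^sup>+w. ennreal (norm (k z w)) \<partial>M) < \<infinity>"
    using schurE[OF assms] by (metis ennreal_less_top infinity_ennreal_def order_le_less_trans)
qed

lemma integrable_col: assumes "schur k" shows "integrable M (\<lambda>z. k z w)"
proof (rule integrableI_bounded)
  show "(\<lambda>z. k z w) \<in> borel_measurable M"
    by (rule schur_measurable'[OF assms]) (auto simp: space_UNIV)
  show "(\<integral>\<^sup>+z. ennreal (norm (k z w)) \<partial>M) < \<infinity>"
    using schurE[OF assms] by (metis ennreal_less_top infinity_ennreal_def order_le_less_trans)
qed

lemma integrable_mult_bfun: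
  assumes "integrable M (h :: 'a \<Rightarrow> complex)" "bfun a" shows "integrable M (\<lambda>x. h x * a x)"
proof -
  obtain b where b: "b \<ge> 0" "\<And>x. norm (a x) \<le> b" using assms bfunE by metis
  note [measurable] = bfun_measurable[OF assms(2)] borel_measurable_integrable[OF assms(1)]
  show ?thesis
    by (rule Bochner_Integration.integrable_bound[OF integrable_mult_right[OF assms(1), of "of_real b"]])
      (use b in \<open>auto simp: norm_mult mult.commute intro!: mult_left_mono mult_right_mono\<close>)
qed

lemma bfun_col: assumes "schur k" shows "bfun (\<lambda>z. k z w)"
  unfolding bfun_def using schurE[OF assms] borel_measurable_integrable[OF integrable_col[OF assms]] by metis

lemma bfun_diag: assumes "schur k" shows "bfun (\<lambda>z. k z z)"
proof -
  have "(\<lambda>z. k z z) \<in> borel_measurable M"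
    by (rule schur_measurable'[OF assms]) auto
  then show ?thesis
    unfolding bfun_def using schurE[OF assms] by metis
qed

lemma integrable_comp: assumes "schur k" "schur l" shows "integrable M (\<lambda>u. k z u * l u w)"
  using integrable_mult_bfun[OF integrable_row[OF assms(1)] bfun_col[OF assms(2)]] .

lemma norm_comp_le:
  assumes "schur k" "schur l"
  shows "ennreal (norm ((k \<bullet>\<bullet> l) z w)) \<le> (\<integral>\<^sup>+u. ennreal (norm (k z u)) * ennreal (norm (l u w)) \<partial>M)"
proof -
  have "ennreal (norm ((k \<bullet>\<bullet> l) z w)) \<le> (\<integral>\<^sup>+u. ennreal (norm (k z u * l u w)) \<partial>M)"
    unfolding comp_def by (rule integral_norm_bound_ennreal[OF integrable_comp[OF assms]])
  then show ?thesis by (simp add: norm_mult ennreal_mult)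
qed

lemma comp_measurable:
  assumes "schur k" "schur l"
  shows "case_prod (k \<bullet>\<bullet> l) \<in> borel_measurable (M \<Otimes>\<^sub>M M)"
proof -
  note [measurable (raw)] = schur_measurable'[OF assms(1)] schur_measurable'[OF assms(2)]
  have "case_prod (k \<bullet>\<bullet> l) = (\<lambda>x. LINT u|M. k (fst x) u * l u (snd x))"
    by (auto simp: comp_def fun_eq_iff)
  then show ?thesis by simp
qed

text \<open>The supremum bound pairs a row integral of the left kernel with the supremum of the
  right one; row and column integrals multiply by Tonelli.\<close>

lemma schur_comp: assumes "schur k" "schur l" shows "schur (k \<bullet>\<bullet> l)"
proof -
  note [measurable (raw)] = schur_measurable'[OF assms(1)] schur_measurable'[OF assms(2)]
  note [measurable] = schur_row_measurable[OF assms(1)] schur_col_measurable[OF assms(1)]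
    schur_row_measurable[OF assms(2)] schur_col_measurable[OF assms(2)]
  obtain b where b: "b \<ge> 0" "\<And>z w. norm (k z w) \<le> b"
    "\<And>z. (\<integral>\<^sup>+w. ennreal (norm (k z w)) \<partial>M) \<le> ennreal b"
    "\<And>w. (\<integral>\<^sup>+z. ennreal (norm (k z w)) \<partial>M) \<le> ennreal b"
    using schurE[OF assms(1)] by metis
  obtain c where c: "c \<ge> 0" "\<And>z w. norm (l z w) \<le> c"
    "\<And>z. (\<integral>\<^sup>+w. ennreal (norm (l z w)) \<partial>M) \<le> ennreal c"
    "\<And>w. (\<integral>\<^sup>+z. ennreal (norm (l z w)) \<partial>M) \<le> ennreal c"
    using schurE[OF assms(2)] by metis
  have m1[measurable]: "k z \<in> borel_measurable M" for z
    using borel_measurable_integrable[OF integrable_row[OF assms(1)]] .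
  have m2[measurable]: "(\<lambda>z. l z w) \<in> borel_measurable M" for w
    using borel_measurable_integrable[OF integrable_col[OF assms(2)]] .
  have 1: "norm ((k \<bullet>\<bullet> l) z w) \<le> b * c" for z w
  proof -
    have "ennreal (norm ((k \<bullet>\<bullet> l) z w)) \<le> (\<integral>\<^sup>+u. ennreal (norm (k z u)) * ennreal (norm (l u w)) \<partial>M)"
      by (rule norm_comp_le[OF assms])
    also have "\<dots> \<le> (\<integral>\<^sup>+u. ennreal (norm (k z u)) * ennreal c \<partial>M)"
      using c by (intro nn_integral_mono mult_left_mono ennreal_leI) auto
    also have "\<dots> = (\<integral>\<^sup>+u. ennreal (norm (k z u)) \<partial>M) * ennreal c"
      by (rule nn_integral_multc) auto
    also have "\<dots> \<le> ennreal b * ennreal c" using b by (intro mult_right_mono) auto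
    finally show ?thesis using b c by (simp add: ennreal_mult[symmetric] ennreal_le_iff)
  qed
  have 2: "(\<integral>\<^sup>+w. ennreal (norm ((k \<bullet>\<bullet> l) z w)) \<partial>M) \<le> ennreal (b * c)" for z
  proof -
    have "(\<integral>\<^sup>+w. ennreal (norm ((k \<bullet>\<bullet> l) z w)) \<partial>M) \<le>
        (\<integral>\<^sup>+w. \<integral>\<^sup>+u. ennreal (norm (k z u)) * ennreal (norm (l u w)) \<partial>M \<partial>M)"
      by (intro nn_integral_mono norm_comp_le assms)
    also have "\<dots> = (\<integral>\<^sup>+u. \<integral>\<^sup>+w. ennreal (norm (k z u)) * ennreal (norm (l u w)) \<partial>M \<partial>M)"
      by (rule pair.Fubini') simp
    also have "\<dots> = (\<integral>\<^sup>+u. ennreal (norm (k z u)) * (\<integral>\<^sup>+w. ennreal (norm (l u w)) \<partial>M) \<partial>M)"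
      by (intro nn_integral_cong nn_integral_cmult)
        (use borel_measurable_integrable[OF integrable_row[OF assms(2)]] in auto)
    also have "\<dots> \<le> (\<integral>\<^sup>+u. ennreal (norm (k z u)) * ennreal c \<partial>M)"
      using c by (intro nn_integral_mono mult_left_mono) auto
    also have "\<dots> = (\<integral>\<^sup>+u. ennreal (norm (k z u)) \<partial>M) * ennreal c"
      by (rule nn_integral_multc) auto
    also have "\<dots> \<le> ennreal b * ennreal c" using b by (intro mult_right_mono) auto
    finally show ?thesis using b c by (simp add: ennreal_mult)
  qed
  have 3: "(\<integral>\<^sup>+z. ennreal (norm ((k \<bullet>\<bullet> l) z w)) \<partial>M) \<le> ennreal (b * c)" for w
  proof -
    have "(\<integral>\<^sup>+z. ennreal (norm ((k \<bullet>\<bullet> l) z w)) \<partial>M) \<le>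
        (\<integral>\<^sup>+z. \<integral>\<^sup>+u. ennreal (norm (k z u)) * ennreal (norm (l u w)) \<partial>M \<partial>M)"
      by (intro nn_integral_mono norm_comp_le assms)
    also have "\<dots> = (\<integral>\<^sup>+u. \<integral>\<^sup>+z. ennreal (norm (k z u)) * ennreal (norm (l u w)) \<partial>M \<partial>M)"
      by (rule pair.Fubini') simp
    also have "\<dots> = (\<integral>\<^sup>+u. (\<integral>\<^sup>+z. ennreal (norm (k z u)) \<partial>M) * ennreal (norm (l u w)) \<partial>M)"
      by (intro nn_integral_cong nn_integral_multc)
        (use borel_measurable_integrable[OF integrable_col[OF assms(1)]] in auto)
    also have "\<dots> \<le> (\<integral>\<^sup>+u. ennreal b * ennreal (norm (l u w)) \<partial>M)"
      using b by (intro nn_integral_mono mult_right_mono) auto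
    also have "\<dots> = ennreal b * (\<integral>\<^sup>+u. ennreal (norm (l u w)) \<partial>M)"
      by (rule nn_integral_cmult) auto
    also have "\<dots> \<le> ennreal b * ennreal c" using c by (intro mult_left_mono) auto
    finally show ?thesis using b c by (simp add: ennreal_mult)
  qed
  show ?thesis unfolding schur_def using b c 1 2 3 comp_measurable[OF assms]
    by (intro conjI exI[of _ "b*c"]) auto
qed

text \<open>One integrable outer factor, a Schur kernel and one bounded outer factor suffice for
  absolute convergence. This is the common Fubini hypothesis behind associativity and the trace
  identities.\<close>

lemma integrable_triple:
  assumes "integrable M (p :: 'a \<Rightarrow> complex)" "schur l" "bfun r"
  shows "integrable (M \<Otimes>\<^sub>M M) (\<lambda>(u, v). p u * l u v * r v)"
proof (rule integrableI_bounded)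
  note [measurable (raw)] = schur_measurable'[OF assms(2)]
  note [measurable] = borel_measurable_integrable[OF assms(1)] bfun_measurable[OF assms(3)]
  show m: "(\<lambda>(u, v). p u * l u v * r v) \<in> borel_measurable (M \<Otimes>\<^sub>M M)"
    unfolding case_prod_beta by measurable
  obtain c where c: "c \<ge> 0" "\<And>z w. norm (l z w) \<le> c"
    "\<And>z. (\<integral>\<^sup>+w. ennreal (norm (l z w)) \<partial>M) \<le> ennreal c"
    "\<And>w. (\<integral>\<^sup>+z. ennreal (norm (l z w)) \<partial>M) \<le> ennreal c"
    using schurE[OF assms(2)] by metis
  obtain d where d: "d \<ge> 0" "\<And>x. norm (r x) \<le> d" using assms bfunE by metis
  have "(\<integral>\<^sup>+x. ennreal (norm (case x of (u, v) \<Rightarrow> p u * l u v * r v)) \<partial>(M \<Otimes>\<^sub>M M))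
     = (\<integral>\<^sup>+u. \<integral>\<^sup>+v. ennreal (norm (p u * l u v * r v)) \<partial>M \<partial>M)"
    using m by (subst nn_integral_fst[symmetric]) auto
  also have "\<dots> \<le> (\<integral>\<^sup>+u. \<integral>\<^sup>+v. ennreal (norm (p u) * d) * ennreal (norm (l u v)) \<partial>M \<partial>M)"
  proof (intro nn_integral_mono)
    fix u v
    have "norm (p u * l u v * r v) \<le> (norm (p u) * d) * norm (l u v)"
      using mult_left_mono[OF d(2)[of v], of "norm (p u) * norm (l u v)"] by (simp add: norm_mult mult_ac)
    then show "ennreal (norm (p u * l u v * r v)) \<le> ennreal (norm (p u) * d) * ennreal (norm (l u v))"
      using d by (simp add: ennreal_mult[symmetric] ennreal_leI)
  qed
  also have "\<dots> = (\<integral>\<^sup>+u. ennreal (norm (p u) * d) * (\<integral>\<^sup>+v. ennreal (norm (l u v)) \<partial>M) \<partial>M)"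
      by (intro nn_integral_cong nn_integral_cmult)
        (use borel_measurable_integrable[OF integrable_row[OF assms(2)]] in auto)
  also have "\<dots> \<le> (\<integral>\<^sup>+u. ennreal (norm (p u) * d) * ennreal c \<partial>M)"
    using c by (intro nn_integral_mono mult_left_mono) auto
  also have "\<dots> = (\<integral>\<^sup>+u. ennreal (norm (p u) * (d * c)) \<partial>M)"
    using c d by (simp add: ennreal_mult[symmetric] mult.assoc)
  also have "\<dots> < \<infinity>"
  proof -
    have "integrable M (\<lambda>u. norm (p u) * (d * c))"
      by (intro integrable_mult_left integrable_norm assms)
    then have "(\<integral>\<^sup>+u. ennreal (norm (norm (p u) * (d * c))) \<partial>M) < \<infinity>"
      by (simp only: integrable_iff_bounded)
    then show ?thesis using c d by (simp only: real_norm_def abs_mult abs_norm_cancel abs_of_nonneg)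
  qed
  finally show "(\<integral>\<^sup>+x. ennreal (norm (case x of (u, v) \<Rightarrow> p u * l u v * r v)) \<partial>(M \<Otimes>\<^sub>M M)) < \<infinity>" .
qed

lemma comp_assoc: assumes "schur k" "schur l" "schur m" shows "(k \<bullet>\<bullet> l) \<bullet>\<bullet> m = k \<bullet>\<bullet> (l \<bullet>\<bullet> m)"
proof (intro ext)
  fix z w
  have i: "integrable (M \<Otimes>\<^sub>M M) (\<lambda>(u, v). k z u * l u v * m v w)"
    by (rule integrable_triple[OF integrable_row[OF assms(1)] assms(2) bfun_col[OF assms(3)]])
  have "((k \<bullet>\<bullet> l) \<bullet>\<bullet> m) z w = (LINT v|M. LINT u|M. k z u * l u v * m v w)"
    unfolding comp_def by simp
  also have "\<dots> = (LINT u|M. LINT v|M. k z u * l u v * m v w)"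
    by (rule pair.Fubini_integral[OF i])
  also have "\<dots> = (k \<bullet>\<bullet> (l \<bullet>\<bullet> m)) z w"
    unfolding comp_def by (simp add: mult.assoc)
  finally show "((k \<bullet>\<bullet> l) \<bullet>\<bullet> m) z w = (k \<bullet>\<bullet> (l \<bullet>\<bullet> m)) z w" .
qed

lemma comp_diff_left: "schur k \<Longrightarrow> schur l \<Longrightarrow> schur m \<Longrightarrow>
   (\<lambda>z w. k z w - l z w) \<bullet>\<bullet> m = (\<lambda>z w. (k \<bullet>\<bullet> m) z w - (l \<bullet>\<bullet> m) z w)"
  by (intro ext) (simp add: comp_def left_diff_distrib integrable_comp)

lemma comp_diff_right: "schur k \<Longrightarrow> schur l \<Longrightarrow> schur m \<Longrightarrow>
   m \<bullet>\<bullet> (\<lambda>z w. k z w - l z w) = (\<lambda>z w. (m \<bullet>\<bullet> k) z w - (m \<bullet>\<bullet> l) z w)"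
  by (intro ext) (simp add: comp_def right_diff_distrib integrable_comp)

lemma lmul_comp: "(a \<star> k) \<bullet>\<bullet> l = a \<star> (k \<bullet>\<bullet> l)"
  by (intro ext) (simp add: comp_def lmul_def mult.assoc)

lemma comp_rmul: "k \<bullet>\<bullet> rmul l a = rmul (k \<bullet>\<bullet> l) a"
  by (intro ext) (simp add: comp_def rmul_def mult.assoc[symmetric])

lemma rmul_comp: "rmul k a \<bullet>\<bullet> l = k \<bullet>\<bullet> (a \<star> l)"
  by (intro ext) (simp add: comp_def rmul_def lmul_def mult.assoc)

lemma lmul_lmul: "a \<star> c \<star> k = (\<lambda>x. a x * c x) \<star> k"
  by (intro ext) (simp add: lmul_def mult.assoc)

lemma lmul_diff: "a \<star> (\<lambda>z w. k z w - l z w) = (\<lambda>z w. (a \<star> k) z w - (a \<star> l) z w)"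
  by (intro ext) (simp add: lmul_def right_diff_distrib)

text \<open>Only kernels with an integrable factor have a trace; the weight \<open>a\<close> supplies it.\<close>

lemma integrable_trace: assumes "integrable M a" "schur k" shows "integrable M (\<lambda>x. (a \<star> k) x x)"
  using integrable_mult_bfun[OF assms(1) bfun_diag[OF assms(2)]] by (simp add: lmul_def)

text \<open>The second kernel is replaced by its supremum, which reduces the claim to
  \<open>integrable_triple\<close> with a constant right factor.\<close>

lemma integrable_pair_trace:
  assumes "integrable M a" "schur k" "schur l"
  shows "integrable (M \<Otimes>\<^sub>M M) (\<lambda>(z, w). a z * k z w * l w z)"
proof -
  note [measurable (raw)] = schur_measurable'[OF assms(2)] schur_measurable'[OF assms(3)]
  note [measurable] = borel_measurable_integrable[OF assms(1)]
  obtain c where c: "c \<ge> 0" "\<And>z w. norm (l z w) \<le> c"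
    using schurE[OF assms(3)] by metis
  have "integrable (M \<Otimes>\<^sub>M M) (\<lambda>(z, w). a z * k z w * of_real c)"
    by (rule integrable_triple[OF assms(1,2) bfun_const])
  then show ?thesis
    by (rule Bochner_Integration.integrable_bound)
     (use c in \<open>auto simp: case_prod_beta norm_mult intro!: mult_left_mono AE_I2\<close>)
qed

lemma integral_pair_trace:
  assumes "integrable M a" "schur k" "schur l"
  shows "(LINT x|(M \<Otimes>\<^sub>M M). a (fst x) * k (fst x) (snd x) * l (snd x) (fst x)) = trace (a \<star> (k \<bullet>\<bullet> l))"
proof -
  have "(LINT x|(M \<Otimes>\<^sub>M M). a (fst x) * k (fst x) (snd x) * l (snd x) (fst x))
    = (LINT z|M. LINT w|M. a z * k z w * l w z)"
    using pair.integral_fst[OF integrable_pair_trace[OF assms]] by (simp add: case_prod_beta')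
  then show ?thesis by (simp add: trace_def lmul_def comp_def mult.assoc)
qed

lemma integral_pair_trace':
  assumes "integrable M a" "schur k" "schur l"
  shows "(LINT x|(M \<Otimes>\<^sub>M M). a (snd x) * k (fst x) (snd x) * l (snd x) (fst x)) = trace (a \<star> (l \<bullet>\<bullet> k))"
proof -
  have i: "integrable (M \<Otimes>\<^sub>M M) (\<lambda>(z, w). a z * l z w * k w z)"
    by (rule integrable_pair_trace[OF assms(1,3,2)])
  have "(LINT x|(M \<Otimes>\<^sub>M M). a (snd x) * k (fst x) (snd x) * l (snd x) (fst x))
     = (LINT x|(M \<Otimes>\<^sub>M M). (\<lambda>(z, w). a z * l z w * k w z) (snd x, fst x))"
    by (simp add: mult_ac)
  also have "\<dots> = (LINT x|(M \<Otimes>\<^sub>M M). (\<lambda>(z, w). a z * l z w * k w z) x)"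
    using pair.integral_product_swap[OF borel_measurable_integrable[OF i]] by (simp add: case_prod_beta')
  also have "\<dots> = trace (a \<star> (l \<bullet>\<bullet> k))"
    using integral_pair_trace[OF assms(1,3,2)] by (simp add: case_prod_beta')
  finally show ?thesis .
qed

text \<open>Both sides are the same integral over pairs of points, read once with the weight
  \<open>a\<close> at the first variable and once with the weight \<open>c\<close> at the
  second.\<close>

lemma trace_cyclic:
  assumes "integrable M a" "bfun a" "integrable M c" "bfun c" "schur k" "schur l"
  shows "trace (a \<star> (k \<bullet>\<bullet> (c \<star> l))) = trace (c \<star> (l \<bullet>\<bullet> (a \<star> k)))"
proof -
  have "trace (a \<star> (k \<bullet>\<bullet> (c \<star> l))) =
     (LINT x|(M \<Otimes>\<^sub>M M). a (fst x) * k (fst x) (snd x) * (c \<star> l) (snd x) (fst x))"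
    by (rule integral_pair_trace[symmetric]) (auto intro: assms schur_lmul)
  also have "\<dots> = (LINT x|(M \<Otimes>\<^sub>M M). c (snd x) * (a \<star> k) (fst x) (snd x) * l (snd x) (fst x))"
    by (simp add: lmul_def mult.assoc mult.left_commute mult.commute)
  also have "\<dots> = trace (c \<star> (l \<bullet>\<bullet> (a \<star> k)))"
    by (rule integral_pair_trace') (auto intro: assms schur_lmul)
  finally show ?thesis .
qed

end

section \<open>Hilbert--Schmidt kernels and commutators\<close>

text \<open>Induction through x ^ Suc n - y ^ Suc n = x ^ n * (x - y) + y * (x ^ n - y ^ n). Writing
  q ^ n / q avoids the truncated exponent n - 1 at n = 0.\<close>

lemma abs_power_diff_le:
  fixes x y q :: real
  assumes "\<bar>x\<bar> \<le> q" "\<bar>y\<bar> \<le> q" "q > 0"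
  shows "\<bar>x ^ n - y ^ n\<bar> \<le> real n * (q ^ n / q) * \<bar>x - y\<bar>"
proof (induction n)
  case (Suc n)
  have "x ^ Suc n - y ^ Suc n = x ^ n * (x - y) + y * (x ^ n - y ^ n)" by (simp add: algebra_simps)
  then have "\<bar>x ^ Suc n - y ^ Suc n\<bar> \<le> \<bar>x ^ n * (x - y)\<bar> + \<bar>y * (x ^ n - y ^ n)\<bar>"
    using abs_triangle_ineq by metis
  also have "\<bar>x ^ n * (x - y)\<bar> \<le> q ^ n * \<bar>x - y\<bar>"
    using assms by (auto simp: abs_mult power_abs intro!: mult_right_mono power_mono)
  also have "\<bar>y * (x ^ n - y ^ n)\<bar> \<le> q * (real n * (q ^ n / q) * \<bar>x - y\<bar>)"
    unfolding abs_mult using assms Suc by (intro mult_mono) auto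
  also have "q ^ n * \<bar>x - y\<bar> + q * (real n * (q ^ n / q) * \<bar>x - y\<bar>) = real (Suc n) * (q ^ Suc n / q) * \<bar>x - y\<bar>"
    using assms by (simp add: field_simps)
  finally show ?case by simp
qed simp

text \<open>The error at Suc n is \<open>y\<close> times the error at \<open>n\<close> minus n x ^
  (n - 1) (x - y)^2, and the quadratic growth of the constant absorbs this because n^2 + n \<le> (n
  + 1)^2.\<close>

lemma abs_power_diff_linear_le:
  fixes x y q :: real
  assumes "\<bar>x\<bar> \<le> q" "\<bar>y\<bar> \<le> q" "q > 0"
  shows "\<bar>x ^ n - y ^ n - real n * x ^ (n - 1) * (x - y)\<bar> \<le> (real n)\<^sup>2 * (q ^ n / q\<^sup>2) * (x - y)\<^sup>2"
proof (induction n)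
  case (Suc n)
  have eq: "x ^ Suc n - y ^ Suc n - real (Suc n) * x ^ (Suc n - 1) * (x - y)
     = y * (x ^ n - y ^ n - real n * x ^ (n - 1) * (x - y)) - real n * x ^ (n - 1) * (x - y)\<^sup>2"
    by (cases n) (simp_all add: algebra_simps power2_eq_square)
  have 1: "\<bar>y * (x ^ n - y ^ n - real n * x ^ (n - 1) * (x - y))\<bar> \<le> q * ((real n)\<^sup>2 * (q ^ n / q\<^sup>2) * (x - y)\<^sup>2)"
    unfolding abs_mult using assms Suc by (intro mult_mono) auto
  have 2: "\<bar>real n * x ^ (n - 1) * (x - y)\<^sup>2\<bar> \<le> real n * (q ^ n / q) * (x - y)\<^sup>2"
  proof (cases n)
    case (Suc l)
    then show ?thesis using assms
      by (auto simp: abs_mult power_abs intro!: mult_right_mono mult_left_mono power_mono)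
  qed simp
  have "q * ((real n)\<^sup>2 * (q ^ n / q\<^sup>2) * (x - y)\<^sup>2) + real n * (q ^ n / q) * (x - y)\<^sup>2
      = ((real n)\<^sup>2 + real n) * ((q ^ n / q) * (x - y)\<^sup>2)"
    using assms by (simp add: field_simps power2_eq_square)
  also have "\<dots> \<le> (real (Suc n))\<^sup>2 * ((q ^ n / q) * (x - y)\<^sup>2)"
  proof (rule mult_right_mono)
    show "0 \<le> q ^ n / q * (x - y)\<^sup>2" using assms by simp
  qed (simp add: power2_eq_square algebra_simps)
  also have "\<dots> = (real (Suc n))\<^sup>2 * (q ^ Suc n / q\<^sup>2) * (x - y)\<^sup>2"
    using assms by (simp add: field_simps power2_eq_square)
  finally show ?case unfolding eq using 1 2 by linarith
qed simp

lemma ennreal_power2_le: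
  assumes "x ^ 2 \<le> ennreal c ^ 2" "c \<ge> 0" shows "x \<le> ennreal c"
proof (cases x)
  case (real r)
  then show ?thesis using assms by (auto simp: ennreal_power intro!: ennreal_leI dest: power2_le_imp_le)
next
  case top
  then show ?thesis using assms by (auto simp: ennreal_power top_unique)
qed

section \<open>Adjoints, Hilbert--Schmidt bounds and Schur's test\<close>

context kernel_space begin

definition adj :: "('a \<Rightarrow> 'a \<Rightarrow> complex) \<Rightarrow> 'a \<Rightarrow> 'a \<Rightarrow> complex" where
  "adj k z w = cnj (k w z)"

lemma schur_adj: assumes "schur k" shows "schur (adj k)"
proof -
  note [measurable (raw)] = schur_measurable'[OF assms]
  have "case_prod (adj k) = (\<lambda>x. cnj (k (snd x) (fst x)))" by (auto simp: adj_def)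
  moreover have "(\<lambda>x. cnj (k (snd x) (fst x))) \<in> borel_measurable (M \<Otimes>\<^sub>M M)" by measurable
  ultimately show ?thesis using assms unfolding schur_def adj_def by auto
qed

lemma adj_comp: "adj (k \<bullet>\<bullet> l) = adj l \<bullet>\<bullet> adj k"
  by (intro ext) (simp add: adj_def comp_def mult.commute flip: Bochner_Integration.integral_cnj)

lemma integrable_sq_col: assumes "schur k" shows "integrable M (\<lambda>z. (norm (k z w))\<^sup>2)"
proof -
  have "integrable M (\<lambda>z. adj k w z * k z w)" by (intro integrable_comp schur_adj assms)
  from integrable_norm[OF this] show ?thesis by (simp add: adj_def norm_mult power2_eq_square)
qed

text \<open>The Hilbert--Schmidt norm enters only through an upper bound \<open>A\<close>: estimates
  then multiply bounds, and finiteness is part of the predicate.\<close>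

definition hsb :: "('a \<Rightarrow> 'a \<Rightarrow> complex) \<Rightarrow> real \<Rightarrow> bool" where
  "hsb k A \<longleftrightarrow> case_prod k \<in> borel_measurable (M \<Otimes>\<^sub>M M) \<and> 0 \<le> A \<and>
     (\<integral>\<^sup>+x. ennreal ((norm (k (fst x) (snd x)))\<^sup>2) \<partial>(M \<Otimes>\<^sub>M M)) \<le> ennreal (A\<^sup>2)"

definition ip :: "('a \<Rightarrow> 'a \<Rightarrow> complex) \<Rightarrow> ('a \<Rightarrow> 'a \<Rightarrow> complex) \<Rightarrow> complex" where
  "ip k l = (LINT x|(M \<Otimes>\<^sub>M M). k (fst x) (snd x) * cnj (l (fst x) (snd x)))"

lemma hsb_measurable: "hsb k A \<Longrightarrow> (\<lambda>x. k (fst x) (snd x)) \<in> borel_measurable (M \<Otimes>\<^sub>M M)"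
  by (simp add: hsb_def case_prod_beta')

lemma hsb_nn_prod:
  assumes "hsb k A" "hsb l B"
  shows "(\<integral>\<^sup>+x. ennreal (norm (k (fst x) (snd x) * cnj (l (fst x) (snd x)))) \<partial>(M \<Otimes>\<^sub>M M)) \<le> ennreal (A * B)"
proof -
  note [measurable] = hsb_measurable[OF assms(1)] hsb_measurable[OF assms(2)]
  let ?I = "\<integral>\<^sup>+x. ennreal (norm (k (fst x) (snd x))) * ennreal (norm (l (fst x) (snd x))) \<partial>(M \<Otimes>\<^sub>M M)"
  have "?I\<^sup>2 \<le> (\<integral>\<^sup>+x. ennreal (norm (k (fst x) (snd x))) ^ 2 \<partial>(M \<Otimes>\<^sub>M M)) *
     (\<integral>\<^sup>+x. ennreal (norm (l (fst x) (snd x))) ^ 2 \<partial>(M \<Otimes>\<^sub>M M))"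
    by (rule Cauchy_Schwarz_nn_integral) measurable
  also have "\<dots> \<le> ennreal (A\<^sup>2) * ennreal (B\<^sup>2)"
    using assms unfolding hsb_def by (intro mult_mono) (auto simp: ennreal_power)
  also have "\<dots> = ennreal (A * B) ^ 2"
    using assms by (simp add: hsb_def ennreal_mult[symmetric] power_mult_distrib ennreal_power)
  finally have "?I \<le> ennreal (A * B)"
    using assms by (intro ennreal_power2_le) (auto simp: hsb_def)
  then show ?thesis by (simp add: norm_mult ennreal_mult)
qed

lemma hsb_integrable:
  assumes "hsb k A" "hsb l B"
  shows "integrable (M \<Otimes>\<^sub>M M) (\<lambda>x. k (fst x) (snd x) * cnj (l (fst x) (snd x)))"
proof (rule integrableI_bounded)
  note [measurable] = hsb_measurable[OF assms(1)] hsb_measurable[OF assms(2)]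
  show "(\<lambda>x. k (fst x) (snd x) * cnj (l (fst x) (snd x))) \<in> borel_measurable (M \<Otimes>\<^sub>M M)"
    by measurable
qed (use hsb_nn_prod[OF assms] in \<open>auto simp: order_le_less_trans\<close>)

lemma norm_ip_le: assumes "hsb k A" "hsb l B" shows "norm (ip k l) \<le> A * B"
proof -
  have "ennreal (norm (ip k l)) \<le> ennreal (A * B)"
    unfolding ip_def by (rule order_trans[OF integral_norm_bound_ennreal[OF hsb_integrable[OF assms]] hsb_nn_prod[OF assms]])
  moreover have "A * B \<ge> 0" using assms by (simp add: hsb_def)
  ultimately show ?thesis by (simp add: ennreal_le_iff)
qed

lemma hsb_bound:
  assumes "hsb l A" "case_prod k \<in> borel_measurable (M \<Otimes>\<^sub>M M)" "c \<ge> 0"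
    "\<And>z w. norm (k z w) \<le> c * norm (l z w)"
  shows "hsb k (c * A)"
proof -
  note [measurable] = hsb_measurable[OF assms(1)]
  have "(\<integral>\<^sup>+x. ennreal ((norm (k (fst x) (snd x)))\<^sup>2) \<partial>(M \<Otimes>\<^sub>M M)) \<le>
     (\<integral>\<^sup>+x. ennreal (c\<^sup>2) * ennreal ((norm (l (fst x) (snd x)))\<^sup>2) \<partial>(M \<Otimes>\<^sub>M M))"
    using assms(3,4) by (intro nn_integral_mono)
      (auto simp: ennreal_mult[symmetric] power_mult_distrib[symmetric] intro!: ennreal_leI power_mono)
  also have "\<dots> = ennreal (c\<^sup>2) * (\<integral>\<^sup>+x. ennreal ((norm (l (fst x) (snd x)))\<^sup>2) \<partial>(M \<Otimes>\<^sub>M M))"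
    by (rule nn_integral_cmult) measurable
  also have "\<dots> \<le> ennreal (c\<^sup>2) * ennreal (A\<^sup>2)"
    using assms by (intro mult_left_mono) (auto simp: hsb_def)
  also have "\<dots> = ennreal ((c * A)\<^sup>2)" by (simp add: ennreal_mult[symmetric] power_mult_distrib)
  finally show ?thesis using assms unfolding hsb_def by auto
qed

lemma hsb_lmul:
  assumes "hsb k A" "a \<in> borel_measurable M" "\<And>x. norm (a x) \<le> c"
  shows "hsb (a \<star> k) (c * A)"
proof (rule hsb_bound[OF assms(1)])
  note [measurable] = hsb_measurable[OF assms(1)] assms(2)
  have "case_prod (a \<star> k) = (\<lambda>x. a (fst x) * k (fst x) (snd x))"
    by (auto simp: lmul_def fun_eq_iff)
  then show "case_prod (a \<star> k) \<in> borel_measurable (M \<Otimes>\<^sub>M M)" by simp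
  show "0 \<le> c" using assms(3)[of undefined] norm_ge_zero order_trans by blast
qed (use assms in \<open>auto simp: lmul_def norm_mult intro!: mult_right_mono\<close>)

lemma hsb_rmul:
  assumes "hsb k A" "a \<in> borel_measurable M" "\<And>x. norm (a x) \<le> c"
  shows "hsb (rmul k a) (c * A)"
proof (rule hsb_bound[OF assms(1)])
  note [measurable] = hsb_measurable[OF assms(1)] assms(2)
  have "case_prod (rmul k a) = (\<lambda>x. k (fst x) (snd x) * a (snd x))"
    by (auto simp: rmul_def fun_eq_iff)
  then show "case_prod (rmul k a) \<in> borel_measurable (M \<Otimes>\<^sub>M M)" by simp
  show "0 \<le> c" using assms(3)[of undefined] norm_ge_zero order_trans by blast
qed (use assms in \<open>auto simp: rmul_def norm_mult mult.commute[of _ "norm (a _)"] intro!: mult_right_mono\<close>)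

lemma hs_snd:
  assumes "case_prod k \<in> borel_measurable (M \<Otimes>\<^sub>M M)"
  shows "(\<integral>\<^sup>+x. ennreal ((norm (k (fst x) (snd x)))\<^sup>2) \<partial>(M \<Otimes>\<^sub>M M)) = (\<integral>\<^sup>+w. \<integral>\<^sup>+z. ennreal ((norm (k z w))\<^sup>2) \<partial>M \<partial>M)"
proof -
  have [measurable]: "(\<lambda>x. k (fst x) (snd x)) \<in> borel_measurable (M \<Otimes>\<^sub>M M)"
    using assms by (simp add: case_prod_beta')
  show ?thesis by (subst pair.nn_integral_snd[symmetric]) auto
qed

text \<open>Schur's test, column by column. Writing |c| as a product of two square roots,
  Cauchy--Schwarz bounds the squared composition at (z, w) by \<epsilon> times the integral of |c|
  |k|^2, and integrating in z costs the second \<epsilon>. Row and column integrals thus act as an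
  operator norm.\<close>

lemma hsb_schur_test:
  assumes "hsb k A" "schur k" "schur c" "\<epsilon> \<ge> 0"
    and 1: "\<And>z. (\<integral>\<^sup>+w. ennreal (norm (c z w)) \<partial>M) \<le> ennreal \<epsilon>"
    and 2: "\<And>w. (\<integral>\<^sup>+z. ennreal (norm (c z w)) \<partial>M) \<le> ennreal \<epsilon>"
  shows "hsb (c \<bullet>\<bullet> k) (\<epsilon> * A)"
proof -
  note [measurable (raw)] = schur_measurable'[OF assms(2)] schur_measurable'[OF assms(3)]
  note [measurable] = schur_row_measurable[OF assms(2)] schur_col_measurable[OF assms(2)]
     schur_row_measurable[OF assms(3)] schur_col_measurable[OF assms(3)]
  have pt: "ennreal ((norm ((c \<bullet>\<bullet> k) z w))\<^sup>2) \<le> ennreal \<epsilon> * (\<integral>\<^sup>+u. ennreal (norm (c z u)) * ennreal ((norm (k u w))\<^sup>2) \<partial>M)" for z w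
  proof -
    have "ennreal (norm ((c \<bullet>\<bullet> k) z w)) \<le> (\<integral>\<^sup>+u. ennreal (norm (c z u)) * ennreal (norm (k u w)) \<partial>M)"
      by (rule norm_comp_le[OF assms(3,2)])
    also have "\<dots> = (\<integral>\<^sup>+u. ennreal (sqrt (norm (c z u))) * ennreal (sqrt (norm (c z u)) * norm (k u w)) \<partial>M)"
      by (intro nn_integral_cong) (simp add: ennreal_mult[symmetric] mult.assoc[symmetric])
    finally have "ennreal (norm ((c \<bullet>\<bullet> k) z w)) ^ 2 \<le> (\<integral>\<^sup>+u. ennreal (sqrt (norm (c z u))) * ennreal (sqrt (norm (c z u)) * norm (k u w)) \<partial>M) ^ 2"
      by (rule power_mono) simp
    also have "\<dots> \<le> (\<integral>\<^sup>+u. ennreal (sqrt (norm (c z u))) ^ 2 \<partial>M) * (\<integral>\<^sup>+u. ennreal (sqrt (norm (c z u)) * norm (k u w)) ^ 2 \<partial>M)"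
      by (rule Cauchy_Schwarz_nn_integral) measurable
    also have "\<dots> = (\<integral>\<^sup>+u. ennreal (norm (c z u)) \<partial>M) * (\<integral>\<^sup>+u. ennreal (norm (c z u)) * ennreal ((norm (k u w))\<^sup>2) \<partial>M)"
      by (simp add: ennreal_power power_mult_distrib ennreal_mult)
    also have "\<dots> \<le> ennreal \<epsilon> * (\<integral>\<^sup>+u. ennreal (norm (c z u)) * ennreal ((norm (k u w))\<^sup>2) \<partial>M)"
      by (intro mult_right_mono 1) simp
    finally show ?thesis by (simp add: ennreal_power)
  qed
  have col: "(\<integral>\<^sup>+z. ennreal ((norm ((c \<bullet>\<bullet> k) z w))\<^sup>2) \<partial>M) \<le> ennreal (\<epsilon>\<^sup>2) * (\<integral>\<^sup>+u. ennreal ((norm (k u w))\<^sup>2) \<partial>M)" for w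
  proof -
    have "(\<integral>\<^sup>+z. ennreal ((norm ((c \<bullet>\<bullet> k) z w))\<^sup>2) \<partial>M) \<le>
       (\<integral>\<^sup>+z. ennreal \<epsilon> * (\<integral>\<^sup>+u. ennreal (norm (c z u)) * ennreal ((norm (k u w))\<^sup>2) \<partial>M) \<partial>M)"
      by (intro nn_integral_mono pt)
    also have "\<dots> = ennreal \<epsilon> * (\<integral>\<^sup>+z. \<integral>\<^sup>+u. ennreal (norm (c z u)) * ennreal ((norm (k u w))\<^sup>2) \<partial>M \<partial>M)"
      by (rule nn_integral_cmult) measurable
    also have "(\<integral>\<^sup>+z. \<integral>\<^sup>+u. ennreal (norm (c z u)) * ennreal ((norm (k u w))\<^sup>2) \<partial>M \<partial>M) =
       (\<integral>\<^sup>+u. \<integral>\<^sup>+z. ennreal (norm (c z u)) * ennreal ((norm (k u w))\<^sup>2) \<partial>M \<partial>M)"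
      by (rule pair.Fubini'[symmetric]) measurable
    also have "\<dots> = (\<integral>\<^sup>+u. (\<integral>\<^sup>+z. ennreal (norm (c z u)) \<partial>M) * ennreal ((norm (k u w))\<^sup>2) \<partial>M)"
      by (intro nn_integral_cong nn_integral_multc) measurable
    also have "\<dots> \<le> (\<integral>\<^sup>+u. ennreal \<epsilon> * ennreal ((norm (k u w))\<^sup>2) \<partial>M)"
      by (intro nn_integral_mono mult_right_mono 2) simp
    also have "\<dots> = ennreal \<epsilon> * (\<integral>\<^sup>+u. ennreal ((norm (k u w))\<^sup>2) \<partial>M)"
      by (rule nn_integral_cmult) measurable
    finally show ?thesis using assms(4)
      by (simp add: power2_eq_square ennreal_mult mult.assoc mult_left_mono)
  qed
  have "(\<integral>\<^sup>+x. ennreal ((norm ((c \<bullet>\<bullet> k) (fst x) (snd x)))\<^sup>2) \<partial>(M \<Otimes>\<^sub>M M)) \<le>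
     (\<integral>\<^sup>+w. ennreal (\<epsilon>\<^sup>2) * (\<integral>\<^sup>+z. ennreal ((norm (k z w))\<^sup>2) \<partial>M) \<partial>M)"
    by (subst hs_snd) (auto intro!: nn_integral_mono col comp_measurable assms)
  also have "\<dots> = ennreal (\<epsilon>\<^sup>2) * (\<integral>\<^sup>+w. (\<integral>\<^sup>+z. ennreal ((norm (k z w))\<^sup>2) \<partial>M) \<partial>M)"
    by (rule nn_integral_cmult) measurable
  also have "\<dots> \<le> ennreal (\<epsilon>\<^sup>2) * ennreal (A\<^sup>2)"
    using assms(1) by (intro mult_left_mono) (auto simp: hsb_def hs_snd)
  also have "\<dots> = ennreal ((\<epsilon> * A)\<^sup>2)" by (simp add: ennreal_mult[symmetric] power_mult_distrib)
  finally show ?thesis using assms comp_measurable[OF assms(3,2)] unfolding hsb_def by auto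
qed

lemma ip_diff_left:
  assumes "hsb k A" "hsb l B" "hsb m C"
  shows "ip (\<lambda>z w. k z w - l z w) m = ip k m - ip l m"
  unfolding ip_def using hsb_integrable[OF assms(1,3)] hsb_integrable[OF assms(2,3)]
  by (simp add: left_diff_distrib)

lemma ip_add_right:
  assumes "hsb m C" "hsb k A" "hsb l B"
  shows "ip m (\<lambda>z w. k z w + l z w) = ip m k + ip m l"
  unfolding ip_def using hsb_integrable[OF assms(1,2)] hsb_integrable[OF assms(1,3)]
  by (simp add: distrib_left)

end

section \<open>Orthogonal projections and their commutators with multiplication operators\<close>

locale projection_kernel = kernel_space M for M :: "'a measure" +
  fixes K :: "'a \<Rightarrow> 'a \<Rightarrow> complex"
  assumes schur_K: "schur K" and hermitian: "K w z = cnj (K z w)" and reproducing: "K \<bullet>\<bullet> K = K"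
begin

lemma adj_K: "adj K = K"
  by (intro ext) (simp add: adj_def hermitian[symmetric])

lemma K_idem: "schur k \<Longrightarrow> K \<bullet>\<bullet> (K \<bullet>\<bullet> k) = K \<bullet>\<bullet> k"
  using comp_assoc[OF schur_K schur_K] reproducing by metis

text \<open>For p = K k the projection property gives, in each column, that the squared norm of p is
  the inner product of p and k. The arithmetic-geometric mean inequality bounds this by half the sum
  of both squared norms, and the half belonging to p is absorbed.\<close>

lemma contraction_col:
  assumes "schur k"
  shows "(LINT z|M. (norm ((K \<bullet>\<bullet> k) z w))\<^sup>2) \<le> (LINT z|M. (norm (k z w))\<^sup>2)"
proof -
  define p where "p = K \<bullet>\<bullet> k"
  have sp: "schur p" unfolding p_def by (intro schur_comp schur_K assms)
  have "adj p \<bullet>\<bullet> p = (adj k \<bullet>\<bullet> K) \<bullet>\<bullet> p" unfolding p_def adj_comp adj_K ..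
  also have "\<dots> = adj k \<bullet>\<bullet> (K \<bullet>\<bullet> p)" by (rule comp_assoc) (auto intro: schur_adj assms schur_K sp)
  also have "K \<bullet>\<bullet> p = p" unfolding p_def by (rule K_idem[OF assms])
  finally have eq: "(adj p \<bullet>\<bullet> p) w w = (adj k \<bullet>\<bullet> p) w w" by simp
  have "of_real (LINT z|M. (norm (p z w))\<^sup>2) = (adj p \<bullet>\<bullet> p) w w"
    unfolding comp_def adj_def integral_complex_of_real[symmetric]
    by (intro Bochner_Integration.integral_cong) (auto simp: complex_norm_square[symmetric] mult.commute)
  then have "(LINT z|M. (norm (p z w))\<^sup>2) = Re ((adj k \<bullet>\<bullet> p) w w)" using eq by (metis Re_complex_of_real)
  also have "\<dots> \<le> norm ((adj k \<bullet>\<bullet> p) w w)" by (rule complex_Re_le_cmod)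
  also have "\<dots> \<le> (LINT z|M. norm (adj k w z * p z w))" unfolding comp_def by (rule integral_norm_bound)
  also have "\<dots> \<le> (LINT z|M. ((norm (k z w))\<^sup>2 + (norm (p z w))\<^sup>2) / 2)"
  proof (rule integral_mono)
    show "integrable M (\<lambda>z. norm (adj k w z * p z w))"
      by (intro integrable_norm integrable_comp schur_adj assms sp)
    show "integrable M (\<lambda>z. ((norm (k z w))\<^sup>2 + (norm (p z w))\<^sup>2) / 2)"
      using integrable_sq_col assms sp by simp
    show "norm (adj k w z * p z w) \<le> ((norm (k z w))\<^sup>2 + (norm (p z w))\<^sup>2) / 2" for z
      using sum_squares_bound[of "norm (k z w)" "norm (p z w)"] by (simp add: adj_def norm_mult)
  qed
  also have "\<dots> = ((LINT z|M. (norm (k z w))\<^sup>2) + (LINT z|M. (norm (p z w))\<^sup>2)) / 2"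
    using integrable_sq_col[OF assms] integrable_sq_col[OF sp] by simp
  finally show ?thesis unfolding p_def by simp
qed

lemma hsb_K: assumes "hsb k A" "schur k" shows "hsb (K \<bullet>\<bullet> k) A"
proof -
  have s: "schur (K \<bullet>\<bullet> k)" by (intro schur_comp schur_K assms)
  have "(\<integral>\<^sup>+z. ennreal ((norm ((K \<bullet>\<bullet> k) z w))\<^sup>2) \<partial>M) \<le> (\<integral>\<^sup>+z. ennreal ((norm (k z w))\<^sup>2) \<partial>M)" for w
    using contraction_col[OF assms(2), of w] integrable_sq_col[OF s, of w] integrable_sq_col[OF assms(2), of w]
    by (simp add: nn_integral_eq_integral ennreal_leI)
  then have "(\<integral>\<^sup>+x. ennreal ((norm ((K \<bullet>\<bullet> k) (fst x) (snd x)))\<^sup>2) \<partial>(M \<Otimes>\<^sub>M M)) \<le>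
     (\<integral>\<^sup>+x. ennreal ((norm (k (fst x) (snd x)))\<^sup>2) \<partial>(M \<Otimes>\<^sub>M M))"
    using schur_measurable[OF assms(2)] schur_measurable[OF s] by (simp add: hs_snd nn_integral_mono)
  then show ?thesis using assms schur_measurable[OF s] unfolding hsb_def by auto
qed

text \<open>The kernel of a K - K a. The factored form shows that a Lipschitz \<open>a\<close> makes
  it small near the diagonal.\<close>

definition commutator :: "('a \<Rightarrow> complex) \<Rightarrow> 'a \<Rightarrow> 'a \<Rightarrow> complex" where
  "commutator a z w = (a z - a w) * K z w"

lemma commutator_eq: "commutator a = (\<lambda>z w. (a \<star> K) z w - rmul K a z w)"
  by (intro ext) (simp add: commutator_def lmul_def rmul_def algebra_simps)

lemma schur_commutator: "bfun a \<Longrightarrow> schur (commutator a)"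
  unfolding commutator_eq by (intro schur_diff schur_lmul schur_rmul schur_K)

lemma integrable_pair_trace_fst:
  assumes "integrable M a" "schur k" "schur l"
  shows "integrable (M \<Otimes>\<^sub>M M) (\<lambda>x. a (fst x) * k (fst x) (snd x) * l (snd x) (fst x))"
  using integrable_pair_trace[OF assms] by (simp add: case_prod_beta')

lemma integrable_pair_trace_snd:
  assumes "integrable M a" "schur k" "schur l"
  shows "integrable (M \<Otimes>\<^sub>M M) (\<lambda>x. a (snd x) * k (fst x) (snd x) * l (snd x) (fst x))"
  using pair.integrable_product_swap[OF integrable_pair_trace[OF assms(1,3,2)]]
  by (simp add: case_prod_beta' mult_ac)

text \<open>As \<open>a\<close> is real and \<open>K\<close> hermitian, the conjugate of the
  commutator is (a z - a w) K w z; its two halves can be integrated separately against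
  \<open>p\<close> because each carries an integrable weight.\<close>

lemma ip_commutator:
  assumes "schur p" "bfun a" "integrable M a" "\<And>x. cnj (a x) = a x"
  shows "ip p (commutator a) = trace (a \<star> (p \<bullet>\<bullet> K)) - trace (a \<star> (K \<bullet>\<bullet> p))"
proof -
  have "ip p (commutator a) = (LINT x|(M \<Otimes>\<^sub>M M). a (fst x) * p (fst x) (snd x) * K (snd x) (fst x)
      - a (snd x) * p (fst x) (snd x) * K (snd x) (fst x))"
    unfolding ip_def commutator_def by (intro Bochner_Integration.integral_cong)
      (auto simp: assms(4) hermitian[symmetric] algebra_simps)
  also have "\<dots> = (LINT x|(M \<Otimes>\<^sub>M M). a (fst x) * p (fst x) (snd x) * K (snd x) (fst x))
      - (LINT x|(M \<Otimes>\<^sub>M M). a (snd x) * p (fst x) (snd x) * K (snd x) (fst x))"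
    by (intro Bochner_Integration.integral_diff integrable_pair_trace_fst integrable_pair_trace_snd assms schur_K)
  finally show ?thesis
    using integral_pair_trace[OF assms(3,1) schur_K] integral_pair_trace'[OF assms(3,1) schur_K] by simp
qed

end

section \<open>Compressed powers and the telescoping trace formula\<close>

locale projection_symbol = projection_kernel M K for M :: "'a measure" and K +
  fixes g :: "'a \<Rightarrow> real" and q :: real
  assumes g_integrable: "integrable M g" and g_bound: "\<And>x. \<bar>g x\<bar> \<le> q" and q_pos: "q > 0"
begin

definition G :: "'a \<Rightarrow> complex" where "G x = of_real (g x)"

lemma bfun_G: "bfun G"
  using g_integrable g_bound unfolding bfun_def G_def by (auto intro!: exI[of _ q])

lemma norm_G: "norm (G x) \<le> q" by (simp add: G_def g_bound)

lemma norm_G_power: "norm (G x ^ n) \<le> q ^ n"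
  by (simp add: norm_power norm_G power_mono)

lemma integrable_G: "integrable M G" using g_integrable by (simp add: G_def[abs_def])

lemma integrable_G_power: "n \<ge> 1 \<Longrightarrow> integrable M (\<lambda>x. G x ^ n)"
  using integrable_mult_bfun[OF integrable_G bfun_power[OF bfun_G, of "n - 1"]]
  by (cases n) auto

lemma bfun_G_power: "bfun (\<lambda>x. G x ^ n)" by (rule bfun_power[OF bfun_G])

lemma cnj_G[simp]: "cnj (G x) = G x" by (simp add: G_def)

text \<open>\<open>T j\<close> is the kernel of K (G K)^j, so trace (G \<star> T (m - 1)) is the
  trace of the m-th power of G K. The projections at both ends absorb further factors
  \<open>K\<close>, and since \<open>K\<close> is a contraction each factor \<open>G\<close> costs
  at most q in norm.\<close>

primrec T :: "nat \<Rightarrow> 'a \<Rightarrow> 'a \<Rightarrow> complex" where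
  "T 0 = K"
| "T (Suc j) = K \<bullet>\<bullet> (G \<star> T j)"

lemma schur_T: "schur (T j)"
  by (induction j) (auto intro!: schur_K schur_comp schur_lmul bfun_G)

lemma K_T: "K \<bullet>\<bullet> T j = T j"
  by (cases j) (auto simp: reproducing intro!: K_idem schur_lmul bfun_G schur_T)

lemma T_Suc: "T (Suc j) = T j \<bullet>\<bullet> (G \<star> K)"
proof (induction j)
  case (Suc j)
  have "T (Suc (Suc j)) = K \<bullet>\<bullet> (G \<star> T (Suc j))" by simp
  also have "\<dots> = K \<bullet>\<bullet> (G \<star> (T j \<bullet>\<bullet> (G \<star> K)))" by (simp only: Suc)
  also have "\<dots> = K \<bullet>\<bullet> ((G \<star> T j) \<bullet>\<bullet> (G \<star> K))" by (simp only: lmul_comp)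
  also have "\<dots> = (K \<bullet>\<bullet> (G \<star> T j)) \<bullet>\<bullet> (G \<star> K)"
    by (rule comp_assoc[symmetric]) (intro schur_K schur_lmul bfun_G schur_T)+
  finally show ?case by simp
qed simp

lemma T_K: "T j \<bullet>\<bullet> K = T j"
proof (cases j)
  case (Suc i)
  have "T (Suc i) \<bullet>\<bullet> K = T i \<bullet>\<bullet> ((G \<star> K) \<bullet>\<bullet> K)"
    unfolding T_Suc by (rule comp_assoc) (intro schur_K schur_lmul bfun_G schur_T)+
  then show ?thesis using Suc by (simp only: lmul_comp reproducing T_Suc)
qed (simp add: reproducing)

lemma T_comp_Suc: "schur k \<Longrightarrow> T (Suc j) \<bullet>\<bullet> k = K \<bullet>\<bullet> (G \<star> (T j \<bullet>\<bullet> k))"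
  unfolding T.simps by (subst comp_assoc) (auto simp: lmul_comp intro!: schur_K schur_lmul bfun_G schur_T)

lemma hsb_T: assumes "hsb k A" "schur k" shows "hsb (T j \<bullet>\<bullet> k) (q ^ j * A)"
proof (induction j)
  case (Suc j)
  have "hsb (K \<bullet>\<bullet> (G \<star> (T j \<bullet>\<bullet> k))) (q * (q ^ j * A))"
    by (intro hsb_K hsb_lmul Suc schur_lmul bfun_G schur_comp schur_T assms norm_G)
      (use bfun_G in \<open>simp add: bfun_def\<close>)
  then show ?case unfolding T_comp_Suc[OF assms(2)] by (simp add: mult.assoc)
qed (auto intro: hsb_K assms)

abbreviation D :: "'a \<Rightarrow> 'a \<Rightarrow> complex" where "D \<equiv> commutator G"

lemma schur_D: "schur D" by (rule schur_commutator[OF bfun_G])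

lemma T_D: "T j \<bullet>\<bullet> D = (\<lambda>z w. T (Suc j) z w - rmul (T j) G z w)"
  unfolding commutator_eq
  by (subst comp_diff_right) (auto simp only: comp_rmul T_K T_Suc intro!: schur_lmul schur_rmul bfun_G schur_K schur_T)

text \<open>Take p = T j D in \<open>ip_commutator\<close>. Then p K = 0, because T (Suc j) K and T
  j G K both equal T (Suc j), while K p = p = T (Suc j) - T j G, whose weighted trace is the
  negative of the right-hand side.\<close>

lemma trace_step:
  assumes "bfun a" "integrable M a" "\<And>x. cnj (a x) = a x"
  shows "ip (T j \<bullet>\<bullet> D) (commutator a) = trace ((\<lambda>x. G x * a x) \<star> T j) - trace (a \<star> T (Suc j))"
proof -
  have s: "schur (T j \<bullet>\<bullet> D)" by (intro schur_comp schur_T schur_D)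
  have r: "schur (rmul (T j) G)" by (intro schur_rmul schur_T bfun_G)
  have "K \<bullet>\<bullet> (T j \<bullet>\<bullet> D) = T j \<bullet>\<bullet> D"
    by (subst comp_assoc[symmetric]) (auto intro!: schur_T schur_D schur_K simp: K_T)
  then have "trace (a \<star> (K \<bullet>\<bullet> (T j \<bullet>\<bullet> D))) = trace (\<lambda>z w. (a \<star> T (Suc j)) z w - (a \<star> rmul (T j) G) z w)"
    by (simp only: T_D lmul_diff)
  then have "trace (a \<star> (K \<bullet>\<bullet> (T j \<bullet>\<bullet> D))) = trace (a \<star> T (Suc j)) - trace ((\<lambda>x. G x * a x) \<star> T j)"
    using integrable_trace[OF assms(2) schur_T[of "Suc j"]] integrable_trace[OF assms(2) r]
    unfolding trace_def by (simp del: T.simps) (simp add: lmul_def rmul_def mult_ac del: T.simps)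
  moreover have "(T j \<bullet>\<bullet> D) \<bullet>\<bullet> K = (\<lambda>z w. 0)"
  proof -
    have "rmul (T j) G \<bullet>\<bullet> K = T (Suc j)" by (simp only: rmul_comp T_Suc)
    then show ?thesis
      unfolding T_D comp_diff_left[OF schur_T[of "Suc j"] r schur_K] T_K by simp
  qed
  moreover have "trace (a \<star> (\<lambda>z w. 0)) = 0" by (simp add: trace_def lmul_def)
  ultimately show ?thesis unfolding ip_commutator[OF s assms] by simp
qed

lemma trace_telescope:
  assumes "m \<ge> 1"
  shows "trace ((\<lambda>x. G x ^ m) \<star> K) - trace (G \<star> T (m - 1)) =
     (\<Sum>k\<in>{1..<m}. ip (T (m - 1 - k) \<bullet>\<bullet> D) (commutator (\<lambda>x. G x ^ k)))"
proof -
  \<comment> \<open>Interpolates between a single separated factor \<open>G\<close> at k = 1 and the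
    collapsed power G ^ m with T 0 = K at k = m.\<close>
  define u where "u k = trace ((\<lambda>x. G x ^ k) \<star> T (m - k))" for k
  have "ip (T (m - 1 - k) \<bullet>\<bullet> D) (commutator (\<lambda>x. G x ^ k)) = u (Suc k) - u k" if "k \<in> {1..<m}" for k
  proof -
    have "k < m" using that by simp
    then obtain j where "m = Suc (k + j)" using less_imp_Suc_add by blast
    then have m: "m = Suc (j + k)" by simp
    have "ip (T j \<bullet>\<bullet> D) (commutator (\<lambda>x. G x ^ k)) = trace ((\<lambda>x. G x * G x ^ k) \<star> T j) - trace ((\<lambda>x. G x ^ k) \<star> T (Suc j))"
      using that by (intro trace_step bfun_G_power integrable_G_power) auto
    then show ?thesis
      unfolding u_def m by (simp add: Suc_diff_le del: T.simps)
  qed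
  then have "(\<Sum>k\<in>{1..<m}. ip (T (m - 1 - k) \<bullet>\<bullet> D) (commutator (\<lambda>x. G x ^ k))) = (\<Sum>k\<in>{1..<m}. u (Suc k) - u k)"
    by (intro sum.cong) auto
  also have "\<dots> = u m - u 1" using assms by (rule sum_Suc_diff')
  finally show ?thesis by (simp add: u_def)
qed

end

section \<open>Fredholm minors\<close>

lemma det_simultaneous_permute:
  fixes F :: "nat \<Rightarrow> nat \<Rightarrow> 'a :: comm_ring_1"
  assumes p: "p permutes {0..<n}"
  shows "Determinant.det (mat n n (\<lambda>(k, l). F (p k) (p l))) = Determinant.det (mat n n (\<lambda>(k, l). F k l))"
proof -
  have pn: "p i < n \<longleftrightarrow> i < n" for i
    using permutes_in_image[OF p, of i] by simp
  have step: "Determinant.det (mat n n (\<lambda>(k, l). H (p k) l)) = signof p * Determinant.det (mat n n (\<lambda>(k, l). H k l))"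
    for H :: "nat \<Rightarrow> nat \<Rightarrow> 'a"
  proof -
    have "mat n n (\<lambda>(k, l). H (p k) l) = mat n n (\<lambda>(i, j). mat n n (\<lambda>(k, l). H k l) $$ (p i, j))"
      by (intro eq_matI) (auto simp: pn)
    then show ?thesis using det_permute_rows[OF mat_carrier[of n n "\<lambda>(k, l). H k l"] p] by simp
  qed
  have tr: "Determinant.det (mat n n (\<lambda>(k, l). H l k)) = Determinant.det (mat n n (\<lambda>(k, l). H k l))"
    for H :: "nat \<Rightarrow> nat \<Rightarrow> 'a"
  proof -
    have "mat n n (\<lambda>(k, l). H l k) = transpose_mat (mat n n (\<lambda>(k, l). H k l))"
      by (intro eq_matI) auto
    then show ?thesis using det_transpose[OF mat_carrier[of n n "\<lambda>(k, l). H k l"]] by simp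
  qed
  have "Determinant.det (mat n n (\<lambda>(k, l). F (p k) (p l))) = signof p * Determinant.det (mat n n (\<lambda>(k, l). F k (p l)))"
    by (rule step[of "\<lambda>k l. F k (p l)"])
  also have "Determinant.det (mat n n (\<lambda>(k, l). F k (p l))) = Determinant.det (mat n n (\<lambda>(k, l). F l (p k)))"
    by (rule tr[of "\<lambda>k l. F l (p k)"])
  also have "\<dots> = signof p * Determinant.det (mat n n (\<lambda>(k, l). F l k))"
    by (rule step[of "\<lambda>k l. F l k"])
  also have "Determinant.det (mat n n (\<lambda>(k, l). F l k)) = Determinant.det (mat n n (\<lambda>(k, l). F k l))"
    by (rule tr)
  also have "signof p * (signof p * \<dots>) = \<dots>"
    by (simp add: sign_def mult.assoc[symmetric])
  finally show ?thesis .
qed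

text \<open>The cofactor of the entry (N, j), kept as a determinant of full size so that
  simultaneous permutations of rows and columns act on it.\<close>

definition unit_last_row_det :: "nat \<Rightarrow> (nat \<Rightarrow> nat \<Rightarrow> 'a :: comm_ring_1) \<Rightarrow> nat \<Rightarrow> 'a" where
  "unit_last_row_det N F j =
     Determinant.det (mat (Suc N) (Suc N) (\<lambda>(k, l). if k = N then (if l = j then 1 else 0) else F k l))"

lemma unit_last_row_det_cofactor:
  assumes "j \<le> N"
  shows "unit_last_row_det N F j = cofactor (mat (Suc N) (Suc N) (\<lambda>(k, l). F k l)) N j"
proof -
  let ?B = "mat (Suc N) (Suc N) (\<lambda>(k, l). if k = N then (if l = j then 1 else 0) else F k l)"
  have "unit_last_row_det N F j = (\<Sum>l<Suc N. ?B $$ (N, l) * cofactor ?B N l)"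
    unfolding unit_last_row_det_def by (rule laplace_expansion_row) auto
  also have "\<dots> = (\<Sum>l<Suc N. if l = j then cofactor ?B N l else 0)"
    by (intro sum.cong) auto
  also have "\<dots> = cofactor ?B N j" using assms by (simp add: less_Suc_eq_le)
  also have "mat_delete ?B N j = mat_delete (mat (Suc N) (Suc N) (\<lambda>(k, l). F k l)) N j"
    unfolding mat_delete_def by (intro eq_matI) auto
  then have "cofactor ?B N j = cofactor (mat (Suc N) (Suc N) (\<lambda>(k, l). F k l)) N j"
    by (simp add: cofactor_def)
  finally show ?thesis .
qed

lemma det_last_row:
  "Determinant.det (mat (Suc N) (Suc N) (\<lambda>(k, l). F k l)) = (\<Sum>j<Suc N. F N j * unit_last_row_det N F j)"
proof -
  have "Determinant.det (mat (Suc N) (Suc N) (\<lambda>(k, l). F k l)) = (\<Sum>j<Suc N. mat (Suc N) (Suc N) (\<lambda>(k, l). F k l) $$ (N, j) *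
     cofactor (mat (Suc N) (Suc N) (\<lambda>(k, l). F k l)) N j)"
    by (rule laplace_expansion_row) auto
  also have "\<dots> = (\<Sum>j<Suc N. F N j * unit_last_row_det N F j)"
    by (intro sum.cong refl) (simp add: unit_last_row_det_cofactor less_Suc_eq_le)
  finally show ?thesis .
qed

text \<open>Both indices lie below \<open>N\<close>, so the transposition fixes the last row and
  merely moves its unit entry. After relabelling the integration variables this identifies the
  off-diagonal terms of the expansion with each other.\<close>

lemma unit_last_row_det_transpose:
  assumes "i < N" "j < N"
  shows "unit_last_row_det N (\<lambda>k l. F (Transposition.transpose i j k) (Transposition.transpose i j l)) i
     = unit_last_row_det N F j"
proof -
  let ?t = "Transposition.transpose i j"
  have p: "?t permutes {0..<Suc N}" using assms by (intro permutes_swap_id) auto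
  have "(\<lambda>(k, l). if k = N then (if l = i then 1 else 0) else F (?t k) (?t l)) =
     (\<lambda>(k, l). (\<lambda>k l. if k = N then (if l = j then 1 else 0) else F k l) (?t k) (?t l))"
    using assms by (auto simp: fun_eq_iff Transposition.transpose_def)
  then show ?thesis
    unfolding unit_last_row_det_def
    using det_simultaneous_permute[OF p, of "\<lambda>k l. if k = N then (if l = j then 1 else 0) else F k l"] by simp
qed

lemma unit_last_row_det_last: "unit_last_row_det N F N = Determinant.det (mat N N (\<lambda>(k, l). F k l))"
proof -
  have "mat_delete (mat (Suc N) (Suc N) (\<lambda>(k, l). F k l)) N N = mat N N (\<lambda>(k, l). F k l)"
    unfolding mat_delete_def by (intro eq_matI) auto
  then show ?thesis by (simp add: unit_last_row_det_cofactor cofactor_def power_add[symmetric] mult_2[symmetric] power_mult)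
qed

text \<open>Deleting row Suc n and column n has sign -1 and keeps the border index Suc n as last
  column. This is the minus sign in the recursion for Fredholm minors.\<close>

lemma unit_last_row_det_penultimate:
  "unit_last_row_det (Suc n) F n = - Determinant.det (mat (Suc n) (Suc n) (\<lambda>(k, l). F k (if l < n then l else Suc n)))"
proof -
  have "mat_delete (mat (Suc (Suc n)) (Suc (Suc n)) (\<lambda>(k, l). F k l)) (Suc n) n
     = mat (Suc n) (Suc n) (\<lambda>(k, l). F k (if l < n then l else Suc n))"
    unfolding mat_delete_def by (intro eq_matI) (auto simp: less_Suc_eq)
  moreover have "(-1 :: 'a) ^ (Suc n + n) = -1" by (simp add: power_add[symmetric] mult_2[symmetric] power_mult)
  ultimately show ?thesis by (simp add: unit_last_row_det_cofactor cofactor_def)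
qed

lemma permutes_atLeast0_less: "p permutes {0..<n} \<Longrightarrow> i < n \<Longrightarrow> p i < n" for n :: nat
  using permutes_in_image[of p "{0..<n}" i] by simp

lemma det_measurable:
  fixes F :: "nat \<Rightarrow> nat \<Rightarrow> 'b \<Rightarrow> complex"
  assumes "\<And>k l. k < n \<Longrightarrow> l < n \<Longrightarrow> F k l \<in> borel_measurable N"
  shows "(\<lambda>s. Determinant.det (mat n n (\<lambda>(k, l). F k l s))) \<in> borel_measurable N"
proof -
  have "(\<lambda>s. Determinant.det (mat n n (\<lambda>(k, l). F k l s))) =
    (\<lambda>s. \<Sum>p\<in>{p. p permutes {0..<n}}. signof p * (\<Prod>i = 0..<n. F i (p i) s))"
    by (intro ext, subst det_def'[OF mat_carrier]) (auto intro!: sum.cong prod.cong simp: permutes_atLeast0_less)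
  moreover have "F i (p i) \<in> borel_measurable N" if "p permutes {0..<n}" "i < n" for p i
    using assms that permutes_atLeast0_less[OF that] by auto
  ultimately show ?thesis by (auto intro!: borel_measurable_sum borel_measurable_times borel_measurable_prod)
qed

text \<open>The crude bound from the Leibniz formula serves integrability for each fixed size;
  convergence of the Fredholm series rests on Newton's identities instead.\<close>

lemma det_norm_le:
  fixes A :: "complex mat"
  assumes "A \<in> carrier_mat n n" "\<And>k l. k < n \<Longrightarrow> l < n \<Longrightarrow> norm (A $$ (k, l)) \<le> b"
  shows "norm (Determinant.det A) \<le> fact n * b ^ n"
proof -
  have "norm (Determinant.det A) \<le> (\<Sum>p\<in>{p. p permutes {0..<n}}. b ^ n)"
    unfolding det_def'[OF assms(1)]
  proof (rule sum_norm_le)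
    fix p assume p: "p \<in> {p. p permutes {0..<n}}"
    have "norm (signof p * (\<Prod>i = 0..<n. A $$ (i, p i))) = (\<Prod>i = 0..<n. norm (A $$ (i, p i)))"
      by (simp add: norm_mult sign_def prod_norm)
    also have "\<dots> \<le> (\<Prod>i = 0..<n. b)"
      using p assms(2) by (intro prod_mono) (auto simp: permutes_atLeast0_less)
    finally show "norm (signof p * (\<Prod>i = 0..<n. A $$ (i, p i))) \<le> b ^ n" by simp
  qed
  also have "\<dots> = fact n * b ^ n" by (simp add: card_permutations[OF refl])
  finally show ?thesis .
qed

text \<open>The new coordinate is integrated outside and the old ones inside, which is the order in
  which a Fredholm minor with free argument \<open>u\<close> arises. Tonelli for the norm justifies
  the exchange.\<close>

lemma (in product_sigma_finite) product_integral_insert_swap: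
  fixes f :: "_ \<Rightarrow> 'c :: {banach, second_countable_topology}"
  assumes I: "finite I" "i \<notin> I" and f: "integrable (Pi\<^sub>M (insert i I) M) f"
  shows "integral\<^sup>L (Pi\<^sub>M (insert i I) M) f = (LINT u|M i. LINT s|Pi\<^sub>M I M. f (s(i := u)))"
proof -
  interpret I: finite_product_sigma_finite M I by standard fact
  interpret P: pair_sigma_finite "Pi\<^sub>M I M" "M i" ..
  have m[measurable]: "(\<lambda>(s, u). f (s(i := u))) \<in> borel_measurable (Pi\<^sub>M I M \<Otimes>\<^sub>M M i)"
    using measurable_compose[OF measurable_add_dim borel_measurable_integrable[OF f]] by (simp add: case_prod_beta')
  have "integrable (Pi\<^sub>M I M \<Otimes>\<^sub>M M i) (\<lambda>(s, u). f (s(i := u)))"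
  proof (rule integrableI_bounded[OF m])
    have "(\<integral>\<^sup>+x. ennreal (norm (case x of (s, u) \<Rightarrow> f (s(i := u)))) \<partial>(Pi\<^sub>M I M \<Otimes>\<^sub>M M i)) =
       (\<integral>\<^sup>+s. \<integral>\<^sup>+u. ennreal (norm (f (s(i := u)))) \<partial>M i \<partial>Pi\<^sub>M I M)"
      using sigma_finite_measure.nn_integral_fst[OF sigma_finite_measures, of "\<lambda>x. ennreal (norm (case x of (s, u) \<Rightarrow> f (s(i := u))))" "Pi\<^sub>M I M"] m by simp
    also have "\<dots> = (\<integral>\<^sup>+x. ennreal (norm (f x)) \<partial>Pi\<^sub>M (insert i I) M)"
      using borel_measurable_integrable[OF f] by (intro product_nn_integral_insert[symmetric] I) auto
    also have "\<dots> < \<infinity>" using f by (simp add: integrable_iff_bounded)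
    finally show "(\<integral>\<^sup>+x. ennreal (norm (case x of (s, u) \<Rightarrow> f (s(i := u)))) \<partial>(Pi\<^sub>M I M \<Otimes>\<^sub>M M i)) < \<infinity>" .
  qed
  from P.Fubini_integral[OF this] product_integral_insert[OF I f] show ?thesis by simp
qed

text \<open>Tested on rectangles: the preimage of a rectangle has its sides permuted by the inverse,
  and the finite product of their measures ignores the order.\<close>

lemma (in product_sigma_finite) distr_permute_coordinates:
  assumes I: "finite I" and p: "p permutes I" and M: "\<And>i. i \<in> I \<Longrightarrow> M (p i) = M i"
  shows "distr (Pi\<^sub>M I M) (Pi\<^sub>M I M) (\<lambda>s. \<lambda>i\<in>I. s (p i)) = Pi\<^sub>M I M"
proof (rule PiM_eqI[OF I])
  have pI: "p i \<in> I" if "i \<in> I" for i using permutes_in_image[OF p] that by blast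
  have meas: "(\<lambda>s. \<lambda>i\<in>I. s (p i)) \<in> Pi\<^sub>M I M \<rightarrow>\<^sub>M Pi\<^sub>M I M"
    using M pI by (intro measurable_restrict) (metis measurable_component_singleton)
  fix A assume A: "\<And>i. i \<in> I \<Longrightarrow> A i \<in> sets (M i)"
  let ?q = "inv_into UNIV p"
  have qI: "?q i \<in> I" if "i \<in> I" for i using permutes_in_image[OF permutes_inv[OF p]] that by blast
  have pq: "p (?q i) = i" "?q (p i) = i" for i using permutes_inverses[OF p] by auto
  have Mq: "M (?q i) = M i" if "i \<in> I" for i using M[OF qI[OF that]] pq by simp
  have Aq: "A (?q i) \<in> sets (M i)" if "i \<in> I" for i using A[OF qI[OF that]] Mq[OF that] by simp
  have "(\<lambda>s. \<lambda>i\<in>I. s (p i)) -` (Pi\<^sub>E I A) \<inter> space (Pi\<^sub>M I M) = Pi\<^sub>E I (\<lambda>i. A (?q i))"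
  proof (intro Set.set_eqI iffI)
    fix s assume w: "s \<in> (\<lambda>s. \<lambda>i\<in>I. s (p i)) -` (Pi\<^sub>E I A) \<inter> space (Pi\<^sub>M I M)"
    have "s i \<in> A (?q i)" if "i \<in> I" for i
      using w qI[OF that] by (auto simp: PiE_iff pq dest!: bspec[of _ _ "?q i"])
    then show "s \<in> Pi\<^sub>E I (\<lambda>i. A (?q i))" using w by (auto simp: space_PiM PiE_iff)
  next
    fix s assume w: "s \<in> Pi\<^sub>E I (\<lambda>i. A (?q i))"
    have "s (p i) \<in> A i" if "i \<in> I" for i
      using w pI[OF that] by (auto simp: PiE_iff pq dest!: bspec[of _ _ "p i"])
    moreover have "s i \<in> space (M i)" if "i \<in> I" for i
      using w sets.sets_into_space[OF Aq[OF that]] that by (auto simp: PiE_iff)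
    ultimately show "s \<in> (\<lambda>s. \<lambda>i\<in>I. s (p i)) -` (Pi\<^sub>E I A) \<inter> space (Pi\<^sub>M I M)"
      using w by (auto simp: space_PiM PiE_iff)
  qed
  then have "emeasure (distr (Pi\<^sub>M I M) (Pi\<^sub>M I M) (\<lambda>s. \<lambda>i\<in>I. s (p i))) (Pi\<^sub>E I A) = emeasure (Pi\<^sub>M I M) (Pi\<^sub>E I (\<lambda>i. A (?q i)))"
    using A I by (subst emeasure_distr[OF meas]) (auto intro: sets_PiM_I_finite)
  also have "\<dots> = (\<Prod>i\<in>I. emeasure (M i) (A (?q i)))"
    using Aq I by (intro emeasure_PiM) auto
  also have "\<dots> = (\<Prod>i\<in>I. emeasure (M (p i)) (A (?q (p i))))"
    by (rule prod.permute[OF p, unfolded comp_def])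
  also have "\<dots> = (\<Prod>i\<in>I. emeasure (M i) (A i))"
    using M by (simp add: pq)
  finally show "emeasure (distr (Pi\<^sub>M I M) (Pi\<^sub>M I M) (\<lambda>s. \<lambda>i\<in>I. s (p i))) (Pi\<^sub>E I A) = (\<Prod>i\<in>I. emeasure (M i) (A i))" .
qed simp

section \<open>Fredholm minors, their recursion and Newton's identities\<close>

context projection_symbol begin

sublocale P: product_sigma_finite "\<lambda>_::nat. M" ..

abbreviation PM :: "nat \<Rightarrow> (nat \<Rightarrow> 'a) measure" where "PM n \<equiv> Pi\<^sub>M {..<n} (\<lambda>_. M)"

text \<open>\<open>fredholm_det n\<close> lacks the factor \<open>1 / fact n\<close> of the Fredholm series.\<close>

definition fredholm_det :: "nat \<Rightarrow> complex" where
  "fredholm_det n = (LINT s|PM n. (\<Prod>i<n. G (s i)) * Determinant.det (mat n n (\<lambda>(k, l). K (s k) (s l))))"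

text \<open>The first-order Fredholm minor, again without the factorial: index n is the border, with
  \<open>x\<close> in its row and \<open>y\<close> in its column, and the other n points are
  integrated out.\<close>

definition fredholm_minor :: "nat \<Rightarrow> 'a \<Rightarrow> 'a \<Rightarrow> complex" where
  "fredholm_minor n x y = (LINT s|PM n. (\<Prod>i<n. G (s i)) *
     Determinant.det (mat (Suc n) (Suc n) (\<lambda>(k, l). K ((s(n := x)) k) ((s(n := y)) l))))"

text \<open>Entries are arbitrary bounded functions and an extra factor \<open>h\<close> is allowed,
  so that the terms of the last-row expansion, whose matrices contain a unit row, are covered
  too.\<close>

lemma integrable_prod_det:
  assumes m: "\<And>k l. k < m \<Longrightarrow> l < m \<Longrightarrow> F k l \<in> borel_measurable (PM n)"
    and b: "\<And>k l s. k < m \<Longrightarrow> l < m \<Longrightarrow> norm (F k l s) \<le> b"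
    and h: "h \<in> borel_measurable (PM n)" "\<And>s. norm (h s) \<le> c"
  shows "integrable (PM n) (\<lambda>s. (\<Prod>i<n. G (s i)) * (h s * Determinant.det (mat m m (\<lambda>(k, l). F k l s))))"
proof (rule Bochner_Integration.integrable_bound)
  show "integrable (PM n) (\<lambda>s. of_real (c * (fact m * b ^ m)) * (\<Prod>i<n. G (s i)))"
    by (intro integrable_mult_right P.product_integrable_prod integrable_G) auto
  have "integrable (PM n) (\<lambda>s. \<Prod>i<n. G (s i))"
    by (intro P.product_integrable_prod integrable_G) auto
  note [measurable] = borel_measurable_integrable[OF this] det_measurable[OF m] h(1)
  show "(\<lambda>s. (\<Prod>i<n. G (s i)) * (h s * Determinant.det (mat m m (\<lambda>(k, l). F k l s)))) \<in> borel_measurable (PM n)"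
    by measurable
  show "AE s in PM n. norm ((\<Prod>i<n. G (s i)) * (h s * Determinant.det (mat m m (\<lambda>(k, l). F k l s)))) \<le>
     norm (of_real (c * (fact m * b ^ m)) * (\<Prod>i<n. G (s i)))"
  proof (intro AE_I2)
    fix s
    have d: "norm (Determinant.det (mat m m (\<lambda>(k, l). F k l s))) \<le> fact m * b ^ m"
      by (rule det_norm_le[OF mat_carrier]) (auto intro: b)
    have "c \<ge> 0" using h(2)[of s] norm_ge_zero order_trans by blast
    then have "norm (h s) * norm (Determinant.det (mat m m (\<lambda>(k, l). F k l s))) \<le> c * (fact m * b ^ m)"
      using d h(2)[of s] by (intro mult_mono) auto
    then show "norm ((\<Prod>i<n. G (s i)) * (h s * Determinant.det (mat m m (\<lambda>(k, l). F k l s)))) \<le>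
     norm (of_real (c * (fact m * b ^ m)) * (\<Prod>i<n. G (s i)))"
      unfolding norm_mult norm_of_real
      by (subst mult.commute) (auto intro!: mult_right_mono)
  qed
qed

lemma K_measurable_comp:
  "f \<in> N \<rightarrow>\<^sub>M M \<Longrightarrow> f' \<in> N \<rightarrow>\<^sub>M M \<Longrightarrow> (\<lambda>s. K (f s) (f' s)) \<in> borel_measurable N"
  by (rule schur_measurable'[OF schur_K])

lemma upd_component_measurable: "k < Suc n \<Longrightarrow> (\<lambda>s. (s(n := x)) k) \<in> PM n \<rightarrow>\<^sub>M M"
  by (cases "k = n") (auto simp: space_UNIV)

lemma integrable_det:
  "integrable (PM n) (\<lambda>s. (\<Prod>i<n. G (s i)) * Determinant.det (mat n n (\<lambda>(k, l). K (s k) (s l))))"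
proof -
  obtain b where b: "\<And>z w. norm (K z w) \<le> b" using schurE[OF schur_K] by metis
  have "integrable (PM n) (\<lambda>s. (\<Prod>i<n. G (s i)) * (1 * Determinant.det (mat n n (\<lambda>(k, l). (\<lambda>s. K (s k) (s l)) s))))"
    by (rule integrable_prod_det[where c = 1 and b = b]) (auto intro!: b K_measurable_comp)
  then show ?thesis by simp
qed

lemma fredholm_det_Suc: "fredholm_det (Suc n) = trace (G \<star> fredholm_minor n)"
proof -
  let ?f = "\<lambda>s. (\<Prod>i<Suc n. G (s i)) * Determinant.det (mat (Suc n) (Suc n) (\<lambda>(k, l). K (s k) (s l)))"
  have I: "{..<Suc n} = insert n {..<n}" by auto
  have "fredholm_det (Suc n) = (LINT u|M. LINT s|PM n. ?f (s(n := u)))"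
    unfolding fredholm_det_def using integrable_det[of "Suc n"] unfolding I
    by (intro P.product_integral_insert_swap) auto
  also have "\<dots> = (LINT u|M. G u * fredholm_minor n u u)"
  proof (intro Bochner_Integration.integral_cong refl)
    fix u
    have "(\<Prod>i<Suc n. G ((s(n := u)) i)) = G u * (\<Prod>i<n. G (s i))" for s
      by (simp add: mult.commute)
    then show "(LINT s|PM n. ?f (s(n := u))) = G u * fredholm_minor n u u"
      unfolding fredholm_minor_def by (simp add: mult.assoc del: fun_upd_apply prod.lessThan_Suc)
  qed
  finally show ?thesis by (simp add: trace_def lmul_def)
qed

lemma fredholm_minor_0: "fredholm_minor 0 x y = K x y"
proof -
  have "Determinant.det (mat (Suc 0) (Suc 0) (\<lambda>(k, l). K ((s(0 := x)) k) ((s(0 := y)) l))) = K x y" for s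
    by (subst det_single) auto
  then show ?thesis unfolding fredholm_minor_def by (simp add: PiM_empty lebesgue_integral_count_space_finite)
qed

lemma fredholm_det_0: "fredholm_det 0 = 1"
  by (simp add: fredholm_det_def PiM_empty lebesgue_integral_count_space_finite)

text \<open>Expansion along the last row; by symmetry all terms but the diagonal one have the same integral.\<close>

lemma fredholm_minor_Suc:
  "fredholm_minor (Suc n) x y = K x y * fredholm_det (Suc n)
     - of_nat (Suc n) * (K \<bullet>\<bullet> (G \<star> fredholm_minor n)) x y"
proof -
  obtain b where b: "\<And>z w. norm (K z w) \<le> b" using schurE[OF schur_K] by metis
  define F where "F s k l = K ((s(Suc n := x)) k) ((s(Suc n := y)) l)" for s k l
  \<comment> \<open>The j-th term of the expansion along the border row. Index Suc n carries
    \<open>x\<close> and \<open>y\<close>, the indices 0 to n carry the integration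
    variables.\<close>
  define \<Phi> where "\<Phi> j s = (\<Prod>i<Suc n. G (s i)) * (F s (Suc n) j * unit_last_row_det (Suc n) (F s) j)" for j s
  have b1: "b + 1 \<ge> norm (K z w)" "b + 1 \<ge> 1" for z w using b[of z w] norm_ge_zero[of "K z w"] by linarith+
  have F_meas: "(\<lambda>s. F s k l) \<in> borel_measurable (PM (Suc n))" if "k < Suc (Suc n)" "l < Suc (Suc n)" for k l
    unfolding F_def by (intro K_measurable_comp upd_component_measurable that)
  have int: "integrable (PM (Suc n)) (\<Phi> j)" if "j < Suc (Suc n)" for j
  proof -
    let ?H = "\<lambda>k l s. if k = Suc n then if l = j then 1 else 0 else F s k l"
    have "integrable (PM (Suc n)) (\<lambda>s. (\<Prod>i<Suc n. G (s i)) * (F s (Suc n) j *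
       Determinant.det (mat (Suc (Suc n)) (Suc (Suc n)) (\<lambda>(k, l). ?H k l s))))"
    proof (rule integrable_prod_det[where c = b and b = "b + 1"])
      show "?H k l \<in> borel_measurable (PM (Suc n))" if "k < Suc (Suc n)" "l < Suc (Suc n)" for k l
        using F_meas[OF that] by (cases "k = Suc n") simp_all
      show "norm (?H k l s) \<le> b + 1" for k l s
        using b1(1)[of "(s(Suc n := x)) k" "(s(Suc n := y)) l"] b1(2) unfolding F_def by (simp del: fun_upd_apply)
      show "(\<lambda>s. F s (Suc n) j) \<in> borel_measurable (PM (Suc n))" by (rule F_meas) (use that in auto)
      show "norm (F s (Suc n) j) \<le> b" for s unfolding F_def by (rule b)
    qed
    then show ?thesis unfolding \<Phi>_def unit_last_row_det_def .
  qed
  have "fredholm_minor (Suc n) x y = (LINT s|PM (Suc n). (\<Sum>j<Suc (Suc n). \<Phi> j s))"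
    unfolding fredholm_minor_def F_def[symmetric] det_last_row[of "Suc n"] \<Phi>_def by (simp only: sum_distrib_left)
  also have "\<dots> = (\<Sum>j<Suc (Suc n). LINT s|PM (Suc n). \<Phi> j s)"
    by (rule Bochner_Integration.integral_sum) (auto intro: int)
  also have "\<dots> = (\<Sum>j<Suc n. LINT s|PM (Suc n). \<Phi> n s) + (LINT s|PM (Suc n). \<Phi> (Suc n) s)"
  proof -
    \<comment> \<open>Exchanging the variables n and j preserves the product measure and the product
      of the values of \<open>G\<close>, and turns term n into term j.\<close>
    have eq: "(LINT s|PM (Suc n). \<Phi> j s) = (LINT s|PM (Suc n). \<Phi> n s)" if j: "j < Suc n" for j
    proof -
      let ?t = "Transposition.transpose n j"
      let ?r = "\<lambda>s. \<lambda>i\<in>{..<Suc n}. s (?t i)"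
      have p: "?t permutes {..<Suc n}" using j by (intro permutes_swap_id) auto
      have r: "?r \<in> PM (Suc n) \<rightarrow>\<^sub>M PM (Suc n)"
        using permutes_in_image[OF p] by (intro measurable_restrict measurable_component_singleton) auto
      have Fr: "F (?r s) k l = F s (?t k) (?t l)" if "k \<le> Suc n" "l \<le> Suc n" for s k l
      proof -
        have "((?r s)(Suc n := z)) k = (s(Suc n := z)) (?t k)" if "k \<le> Suc n" for k z
          using that j permutes_in_image[OF p, of k] by (auto simp: Transposition.transpose_def)
        from this[OF that(1)] this[OF that(2)] show ?thesis by (simp only: F_def)
      qed
      have "\<Phi> n (?r s) = \<Phi> j s" for s
      proof -
        have "(\<Prod>i<Suc n. G (?r s i)) = (\<Prod>i<Suc n. G (s (?t i)))" by (intro prod.cong) auto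
        also have "\<dots> = (\<Prod>i<Suc n. G (s i))" using prod.permute[OF p, of "\<lambda>i. G (s i)"] by (simp only: o_def)
        finally have 1: "(\<Prod>i<Suc n. G (?r s i)) = (\<Prod>i<Suc n. G (s i))" .
        have 2: "F (?r s) (Suc n) n = F s (Suc n) j"
          using Fr[of "Suc n" n s] j by (simp add: Transposition.transpose_def)
        have "unit_last_row_det (Suc n) (F (?r s)) n = unit_last_row_det (Suc n) (\<lambda>k l. F s (?t k) (?t l)) n"
          unfolding unit_last_row_det_def
          by (intro arg_cong[of _ _ Determinant.det] eq_matI) (auto simp: Fr)
        also have "\<dots> = unit_last_row_det (Suc n) (F s) j"
          using j by (intro unit_last_row_det_transpose) auto
        finally show ?thesis unfolding \<Phi>_def 1 2 by simp
      qed
      then have "(LINT s|PM (Suc n). \<Phi> j s) = (LINT s|PM (Suc n). \<Phi> n (?r s))" by (simp only:)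
      also have "\<dots> = (LINT s|distr (PM (Suc n)) (PM (Suc n)) ?r. \<Phi> n s)"
        using borel_measurable_integrable[OF int[of n]] by (intro integral_distr[symmetric] r) auto
      also have "distr (PM (Suc n)) (PM (Suc n)) ?r = PM (Suc n)"
        by (rule P.distr_permute_coordinates[OF _ p]) auto
      finally show ?thesis .
    qed
    have "(\<Sum>j<Suc n. LINT s|PM (Suc n). \<Phi> j s) = (\<Sum>j<Suc n. LINT s|PM (Suc n). \<Phi> n s)"
      by (rule sum.cong[OF refl], rule eq) simp
    then show ?thesis by (simp only: sum.lessThan_Suc[of _ "Suc n"])
  qed
  also have "(LINT s|PM (Suc n). \<Phi> (Suc n) s) = K x y * fredholm_det (Suc n)"
  proof -
    have "\<Phi> (Suc n) s = K x y * ((\<Prod>i<Suc n. G (s i)) * Determinant.det (mat (Suc n) (Suc n) (\<lambda>(k, l). K (s k) (s l))))" for s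
    proof -
      have "unit_last_row_det (Suc n) (F s) (Suc n) = Determinant.det (mat (Suc n) (Suc n) (\<lambda>(k, l). K (s k) (s l)))"
        unfolding unit_last_row_det_last
        by (intro arg_cong[of _ _ Determinant.det] eq_matI) (auto simp: F_def)
      then show ?thesis unfolding \<Phi>_def by (simp add: F_def mult_ac)
    qed
    then show ?thesis unfolding fredholm_det_def by simp
  qed
  \<comment> \<open>The entry chosen from the border row is K x u with u the variable of index n.
    What remains is the minor of one order less with border arguments u and
    \<open>y\<close>.\<close>
  also have "(LINT s|PM (Suc n). \<Phi> n s) = - (K \<bullet>\<bullet> (G \<star> fredholm_minor n)) x y"
  proof -
    have I: "{..<Suc n} = insert n {..<n}" by auto
    have "(LINT s|PM (Suc n). \<Phi> n s) = (LINT u|M. LINT s|PM n. \<Phi> n (s(n := u)))"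
      using int[of n] unfolding I
      by (intro P.product_integral_insert_swap) auto
    also have "\<dots> = (LINT u|M. - (K x u * (G u * fredholm_minor n u y)))"
    proof (intro Bochner_Integration.integral_cong refl)
      fix u
      have "\<Phi> n (s(n := u)) = - (K x u * G u) * ((\<Prod>i<n. G (s i)) *
        Determinant.det (mat (Suc n) (Suc n) (\<lambda>(k, l). K ((s(n := u)) k) ((s(n := y)) l))))" for s
      proof -
        have "unit_last_row_det (Suc n) (F (s(n := u))) n =
          - Determinant.det (mat (Suc n) (Suc n) (\<lambda>(k, l). K ((s(n := u)) k) ((s(n := y)) l)))"
          unfolding unit_last_row_det_penultimate
          by (intro arg_cong[of _ _ uminus] arg_cong[of _ _ Determinant.det] eq_matI) (auto simp: F_def)
        moreover have "F (s(n := u)) (Suc n) n = K x u" by (simp add: F_def)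
        moreover have "(\<Prod>i<Suc n. G ((s(n := u)) i)) = G u * (\<Prod>i<n. G (s i))" by (simp add: mult.commute)
        ultimately show ?thesis unfolding \<Phi>_def by (simp add: mult_ac del: fun_upd_apply)
      qed
      then show "(LINT s|PM n. \<Phi> n (s(n := u))) = - (K x u * (G u * fredholm_minor n u y))"
        unfolding fredholm_minor_def by (simp add: mult_ac del: fun_upd_apply)
    qed
    finally show ?thesis by (simp add: comp_def lmul_def)
  qed
  finally show ?thesis by (simp add: algebra_simps)
qed

definition fredholm_coeff :: "nat \<Rightarrow> complex" where
  "fredholm_coeff n = fredholm_det n / fact n"

text \<open>Solution of the recursion. In terms of generating functions, the series of minors is the
  alternating resolvent series of the \<open>T m\<close> times the Fredholm series.\<close>

lemma fredholm_minor_eq: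
  "fredholm_minor n x y / fact n = (\<Sum>m\<le>n. (-1) ^ m * T m x y * fredholm_coeff (n - m))"
proof (induction n arbitrary: x y)
  case 0
  then show ?case by (simp add: fredholm_minor_0 fredholm_coeff_def fredholm_det_0)
next
  case (Suc n)
  have "fredholm_minor n = (\<lambda>x y. fact n * (\<Sum>m\<le>n. (-1) ^ m * T m x y * fredholm_coeff (n - m)))"
    using Suc by (auto simp: fun_eq_iff field_simps)
  then have "(K \<bullet>\<bullet> (G \<star> fredholm_minor n)) x y = (LINT u|M. (\<Sum>m\<le>n. fact n * (-1) ^ m * fredholm_coeff (n - m) * (K x u * (G \<star> T m) u y)))"
    unfolding comp_def lmul_def by (simp add: sum_distrib_left mult_ac)
  also have "\<dots> = (\<Sum>m\<le>n. LINT u|M. fact n * (-1) ^ m * fredholm_coeff (n - m) * (K x u * (G \<star> T m) u y))"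
    by (intro Bochner_Integration.integral_sum integrable_mult_right integrable_comp schur_K schur_lmul bfun_G schur_T)
  also have "\<dots> = (\<Sum>m\<le>n. fact n * (-1) ^ m * fredholm_coeff (n - m) * T (Suc m) x y)"
    by (simp add: comp_def)
  finally have 1: "(K \<bullet>\<bullet> (G \<star> fredholm_minor n)) x y = fact n * (\<Sum>m\<le>n. (-1) ^ m * T (Suc m) x y * fredholm_coeff (n - m))"
    by (simp add: sum_distrib_left mult_ac)
  have "fredholm_minor (Suc n) x y / fact (Suc n) = K x y * fredholm_coeff (Suc n)
     - of_nat (Suc n) * (fact n * (\<Sum>m\<le>n. (-1) ^ m * T (Suc m) x y * fredholm_coeff (n - m))) / fact (Suc n)"
    unfolding fredholm_minor_Suc 1 by (simp add: fredholm_coeff_def diff_divide_distrib del: of_nat_Suc fact_Suc)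
  also have "of_nat (Suc n) * (fact n * (\<Sum>m\<le>n. (-1) ^ m * T (Suc m) x y * fredholm_coeff (n - m))) / fact (Suc n) =
     (\<Sum>m\<le>n. (-1) ^ m * T (Suc m) x y * fredholm_coeff (n - m))"
    by (simp del: of_nat_Suc)
  also have "K x y * fredholm_coeff (Suc n) - \<dots> = (\<Sum>m\<le>Suc n. (-1) ^ m * T m x y * fredholm_coeff (Suc n - m))"
    by (subst sum.atMost_Suc_shift) (simp add: sum_negf del: T.simps(2))
  finally show ?case .
qed

text \<open>The previous identity is weighted by \<open>G\<close> and integrated over the diagonal.
  The traces play the role of power sums, the coefficients that of elementary symmetric
  functions.\<close>

lemma newton_identity:
  "of_nat (Suc n) * fredholm_coeff (Suc n) = (\<Sum>m\<le>n. (-1) ^ m * trace (G \<star> T m) * fredholm_coeff (n - m))"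
proof -
  have "of_nat (Suc n) * fredholm_coeff (Suc n) = trace (G \<star> fredholm_minor n) / fact n"
    unfolding fredholm_coeff_def fredholm_det_Suc fact_Suc by (simp del: of_nat_Suc)
  also have "\<dots> = (LINT x|M. G x * (fredholm_minor n x x / fact n))"
    by (simp add: trace_def lmul_def)
  also have "\<dots> = (LINT x|M. (\<Sum>m\<le>n. (-1) ^ m * fredholm_coeff (n - m) * (G \<star> T m) x x))"
    unfolding fredholm_minor_eq by (simp add: sum_distrib_left lmul_def mult_ac)
  also have "\<dots> = (\<Sum>m\<le>n. LINT x|M. (-1) ^ m * fredholm_coeff (n - m) * (G \<star> T m) x x)"
    by (intro Bochner_Integration.integral_sum integrable_mult_right integrable_trace integrable_G schur_T)
  finally show ?thesis by (simp add: trace_def mult_ac)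
qed

end

section \<open>Traces of compressed powers\<close>

lemma norm_diff_triangle_split:
  fixes x y z w :: "'a :: real_normed_vector"
  assumes "x = y - z" "norm (y - w) \<le> a" "norm z \<le> b" shows "norm (x - w) \<le> a + b"
proof -
  have "x - w = (y - w) - z" using assms(1) by simp
  then have "norm (x - w) \<le> norm (y - w) + norm z" by (simp only: norm_triangle_ineq4)
  from order_trans[OF this add_mono[OF assms(2,3)]] show ?thesis .
qed

text \<open>\<open>A\<close> bounds [G, K] and \<open>E\<close> bounds [G, [G, K]] in
  Hilbert--Schmidt norm, while \<epsilon> bounds the row integrals of [G, K] and so replaces its
  operator norm. Terms with a factor \<open>E\<close> or \<epsilon> are errors; the square of
  \<open>A\<close> alone is the order of the main term.\<close>

locale projection_estimate = projection_symbol M K g q for M :: "'a measure" and K g q +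
  fixes A E \<epsilon> :: real
  assumes hsb_D: "hsb D A"
    and hsb_D2: "hsb (\<lambda>z w. (G z - G w)\<^sup>2 * K z w) E"
    and eps_nonneg: "\<epsilon> \<ge> 0"
    and row_le: "\<And>z. (\<integral>\<^sup>+w. ennreal (norm (D z w)) \<partial>M) \<le> ennreal \<epsilon>"
begin

lemma A_nonneg: "A \<ge> 0" and E_nonneg: "E \<ge> 0"
  using hsb_D hsb_D2 by (auto simp: hsb_def)

lemma norm_D_sym: "norm (D z w) = norm (D w z)"
  using hermitian[of z w] by (simp add: commutator_def norm_mult norm_minus_commute)

lemma col_le: "(\<integral>\<^sup>+z. ennreal (norm (D z w)) \<partial>M) \<le> ennreal \<epsilon>"
  using row_le[of w] by (simp add: norm_D_sym[of _ w])

lemma norm_G_power_diff_le: "norm (G z ^ n - G w ^ n) \<le> real n * (q ^ n / q) * norm (G z - G w)"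
proof -
  have "norm (G z ^ n - G w ^ n) = \<bar>g z ^ n - g w ^ n\<bar>" "norm (G z - G w) = \<bar>g z - g w\<bar>"
    unfolding G_def by (simp_all flip: of_real_power of_real_diff)
  then show ?thesis using abs_power_diff_le[OF g_bound g_bound q_pos] by simp
qed

lemma norm_G_power_diff_linear_le:
  "norm (G z ^ n - G w ^ n - of_nat n * G z ^ (n - 1) * (G z - G w)) \<le> (real n)\<^sup>2 * (q ^ n / q\<^sup>2) * norm ((G z - G w)\<^sup>2)"
proof -
  have "G z ^ n - G w ^ n - of_nat n * G z ^ (n - 1) * (G z - G w)
      = of_real (g z ^ n - g w ^ n - real n * g z ^ (n - 1) * (g z - g w))"
    "(G z - G w)\<^sup>2 = of_real ((g z - g w)\<^sup>2)"
    by (simp_all add: G_def)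
  then have "norm (G z ^ n - G w ^ n - of_nat n * G z ^ (n - 1) * (G z - G w))
      = \<bar>g z ^ n - g w ^ n - real n * g z ^ (n - 1) * (g z - g w)\<bar>"
     "norm ((G z - G w)\<^sup>2) = (g z - g w)\<^sup>2"
    by (simp_all only: norm_of_real) auto
  then show ?thesis using abs_power_diff_linear_le[OF g_bound g_bound q_pos] by metis
qed

lemma G_measurable[measurable]: "G \<in> borel_measurable M"
  using bfun_G by (simp add: bfun_def)

lemma hsb_T_D: "hsb (T j \<bullet>\<bullet> D) (q ^ j * A)"
  by (rule hsb_T[OF hsb_D schur_D])

lemma ip_lmul_swap: "(\<And>x. cnj (a x) = a x) \<Longrightarrow> ip p (a \<star> k) = ip (a \<star> p) k"
  unfolding ip_def lmul_def by (intro Bochner_Integration.integral_cong) (auto simp: mult_ac)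

lemma ip_cmult_right: "ip p (\<lambda>z w. c * k z w) = cnj c * ip p k"
proof -
  have "ip p (\<lambda>z w. c * k z w) = (LINT x|(M \<Otimes>\<^sub>M M). cnj c * (p (fst x) (snd x) * cnj (k (fst x) (snd x))))"
    unfolding ip_def by (intro Bochner_Integration.integral_cong) (auto simp: mult_ac)
  then show ?thesis by (simp add: ip_def)
qed

text \<open>Taylor expansion of the power: [G^k, K] is k G^(k - 1) [G, K] up to a kernel dominated
  by (G z - G w)^2 K z w, which is measured by \<open>E\<close>.\<close>

lemma linearize_commutator_power:
  "norm (ip (T j \<bullet>\<bullet> D) (commutator (\<lambda>x. G x ^ k)) - of_nat k * ip ((\<lambda>x. G x ^ (k - 1)) \<star> (T j \<bullet>\<bullet> D)) D)
    \<le> (q ^ j * A) * ((real k)\<^sup>2 * (q ^ k / q\<^sup>2) * E)"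
proof -
  define R where "R z w = (G z ^ k - G w ^ k - of_nat k * G z ^ (k - 1) * (G z - G w)) * K z w" for z w
  note [measurable (raw)] = schur_measurable'[OF schur_K]
  have R: "hsb R ((real k)\<^sup>2 * (q ^ k / q\<^sup>2) * E)"
  proof (rule hsb_bound[OF hsb_D2])
    have "case_prod R = (\<lambda>x. (G (fst x) ^ k - G (snd x) ^ k - of_nat k * G (fst x) ^ (k - 1) * (G (fst x) - G (snd x))) * K (fst x) (snd x))"
      by (auto simp: R_def fun_eq_iff)
    then show "case_prod R \<in> borel_measurable (M \<Otimes>\<^sub>M M)" by simp
    show "norm (R z w) \<le> (real k)\<^sup>2 * (q ^ k / q\<^sup>2) * norm ((G z - G w)\<^sup>2 * K z w)" for z w
      using mult_right_mono[OF norm_G_power_diff_linear_le[of z k w], of "norm (K z w)"]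
      by (simp add: R_def norm_mult mult.assoc)
  qed (use q_pos in auto)
  let ?L = "\<lambda>z w. of_nat k * ((\<lambda>x. G x ^ (k - 1)) \<star> D) z w"
  have L: "hsb ?L (real k * (q ^ (k - 1) * A))"
  proof -
    have "hsb ((\<lambda>x. of_nat k) \<star> (\<lambda>x. G x ^ (k - 1)) \<star> D) (real k * (q ^ (k - 1) * A))"
      by (intro hsb_lmul hsb_D) (auto simp: norm_G_power)
    then show ?thesis by (simp add: lmul_def[abs_def])
  qed
  have "commutator (\<lambda>x. G x ^ k) = (\<lambda>z w. ?L z w + R z w)"
    by (intro ext) (simp add: commutator_def R_def lmul_def algebra_simps)
  then have "ip (T j \<bullet>\<bullet> D) (commutator (\<lambda>x. G x ^ k)) = ip (T j \<bullet>\<bullet> D) ?L + ip (T j \<bullet>\<bullet> D) R"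
    using ip_add_right[OF hsb_T_D L R] by simp
  moreover have "ip (T j \<bullet>\<bullet> D) ?L = of_nat k * ip ((\<lambda>x. G x ^ (k - 1)) \<star> (T j \<bullet>\<bullet> D)) D"
    by (simp add: ip_cmult_right ip_lmul_swap)
  ultimately show ?thesis using norm_ip_le[OF hsb_T_D[of j] R] by simp
qed

text \<open>In K G T_j D the product K G is replaced by G K - D, after which \<open>K\<close> is
  absorbed into T_j.\<close>

lemma T_Suc_commutator:
  "T (Suc j) \<bullet>\<bullet> D = (\<lambda>z w. (G \<star> (T j \<bullet>\<bullet> D)) z w - (D \<bullet>\<bullet> (T j \<bullet>\<bullet> D)) z w)"
proof -
  have s: "schur (T j \<bullet>\<bullet> D)" by (intro schur_comp schur_T schur_D)
  have K: "K \<bullet>\<bullet> (T j \<bullet>\<bullet> D) = T j \<bullet>\<bullet> D"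
    by (subst comp_assoc[symmetric]) (auto intro!: schur_T schur_D schur_K simp: K_T)
  have "D \<bullet>\<bullet> (T j \<bullet>\<bullet> D) = (\<lambda>z w. (G \<star> (T j \<bullet>\<bullet> D)) z w - (T (Suc j) \<bullet>\<bullet> D) z w)"
    by (subst (1) commutator_eq, subst comp_diff_left)
       (auto simp only: lmul_comp rmul_comp K T_comp_Suc[OF schur_D] intro!: schur_lmul schur_rmul bfun_G schur_K s)
  then show ?thesis by auto
qed

text \<open>Each of the \<open>j\<close> exchanges moves one factor \<open>G\<close> to the left and
  leaves an error of the form D T D. By Schur's test the additional \<open>D\<close> costs only
  \<epsilon>.\<close>

lemma pull_out_symbol:
  "norm (ip ((\<lambda>x. G x ^ i) \<star> (T j \<bullet>\<bullet> D)) D - ip ((\<lambda>x. G x ^ (i + j)) \<star> (K \<bullet>\<bullet> D)) D)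
    \<le> real j * (q ^ (i + j) / q) * (\<epsilon> * A\<^sup>2)"
proof (induction j arbitrary: i)
  case (Suc j)
  have s: "schur (T j \<bullet>\<bullet> D)" by (intro schur_comp schur_T schur_D)
  let ?P = "(\<lambda>x. G x ^ Suc i) \<star> (T j \<bullet>\<bullet> D)" and ?Q = "(\<lambda>x. G x ^ i) \<star> (D \<bullet>\<bullet> (T j \<bullet>\<bullet> D))"
  have P: "hsb ?P (q ^ Suc i * (q ^ j * A))" by (intro hsb_lmul hsb_T_D norm_G_power) measurable
  have Q: "hsb ?Q (q ^ i * (\<epsilon> * (q ^ j * A)))"
    by (intro hsb_lmul hsb_schur_test hsb_T_D norm_G_power s schur_D eps_nonneg row_le col_le) measurable
  have eq: "(\<lambda>x. G x ^ i) \<star> (T (Suc j) \<bullet>\<bullet> D) = (\<lambda>z w. ?P z w - ?Q z w)"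
    unfolding T_Suc_commutator lmul_diff lmul_lmul by (simp add: mult.commute)
  have "ip ((\<lambda>x. G x ^ i) \<star> (T (Suc j) \<bullet>\<bullet> D)) D = ip ?P D - ip ?Q D"
    unfolding eq by (rule ip_diff_left[OF P Q hsb_D])
  moreover have "norm (ip ?Q D) \<le> q ^ (i + Suc j) / q * (\<epsilon> * A\<^sup>2)"
    using norm_ip_le[OF Q hsb_D] q_pos by (simp add: power_add power2_eq_square mult_ac)
  moreover have "norm (ip ?P D - ip ((\<lambda>x. G x ^ (i + Suc j)) \<star> (K \<bullet>\<bullet> D)) D) \<le> real j * (q ^ (i + Suc j) / q) * (\<epsilon> * A\<^sup>2)"
    using Suc[of "Suc i"] by simp
  ultimately have "norm (ip ((\<lambda>x. G x ^ i) \<star> (T (Suc j) \<bullet>\<bullet> D)) D - ip ((\<lambda>x. G x ^ (i + Suc j)) \<star> (K \<bullet>\<bullet> D)) D)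
     \<le> real j * (q ^ (i + Suc j) / q) * (\<epsilon> * A\<^sup>2) + q ^ (i + Suc j) / q * (\<epsilon> * A\<^sup>2)"
    by (intro norm_diff_triangle_split)
  also have "\<dots> = real (Suc j) * (q ^ (i + Suc j) / q) * (\<epsilon> * A\<^sup>2)" by (simp add: algebra_simps)
  finally show ?case .
qed simp

lemma K_D: "K \<bullet>\<bullet> D = (\<lambda>z w. (K \<bullet>\<bullet> (G \<star> K)) z w - rmul K G z w)"
  unfolding commutator_eq
  by (subst comp_diff_right) (auto simp only: comp_rmul reproducing intro!: schur_lmul schur_rmul bfun_G schur_K)

lemma D_K: "D \<bullet>\<bullet> K = (\<lambda>z w. (G \<star> K) z w - (K \<bullet>\<bullet> (G \<star> K)) z w)"
  unfolding commutator_eq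
  by (subst comp_diff_left) (auto simp only: lmul_comp rmul_comp reproducing intro!: schur_lmul schur_rmul bfun_G schur_K)

text \<open>Commutation with \<open>G\<close> is a derivation; applied to K = K K it yields D = K D
  + D K.\<close>

lemma D_split: "D z w = (K \<bullet>\<bullet> D) z w + (D \<bullet>\<bullet> K) z w"
  unfolding K_D D_K by (simp add: commutator_eq)

lemma trace_diff:
  assumes "integrable M a" "schur k" "schur l"
  shows "trace (a \<star> (\<lambda>z w. k z w - l z w)) = trace (a \<star> k) - trace (a \<star> l)"
  using integrable_trace[OF assms(1,2)] integrable_trace[OF assms(1,3)]
  unfolding lmul_diff by (simp add: trace_def)

lemma ip_D:
  assumes "schur p"
  shows "ip p D = trace (G \<star> (p \<bullet>\<bullet> K)) - trace (G \<star> (K \<bullet>\<bullet> p))"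
  by (rule ip_commutator[OF assms bfun_G integrable_G]) simp

text \<open>Exchanging the two halves \<open>K D\<close> and \<open>D K\<close> of \<open>D\<close> moves the weight \<open>h\<close> from the left to the right.\<close>

lemma ip_D_K:
  assumes h: "bfun h"
  shows "ip (h \<star> (D \<bullet>\<bullet> K)) D = ip (rmul (K \<bullet>\<bullet> D) h) D"
proof -
  note sch = schur_lmul schur_rmul schur_comp bfun_G schur_K schur_D h
  define L where "L = K \<bullet>\<bullet> (h \<star> K)"
  have sL: "schur L" unfolding L_def by (intro sch)
  have hG: "(\<lambda>x. G x * h x) \<star> k = h \<star> G \<star> k" for k by (simp add: lmul_lmul mult.commute)
  have 1: "trace (G \<star> ((h \<star> (D \<bullet>\<bullet> K)) \<bullet>\<bullet> K)) = - trace (G \<star> rmul (K \<bullet>\<bullet> D) h)"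
  proof -
    have "(h \<star> (D \<bullet>\<bullet> K)) \<bullet>\<bullet> K = h \<star> (D \<bullet>\<bullet> K)"
      unfolding lmul_comp by (subst comp_assoc) (auto simp: reproducing intro!: sch)
    \<comment> \<open>The commutator vanishes on the diagonal, so the diagonals of its two halves
      are opposite.\<close>
    moreover have "(D \<bullet>\<bullet> K) x x = - (K \<bullet>\<bullet> D) x x" for x
      using D_split[of x x] by (simp add: commutator_def eq_neg_iff_add_eq_0 add.commute)
    ultimately show ?thesis
      unfolding trace_def lmul_def rmul_def by (simp add: mult_ac)
  qed
  have 2: "K \<bullet>\<bullet> rmul (K \<bullet>\<bullet> D) h = rmul (K \<bullet>\<bullet> D) h"
    unfolding comp_rmul by (subst K_idem) (auto intro!: sch)
  have a1: "K \<bullet>\<bullet> (h \<star> (D \<bullet>\<bullet> K)) = (\<lambda>z w. (K \<bullet>\<bullet> (h \<star> G \<star> K)) z w - (L \<bullet>\<bullet> (G \<star> K)) z w)"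
  proof -
    have "K \<bullet>\<bullet> (h \<star> (D \<bullet>\<bullet> K)) = (\<lambda>z w. (K \<bullet>\<bullet> (h \<star> G \<star> K)) z w - (K \<bullet>\<bullet> (h \<star> (K \<bullet>\<bullet> (G \<star> K)))) z w)"
      unfolding D_K lmul_diff by (rule comp_diff_right) (intro sch)+
    moreover have "K \<bullet>\<bullet> (h \<star> (K \<bullet>\<bullet> (G \<star> K))) = L \<bullet>\<bullet> (G \<star> K)"
      unfolding L_def by (subst comp_assoc) (auto simp: lmul_comp intro!: sch)
    ultimately show ?thesis by simp
  qed
  have a2: "rmul (K \<bullet>\<bullet> D) h \<bullet>\<bullet> K = (\<lambda>z w. (K \<bullet>\<bullet> (G \<star> L)) z w - (K \<bullet>\<bullet> (h \<star> G \<star> K)) z w)"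
  proof -
    have "rmul (K \<bullet>\<bullet> D) h \<bullet>\<bullet> K = (\<lambda>z w. ((K \<bullet>\<bullet> (G \<star> K)) \<bullet>\<bullet> (h \<star> K)) z w - (rmul K G \<bullet>\<bullet> (h \<star> K)) z w)"
      unfolding rmul_comp[of "K \<bullet>\<bullet> D"] unfolding K_D by (rule comp_diff_left) (intro sch)+
    moreover have "(K \<bullet>\<bullet> (G \<star> K)) \<bullet>\<bullet> (h \<star> K) = K \<bullet>\<bullet> (G \<star> L)"
      unfolding L_def by (subst comp_assoc) (auto simp: lmul_comp intro!: sch)
    moreover have "rmul K G \<bullet>\<bullet> (h \<star> K) = K \<bullet>\<bullet> (h \<star> G \<star> K)"
      by (simp add: rmul_comp lmul_lmul mult.commute)
    ultimately show ?thesis by simp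
  qed
  \<comment> \<open>Once both inner products are expanded into traces, they differ by this cyclic
    exchange only.\<close>
  have "trace (G \<star> (L \<bullet>\<bullet> (G \<star> K))) = trace (G \<star> (K \<bullet>\<bullet> (G \<star> L)))"
    by (rule trace_cyclic[OF integrable_G bfun_G integrable_G bfun_G sL schur_K])
  moreover have "ip (h \<star> (D \<bullet>\<bullet> K)) D = - trace (G \<star> rmul (K \<bullet>\<bullet> D) h) - (trace (G \<star> (K \<bullet>\<bullet> (h \<star> G \<star> K))) - trace (G \<star> (L \<bullet>\<bullet> (G \<star> K))))"
  proof -
    have "trace (G \<star> (K \<bullet>\<bullet> (h \<star> (D \<bullet>\<bullet> K)))) = trace (G \<star> (K \<bullet>\<bullet> (h \<star> G \<star> K))) - trace (G \<star> (L \<bullet>\<bullet> (G \<star> K)))"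
      unfolding a1 by (rule trace_diff[OF integrable_G]) (intro sch sL)+
    moreover have "schur (h \<star> (D \<bullet>\<bullet> K))" by (intro sch)
    ultimately show ?thesis using 1 by (simp add: ip_D)
  qed
  moreover have "ip (rmul (K \<bullet>\<bullet> D) h) D = trace (G \<star> (K \<bullet>\<bullet> (G \<star> L))) - trace (G \<star> (K \<bullet>\<bullet> (h \<star> G \<star> K))) - trace (G \<star> rmul (K \<bullet>\<bullet> D) h)"
  proof -
    have "trace (G \<star> (rmul (K \<bullet>\<bullet> D) h \<bullet>\<bullet> K)) = trace (G \<star> (K \<bullet>\<bullet> (G \<star> L))) - trace (G \<star> (K \<bullet>\<bullet> (h \<star> G \<star> K)))"
      unfolding a2 by (rule trace_diff[OF integrable_G]) (intro sch sL)+
    moreover have "schur (rmul (K \<bullet>\<bullet> D) h)" by (intro sch)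
    ultimately show ?thesis using 2 by (simp add: ip_D)
  qed
  ultimately show ?thesis by simp
qed

text \<open>By D = K D + D K the weighted form of \<open>D\<close> splits into two halves which
  agree up to moving the weight from the left of K D to its right. The discrepancy carries (G z ^ n
  - G w ^ n) (G z - G w) K z w and hence a factor \<open>E\<close>, so either half is close to half
  of the whole.\<close>

lemma symmetrize:
  "norm (ip ((\<lambda>x. G x ^ n) \<star> (K \<bullet>\<bullet> D)) D - ip ((\<lambda>x. G x ^ n) \<star> D) D / 2) \<le> A * (real n * (q ^ n / q) * E) / 2"
proof -
  note sch = schur_lmul schur_rmul schur_comp bfun_G schur_K schur_D bfun_G_power
  let ?h = "\<lambda>x. G x ^ n"
  define F where "F z w = (?h z - ?h w) * (G z - G w) * K z w" for z w
  note [measurable (raw)] = schur_measurable'[OF schur_K]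
  have F: "hsb F (real n * (q ^ n / q) * E)"
  proof (rule hsb_bound[OF hsb_D2])
    have "case_prod F = (\<lambda>x. (?h (fst x) - ?h (snd x)) * (G (fst x) - G (snd x)) * K (fst x) (snd x))"
      by (auto simp: F_def fun_eq_iff)
    then show "case_prod F \<in> borel_measurable (M \<Otimes>\<^sub>M M)" by simp
    show "norm (F z w) \<le> real n * (q ^ n / q) * norm ((G z - G w)\<^sup>2 * K z w)" for z w
      using mult_right_mono[OF norm_G_power_diff_le[of z n w], of "norm (G z - G w) * norm (K z w)"]
      by (simp add: F_def norm_mult power2_eq_square mult.assoc)
  qed (use q_pos in auto)
  have KD: "hsb (K \<bullet>\<bullet> D) A" by (rule hsb_K[OF hsb_D schur_D])
  have hKD: "hsb (?h \<star> (K \<bullet>\<bullet> D)) (q ^ n * A)" and KDh: "hsb (rmul (K \<bullet>\<bullet> D) ?h) (q ^ n * A)"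
    and hD: "hsb (?h \<star> D) (q ^ n * A)"
    by (auto intro!: hsb_lmul hsb_rmul KD hsb_D norm_G_power)
  have "D \<bullet>\<bullet> K = (\<lambda>z w. D z w - (K \<bullet>\<bullet> D) z w)" using D_split by (auto simp: fun_eq_iff)
  then have "?h \<star> (D \<bullet>\<bullet> K) = (\<lambda>z w. (?h \<star> D) z w - (?h \<star> (K \<bullet>\<bullet> D)) z w)"
    by (simp only: lmul_diff)
  then have "ip (?h \<star> (D \<bullet>\<bullet> K)) D = ip (?h \<star> D) D - ip (?h \<star> (K \<bullet>\<bullet> D)) D"
    using ip_diff_left[OF hD hKD hsb_D] by (simp only:)
  moreover have "ip (?h \<star> (K \<bullet>\<bullet> D)) D - ip (rmul (K \<bullet>\<bullet> D) ?h) D = ip (K \<bullet>\<bullet> D) F"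
  proof -
    have "ip (?h \<star> (K \<bullet>\<bullet> D)) D - ip (rmul (K \<bullet>\<bullet> D) ?h) D
       = ip (\<lambda>z w. (?h \<star> (K \<bullet>\<bullet> D)) z w - rmul (K \<bullet>\<bullet> D) ?h z w) D"
      by (rule ip_diff_left[OF hKD KDh hsb_D, symmetric])
    also have "\<dots> = ip (K \<bullet>\<bullet> D) F"
      unfolding ip_def by (intro Bochner_Integration.integral_cong)
        (auto simp: lmul_def rmul_def F_def commutator_def algebra_simps)
    finally show ?thesis .
  qed
  ultimately have "ip (?h \<star> (K \<bullet>\<bullet> D)) D - ip (?h \<star> D) D / 2 = ip (K \<bullet>\<bullet> D) F / 2"
  proof -
    let ?x = "ip (?h \<star> (K \<bullet>\<bullet> D)) D" and ?y = "ip (rmul (K \<bullet>\<bullet> D) ?h) D" and ?z = "ip (?h \<star> D) D"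
    assume "ip (?h \<star> (D \<bullet>\<bullet> K)) D = ?z - ?x" "?x - ?y = ip (K \<bullet>\<bullet> D) F"
    moreover have "ip (?h \<star> (D \<bullet>\<bullet> K)) D = ?y" by (rule ip_D_K[OF bfun_G_power])
    ultimately have "?z = ?x + ?y" "ip (K \<bullet>\<bullet> D) F = ?x - ?y" by (simp_all add: algebra_simps)
    then have "2 * ?x - ?z = ip (K \<bullet>\<bullet> D) F" by simp
    moreover have "?x - ?z / 2 = (2 * ?x - ?z) / 2" by simp
    ultimately show ?thesis by simp
  qed
  then have "norm (ip (?h \<star> (K \<bullet>\<bullet> D)) D - ip (?h \<star> D) D / 2) = norm (ip (K \<bullet>\<bullet> D) F) / 2"
    by (simp only: norm_divide norm_numeral)
  then show ?thesis using divide_right_mono[OF norm_ip_le[OF KD F], of 2] by (simp only:)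
qed

text \<open>Linearization, extraction of the symbol and symmetrization in succession. The resulting
  main term depends on \<open>k\<close> only through the factor k / 2, which makes the sum over
  \<open>k\<close> explicit.\<close>

lemma step_estimate:
  assumes "k \<ge> 1" "m = Suc (j + k)"
  shows "norm (ip (T j \<bullet>\<bullet> D) (commutator (\<lambda>x. G x ^ k)) - of_nat k / 2 * ip ((\<lambda>x. G x ^ (m - 2)) \<star> D) D)
    \<le> (real m)\<^sup>2 * (q ^ m / q ^ 3) * (2 * A * E + \<epsilon> * A\<^sup>2)"
proof -
  have m2: "k - 1 + j = m - 2" "m \<ge> 2" using assms by auto
  let ?x = "ip (T j \<bullet>\<bullet> D) (commutator (\<lambda>x. G x ^ k))"
  let ?a = "ip ((\<lambda>x. G x ^ (k - 1)) \<star> (T j \<bullet>\<bullet> D)) D"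
  let ?b = "ip ((\<lambda>x. G x ^ (m - 2)) \<star> (K \<bullet>\<bullet> D)) D"
  let ?c = "ip ((\<lambda>x. G x ^ (m - 2)) \<star> D) D / 2"
  \<comment> \<open>The powers of q in the three estimates all reduce to q ^ m / q ^ 3 because m = j
    + k + 1.\<close>
  define Q where "Q = q ^ m / q ^ 3"
  have Qeq: "q ^ (m - 2) / q = Q" "q ^ j * (q ^ k / q\<^sup>2) = Q"
  proof -
    obtain r where r: "m = r + 2" using m2 by (metis add.commute le_Suc_ex)
    show "q ^ (m - 2) / q = Q" using q_pos r unfolding Q_def by (simp add: power_add power2_eq_square power3_eq_cube)
    show "q ^ j * (q ^ k / q\<^sup>2) = Q" using q_pos assms unfolding Q_def by (simp add: power_add power2_eq_square power3_eq_cube)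
  qed
  have Q0: "Q \<ge> 0" using q_pos by (simp add: Q_def)
  have "norm (?x - of_nat k * ?a) \<le> (real k)\<^sup>2 * Q * (A * E)"
    using linearize_commutator_power[of j k] unfolding Qeq(2)[symmetric] by (simp add: mult_ac)
  moreover have "norm (of_nat k * ?a - of_nat k * ?b) \<le> real k * (real j * Q * (\<epsilon> * A\<^sup>2))"
    using mult_left_mono[OF pull_out_symbol[of "k - 1" j], of "real k"] unfolding m2 Qeq(1)
    by (simp add: right_diff_distrib[symmetric] norm_mult)
  moreover have "norm (of_nat k * ?b - of_nat k * ?c) \<le> real k * (real (m - 2) * Q * (A * E) / 2)"
  proof -
    have "norm (of_nat k * ?b - of_nat k * ?c) = real k * norm (?b - ?c)"
      by (simp only: right_diff_distrib[symmetric] norm_mult norm_of_nat)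
    then show ?thesis using mult_left_mono[OF symmetrize[of "m - 2"], of "real k"] unfolding Qeq(1)
      by (simp add: mult_ac)
  qed
  moreover have "?x - of_nat k / 2 * ip ((\<lambda>x. G x ^ (m - 2)) \<star> D) D =
     (?x - of_nat k * ?a) + (of_nat k * ?a - of_nat k * ?b) + (of_nat k * ?b - of_nat k * ?c)"
    by simp
  ultimately have "norm (?x - of_nat k / 2 * ip ((\<lambda>x. G x ^ (m - 2)) \<star> D) D) \<le>
     (real k)\<^sup>2 * Q * (A * E) + real k * (real j * Q * (\<epsilon> * A\<^sup>2)) + real k * (real (m - 2) * Q * (A * E) / 2)"
    by (metis (no_types, lifting) norm_triangle_mono)
  also have "\<dots> = ((real k)\<^sup>2 + real k * real (m - 2) / 2) * (Q * (A * E)) + (real k * real j) * (Q * (\<epsilon> * A\<^sup>2))"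
    by (simp add: algebra_simps)
  also have "\<dots> \<le> (2 * (real m)\<^sup>2) * (Q * (A * E)) + (real m)\<^sup>2 * (Q * (\<epsilon> * A\<^sup>2))"
  proof (intro add_mono mult_right_mono)
    have k: "real k \<le> real m" "real j \<le> real m" "real (m - 2) \<le> real m" using assms by auto
    have 1: "(real k)\<^sup>2 \<le> (real m)\<^sup>2" "real k * real (m - 2) \<le> (real m)\<^sup>2" "real k * real j \<le> (real m)\<^sup>2"
      using k by (auto simp: power2_eq_square simp del: of_nat_mult intro!: mult_mono)
    moreover have "real k * real (m - 2) / 2 \<le> (real m)\<^sup>2"
      using 1(2) zero_le_power2[of "real m"] by linarith
    ultimately show "(real k)\<^sup>2 + real k * real (m - 2) / 2 \<le> 2 * (real m)\<^sup>2" "real k * real j \<le> (real m)\<^sup>2"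
      by linarith+
  qed (use Q0 A_nonneg E_nonneg eps_nonneg in auto)
  finally show ?thesis unfolding Q_def[symmetric] by (simp add: algebra_simps)
qed

text \<open>The main terms k / 2 sum over 1 \<le> k < m to m (m - 1) / 4, and the m - 1 errors
  contribute one more power of m.\<close>

lemma trace_estimate:
  assumes "m \<ge> 1"
  shows "norm (trace ((\<lambda>x. G x ^ m) \<star> K) - trace (G \<star> T (m - 1)) - of_nat (m * (m - 1)) / 4 * ip ((\<lambda>x. G x ^ (m - 2)) \<star> D) D)
    \<le> real m ^ 3 * (q ^ m / q ^ 3) * (2 * A * E + \<epsilon> * A\<^sup>2)"
proof -
  let ?I = "ip ((\<lambda>x. G x ^ (m - 2)) \<star> D) D"
  let ?B = "(real m)\<^sup>2 * (q ^ m / q ^ 3) * (2 * A * E + \<epsilon> * A\<^sup>2)"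
  have B: "?B \<ge> 0" using A_nonneg E_nonneg eps_nonneg q_pos by auto
  have "(\<Sum>k\<in>{1..<m}. of_nat k / 2 * ?I) = of_nat (m * (m - 1)) / 4 * ?I"
  proof -
    have "(\<Sum>k\<in>{1..<m}. of_nat k / 2 :: complex) = of_nat (m * (m - 1)) / 4"
    proof -
      have "(\<Sum>k\<in>{1..<m}. of_nat k / 2 :: complex) * 4 = of_nat (m * (m - 1))"
        using assms by (induction m rule: dec_induct) (auto simp: algebra_simps of_nat_diff)
      then show ?thesis by (simp add: field_simps)
    qed
    then show ?thesis by (simp only: sum_distrib_right[symmetric])
  qed
  then have "norm (trace ((\<lambda>x. G x ^ m) \<star> K) - trace (G \<star> T (m - 1)) - of_nat (m * (m - 1)) / 4 * ?I)
    = norm (\<Sum>k\<in>{1..<m}. ip (T (m - 1 - k) \<bullet>\<bullet> D) (commutator (\<lambda>x. G x ^ k)) - of_nat k / 2 * ?I)"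
    unfolding trace_telescope[OF assms] by (simp only: sum_subtractf)
  also have "\<dots> \<le> (\<Sum>k\<in>{1..<m}. ?B)"
  proof (rule sum_norm_le)
    fix k assume "k \<in> {1..<m}"
    then show "norm (ip (T (m - 1 - k) \<bullet>\<bullet> D) (commutator (\<lambda>x. G x ^ k)) - of_nat k / 2 * ?I) \<le> ?B"
      by (intro step_estimate) auto
  qed
  also have "\<dots> = real (m - 1) * ?B" by simp
  also have "\<dots> \<le> real m * ?B" using B by (intro mult_right_mono) auto
  finally show ?thesis by (simp add: power3_eq_cube power2_eq_square mult_ac)
qed

end

section \<open>The logarithm of the Fredholm determinant\<close>

text \<open>The convolution sum is at most n-independent: it is D times B r ^ n. Beyond an index N
  \<ge> D the factor Suc n on the left outweighs D and the induction closes; \<open>B\<close> is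
  chosen to cover the initial segment.\<close>

lemma newton_series_bound:
  fixes c s :: "nat \<Rightarrow> complex"
  assumes q: "0 < q" "q < r" and s: "\<And>m. norm (s m) \<le> C * q ^ m"
    and rec: "\<And>n. of_nat (Suc n) * c (Suc n) = (\<Sum>m\<le>n. s m * c (n - m))"
  shows "\<exists>B. \<forall>n. norm (c n) \<le> B * r ^ n"
proof -
  have C: "C \<ge> 0" using order_trans[OF norm_ge_zero s[of 0]] by simp
  have r: "r > 0" "q / r < 1" "q / r > 0" using q by auto
  have nr: "norm (q / r) < 1" using r unfolding real_norm_def by linarith
  define D where "D = C / (1 - q / r) / r"
  have D: "D \<ge> 0" using C r unfolding D_def by auto
  define N where "N = nat \<lceil>D\<rceil>"
  have N: "D \<le> real N" unfolding N_def by linarith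
  define B where "B = (\<Sum>i\<le>N. norm (c i) / r ^ i)"
  have B: "B \<ge> 0" unfolding B_def using r by (intro sum_nonneg) auto
  have "norm (c n) \<le> B * r ^ n" for n
  proof (induction n rule: less_induct)
    case (less n)
    show ?case
    proof (cases "n \<le> N")
      case True
      have "norm (c n) / r ^ n \<le> B"
        unfolding B_def using True r by (intro member_le_sum) auto
      then show ?thesis using r by (simp add: field_simps)
    next
      case False
      then obtain k where k: "n = Suc k" "N \<le> k" by (cases n) auto
      have "real n * norm (c n) = norm (\<Sum>m\<le>k. s m * c (k - m))"
        unfolding k rec[symmetric] norm_mult norm_of_nat ..
      also have "\<dots> \<le> (\<Sum>m\<le>k. B * r ^ k * C * (q / r) ^ m)"
      proof (rule sum_norm_le)
        fix m assume m: "m \<in> {..k}"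
        have "norm (s m * c (k - m)) \<le> (C * q ^ m) * (B * r ^ (k - m))"
          unfolding norm_mult using C q k by (intro mult_mono s less) auto
        also have "\<dots> = B * r ^ k * C * (q / r) ^ m"
          using m r by (simp add: power_diff power_divide)
        finally show "norm (s m * c (k - m)) \<le> B * r ^ k * C * (q / r) ^ m" .
      qed
      also have "\<dots> = B * r ^ k * C * (\<Sum>m\<le>k. (q / r) ^ m)"
        by (simp add: sum_distrib_left)
      also have "\<dots> \<le> B * r ^ k * C * (1 / (1 - q / r))"
      proof (rule mult_left_mono)
        have "(\<Sum>m<Suc k. (q / r) ^ m) \<le> (\<Sum>m. (q / r) ^ m)"
          by (rule sum_le_suminf) (use r nr in \<open>auto intro!: summable_geometric\<close>)
        then show "(\<Sum>m\<le>k. (q / r) ^ m) \<le> 1 / (1 - q / r)"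
          using suminf_geometric[OF nr] by (simp add: lessThan_Suc_atMost)
      qed (use B r C in auto)
      also have "\<dots> = B * r ^ n * D" using r unfolding D_def k by simp
      also have "\<dots> \<le> B * r ^ n * real n"
        using N k B r by (intro mult_left_mono) auto
      finally show ?thesis using k by (simp add: mult.commute)
    qed
  qed
  then show ?thesis by blast
qed

text \<open>The recursion is the differential equation a' = b a for the generating functions. With
  h' = b and h 0 = 0 the product a exp (- h) is constant on the closed unit disc, and its values at
  0 and 1 are compared.\<close>

lemma newton_series_exp:
  fixes c s :: "nat \<Rightarrow> complex"
  assumes q: "0 < q" "q < 1" and s: "\<And>m. norm (s m) \<le> C * q ^ m" and c0: "c 0 = 1"
    and rec: "\<And>n. of_nat (Suc n) * c (Suc n) = (\<Sum>m\<le>n. s m * c (n - m))"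
  shows "summable (\<lambda>n. norm (c n))" "summable (\<lambda>m. s m / of_nat (Suc m))"
    "suminf c = exp (\<Sum>m. s m / of_nat (Suc m))"
proof -
  define r where "r = (1 + q) / 2"
  have r: "q < r" "r < 1" "0 < r" using q by (auto simp: r_def)
  obtain B where B: "\<And>n. norm (c n) \<le> B * r ^ n"
    using newton_series_bound[OF q(1) r(1) s rec] by blast
  \<comment> \<open>Chosen with R > 1 but r R < 1 and q R < 1, so that all three series converge
    beyond the unit circle and can be evaluated at 1.\<close>
  define R where "R = 1 / ((1 + r) / 2)"
  have R: "R > 1" "r * R < 1" "q * R < 1"
    using r q unfolding R_def by (auto simp: field_simps)
  have rad: "fps_conv_radius (Abs_fps f) > 1" if "\<And>n. norm (f n) \<le> D * t ^ n" "0 < t" "t * R < 1" for f :: "nat \<Rightarrow> complex" and D t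
  proof -
    have "summable (\<lambda>n. f n * of_real R ^ n)"
    proof (rule summable_comparison_test'[where N = 0])
      show "summable (\<lambda>n. D * (t * R) ^ n)" using that R by (intro summable_mult summable_geometric) auto
      show "norm (f n * of_real R ^ n) \<le> D * (t * R) ^ n" for n
        using that(1)[of n] R mult_right_mono[OF that(1)[of n], of "R ^ n"]
        by (simp add: norm_mult norm_power power_mult_distrib mult.assoc)
    qed
    then have "ereal (norm (of_real R :: complex)) \<le> conv_radius f" by (rule conv_radius_geI)
    then show ?thesis using R by (simp add: fps_conv_radius_def) (metis ereal_less(4) one_ereal_def order_less_le_trans)
  qed
  define a where "a = Abs_fps c"
  define b where "b = Abs_fps s"
  define h where "h = Abs_fps (\<lambda>n. if n = 0 then 0 else s (n - 1) / of_nat n)"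
  have C: "C \<ge> 0" using order_trans[OF norm_ge_zero s[of 0]] by simp
  have ra: "fps_conv_radius a > 1" unfolding a_def using B r R by (intro rad[of c B r]) auto
  have rb: "fps_conv_radius b > 1" unfolding b_def using s q R by (intro rad[of s C q]) auto
  have hb: "norm (if n = 0 then 0 else s (n - 1) / of_nat n) \<le> C / q * q ^ n" for n
  proof (cases n)
    case (Suc k)
    have "norm (s k) / real (Suc k) \<le> norm (s k) / 1" by (intro divide_left_mono) auto
    then show ?thesis using s[of k] q Suc by (simp add: norm_divide del: of_nat_Suc)
  qed (use C q in auto)
  have rh: "fps_conv_radius h > 1" unfolding h_def using hb q R by (intro rad[of _ "C / q" q]) auto
  have da: "fps_deriv a = b * a"
    by (rule fps_ext) (simp add: a_def b_def fps_mult_nth rec[symmetric] atLeast0AtMost del: of_nat_Suc)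
  have dh: "fps_deriv h = b"
    by (rule fps_ext) (simp add: h_def b_def del: of_nat_Suc)
  have const: "\<exists>k. \<forall>z\<in>cball 0 1. eval_fps a z * exp (- eval_fps h z) = k"
  proof (rule has_field_derivative_zero_constant)
    fix z :: complex assume "z \<in> cball 0 1"
    then have z: "ereal (norm z) < fps_conv_radius a" "ereal (norm z) < fps_conv_radius b" "ereal (norm z) < fps_conv_radius h"
      using ra rb rh by (auto simp: one_ereal_def intro: order_le_less_trans[of _ "ereal 1"])
    have "((\<lambda>z. eval_fps a z * exp (- eval_fps h z)) has_field_derivative
       eval_fps (b * a) z * exp (- eval_fps h z) + exp (- eval_fps h z) * (- eval_fps b z) * eval_fps a z) (at z within cball 0 1)"
      using has_field_derivative_eval_fps[OF z(1), of "cball 0 1"] has_field_derivative_eval_fps[OF z(3), of "cball 0 1"]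
      by (auto intro!: derivative_eq_intros z simp: da dh)
    then show "((\<lambda>z. eval_fps a z * exp (- eval_fps h z)) has_field_derivative 0) (at z within cball 0 1)"
      using z by (simp add: eval_fps_mult)
  qed simp
  then have "eval_fps a 1 * exp (- eval_fps h 1) = eval_fps a 0 * exp (- eval_fps h 0)" by force
  also have "\<dots> = 1" by (simp add: eval_fps_at_0 a_def h_def c0)
  finally have ev: "eval_fps a 1 = exp (eval_fps h 1)"
    by (simp add: exp_minus field_simps)
  show "summable (\<lambda>n. norm (c n))"
    by (rule summable_comparison_test'[where N = 0 and g = "\<lambda>n. B * r ^ n"])
      (use B r in \<open>auto intro!: summable_mult summable_geometric\<close>)
  have sh: "summable (\<lambda>n. fps_nth h n)"
    using sums_eval_fps[of 1 h] rh by (simp add: one_ereal_def sums_iff)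
  then have "summable (\<lambda>n. fps_nth h (Suc n))" by (subst summable_Suc_iff)
  then show "summable (\<lambda>m. s m / of_nat (Suc m))" by (simp add: h_def del: of_nat_Suc)
  have "eval_fps h 1 = (\<Sum>n. fps_nth h n)" by (simp add: eval_fps_def)
  also have "\<dots> = (\<Sum>n. fps_nth h (Suc n))" using suminf_split_head[OF sh] by (simp add: h_def)
  finally have "eval_fps h 1 = (\<Sum>m. s m / of_nat (Suc m))" by (simp add: h_def del: of_nat_Suc)
  moreover have "eval_fps a 1 = suminf c" by (simp add: eval_fps_def a_def)
  ultimately show "suminf c = exp (\<Sum>m. s m / of_nat (Suc m))" using ev by simp
qed

section \<open>Geometric decay of the traces of compressed powers\<close>

context projection_symbol begin

lemma integral_sq_K: "(LINT u|M. (norm (K z u))\<^sup>2) = norm (K z z)" "(LINT u|M. (norm (K u z))\<^sup>2) = norm (K z z)"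
proof -
  have "K z u * K u z = of_real ((norm (K z u))\<^sup>2)" for u
    unfolding hermitian[of u z] of_real_power complex_norm_square[symmetric] ..
  then have "of_real (LINT u|M. (norm (K z u))\<^sup>2) = (K \<bullet>\<bullet> K) z z"
    unfolding comp_def by (simp only: integral_complex_of_real)
  then have "norm (of_real (LINT u|M. (norm (K z u))\<^sup>2) :: complex) = norm (K z z)" by (simp only: reproducing)
  moreover have "(LINT u|M. (norm (K z u))\<^sup>2) \<ge> 0" by simp
  ultimately show 1: "(LINT u|M. (norm (K z u))\<^sup>2) = norm (K z z)" by (simp only: norm_of_real abs_of_nonneg)
  have "(LINT u|M. (norm (K u z))\<^sup>2) = (LINT u|M. (norm (K z u))\<^sup>2)"
  proof (intro Bochner_Integration.integral_cong refl)
    show "(norm (K u z))\<^sup>2 = (norm (K z u))\<^sup>2" for u by (simp only: hermitian[of u z] complex_mod_cnj)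
  qed
  then show "(LINT u|M. (norm (K u z))\<^sup>2) = norm (K z z)" using 1 by (simp only:)
qed

lemma T_col: "(LINT z|M. (norm (T j z w))\<^sup>2) \<le> (q ^ j)\<^sup>2 * norm (K w w)"
proof (induction j)
  case 0
  then show ?case by (simp add: integral_sq_K)
next
  case (Suc j)
  have s: "schur (G \<star> T j)" by (intro schur_lmul bfun_G schur_T)
  have "(LINT z|M. (norm (T (Suc j) z w))\<^sup>2) \<le> (LINT z|M. (norm ((G \<star> T j) z w))\<^sup>2)"
    unfolding T.simps by (rule contraction_col[OF s])
  also have "\<dots> \<le> (LINT z|M. q\<^sup>2 * (norm (T j z w))\<^sup>2)"
    by (intro integral_mono integrable_mult_right integrable_sq_col s schur_T)
       (auto simp: lmul_def norm_mult power_mult_distrib intro!: mult_right_mono power_mono norm_G)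
  also have "\<dots> \<le> q\<^sup>2 * ((q ^ j)\<^sup>2 * norm (K w w))" using Suc by (simp add: mult_left_mono)
  finally show ?case by (simp add: power_mult_distrib)
qed

text \<open>Since T j = K T j, Cauchy--Schwarz turns the column norm of \<open>T j\<close> into a
  pointwise bound. The rate is q itself; a bound through row integrals would bring in powers of the
  Schur constant of \<open>K\<close>.\<close>

lemma norm_T_le:
  assumes "\<And>x. norm (K x x) \<le> \<kappa>"
  shows "norm (T j z w) \<le> q ^ j * \<kappa>"
proof -
  have k: "\<kappa> \<ge> 0" using assms[of undefined] norm_ge_zero order_trans by blast
  note [measurable] = schur_row_measurable[OF schur_K] schur_col_measurable[OF schur_T]
  have "norm (K z u) = norm (K u z)" for u by (simp only: hermitian[of u z] complex_mod_cnj)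
  then have i: "integrable M (\<lambda>u. (norm (K z u))\<^sup>2)" using integrable_sq_col[OF schur_K, of z] by (simp only:)
  have "ennreal (norm (T j z w)) \<le> (\<integral>\<^sup>+u. ennreal (norm (K z u)) * ennreal (norm (T j u w)) \<partial>M)"
    using norm_comp_le[OF schur_K schur_T[of j], of z w] unfolding K_T .
  then have "ennreal (norm (T j z w)) ^ 2 \<le> (\<integral>\<^sup>+u. ennreal (norm (K z u)) * ennreal (norm (T j u w)) \<partial>M) ^ 2"
    by (rule power_mono) simp
  also have "\<dots> \<le> (\<integral>\<^sup>+u. ennreal (norm (K z u)) ^ 2 \<partial>M) * (\<integral>\<^sup>+u. ennreal (norm (T j u w)) ^ 2 \<partial>M)"
    by (rule Cauchy_Schwarz_nn_integral) measurable
  also have "\<dots> = ennreal (LINT u|M. (norm (K z u))\<^sup>2) * ennreal (LINT u|M. (norm (T j u w))\<^sup>2)"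
    using i integrable_sq_col[OF schur_T[of j], of w] by (simp add: ennreal_power nn_integral_eq_integral)
  also have "\<dots> \<le> ennreal \<kappa> * ennreal ((q ^ j)\<^sup>2 * \<kappa>)"
    using T_col[of j w] assms[of z] mult_left_mono[OF assms[of w], of "(q ^ j)\<^sup>2"]
    by (intro mult_mono ennreal_leI) (auto simp: integral_sq_K)
  also have "\<dots> = ennreal (q ^ j * \<kappa>) ^ 2"
    using k q_pos by (simp add: ennreal_mult[symmetric] ennreal_power power_mult_distrib power2_eq_square mult_ac)
  finally have "ennreal (norm (T j z w)) \<le> ennreal (q ^ j * \<kappa>)"
    using k q_pos by (intro ennreal_power2_le) auto
  then show ?thesis using k q_pos by (simp add: ennreal_le_iff)
qed

lemma norm_trace_T_le:
  assumes "\<And>x. norm (K x x) \<le> \<kappa>"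
  shows "norm (trace (G \<star> T m)) \<le> ((LINT x|M. \<bar>g x\<bar>) * \<kappa>) * q ^ m"
proof -
  have "norm (trace (G \<star> T m)) \<le> (LINT x|M. norm ((G \<star> T m) x x))"
    unfolding trace_def by (rule integral_norm_bound)
  also have "\<dots> \<le> (LINT x|M. \<bar>g x\<bar> * (q ^ m * \<kappa>))"
  proof (rule integral_mono)
    show "integrable M (\<lambda>x. norm ((G \<star> T m) x x))"
      by (intro integrable_norm integrable_trace integrable_G schur_T)
    show "integrable M (\<lambda>x. \<bar>g x\<bar> * (q ^ m * \<kappa>))" using g_integrable by simp
    show "norm ((G \<star> T m) x x) \<le> \<bar>g x\<bar> * (q ^ m * \<kappa>)" for x
      using norm_T_le[OF assms] by (auto simp: lmul_def norm_mult G_def intro!: mult_left_mono)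
  qed
  finally show ?thesis by (simp add: mult_ac)
qed

theorem fredholm_exp:
  assumes "q < 1" "\<And>x. norm (K x x) \<le> \<kappa>"
  shows "summable (\<lambda>n. norm (fredholm_coeff n))"
    and "summable (\<lambda>m. (-1) ^ m * trace (G \<star> T m) / of_nat (Suc m))"
    and "suminf fredholm_coeff = exp (\<Sum>m. (-1) ^ m * trace (G \<star> T m) / of_nat (Suc m))"
proof -
  have *: "norm ((-1) ^ m * trace (G \<star> T m)) \<le> ((LINT x|M. \<bar>g x\<bar>) * \<kappa>) * q ^ m" for m
    using norm_trace_T_le[OF assms(2)] by (simp add: norm_mult norm_power)
  have c0: "fredholm_coeff 0 = 1" by (simp add: fredholm_coeff_def fredholm_det_0)
  note e = newton_series_exp[OF q_pos assms(1) * c0 newton_identity]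
  show "summable (\<lambda>n. norm (fredholm_coeff n))" by (rule e(1))
  show "summable (\<lambda>m. (-1) ^ m * trace (G \<star> T m) / of_nat (Suc m))" by (rule e(2))
  show "suminf fredholm_coeff = exp (\<Sum>m. (-1) ^ m * trace (G \<star> T m) / of_nat (Suc m))" by (rule e(3))
qed

end

section \<open>Summation of the trace expansion over all powers\<close>

lemma summable_square_geometric:
  fixes q :: real assumes "0 < q" "q < 1" shows "summable (\<lambda>m. (real m)\<^sup>2 * q ^ m)"
proof -
  have 1: "summable (\<lambda>n. diffs (\<lambda>n. 1) n * x ^ n)" if "norm x < 1" for x :: real
    using that by (intro termdiff_converges[where K = 1]) (auto intro: summable_geometric)
  have "summable (\<lambda>n. diffs (diffs (\<lambda>n. 1)) n * q ^ n)"
    using assms by (intro termdiff_converges[where K = 1] 1) auto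
  then show ?thesis
    by (rule summable_comparison_test'[where N = 0])
       (use assms in \<open>auto simp: diffs_def power2_eq_square intro!: mult_mono\<close>)
qed

text \<open>Collects the trace errors, of order m ^ 3, after the division by m in the logarithmic
  series.\<close>

definition series_constant :: "real \<Rightarrow> real" where
  "series_constant q = (\<Sum>m. (real m)\<^sup>2 * (q ^ m / q ^ 3))"

context projection_estimate begin

text \<open>Termwise integration of the series of ln (1 + g). One factor |g| is kept outside the
  geometric bound to supply integrability. At m = 0 division by zero makes the coefficient
  vanish.\<close>

lemma trace_log:
  assumes "q < 1" "\<And>x. norm (K x x) \<le> \<kappa>"
  shows "(\<lambda>m. - ((-1) ^ m) / of_nat m * trace ((\<lambda>x. G x ^ m) \<star> K)) sums (LINT x|M. of_real (ln (1 + g x)) * K x x)"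
proof -
  have k: "\<kappa> \<ge> 0" using assms(2)[of undefined] norm_ge_zero order_trans by blast
  let ?f = "\<lambda>m x. (- ((-1) ^ m) / of_nat m) * ((\<lambda>x. G x ^ m) \<star> K) x x"
  have i: "integrable M (?f m)" for m
    by (cases "m = 0") (auto intro!: integrable_mult_right integrable_trace integrable_G_power schur_K)
  have b: "norm (?f m x) \<le> \<bar>g x\<bar> * (\<kappa> / q * q ^ m)" for m x
  proof (cases m)
    case (Suc n)
    have "norm (?f m x) = 1 / real m * norm (G x ^ m) * norm (K x x)"
      by (simp add: lmul_def norm_mult norm_divide norm_power)
    also have "\<dots> \<le> 1 * (\<bar>g x\<bar> * q ^ n) * \<kappa>"
    proof (intro mult_mono assms(2))
      have "norm (G x ^ m) = \<bar>g x\<bar> * norm (G x ^ n)" by (simp add: Suc norm_mult G_def)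
      then show "norm (G x ^ m) \<le> \<bar>g x\<bar> * q ^ n" using norm_G_power[of x n] by (simp add: mult_left_mono)
    qed (use Suc q_pos in auto)
    finally show ?thesis using Suc q_pos by (simp add: mult_ac)
  qed (use k q_pos in auto)
  have geo: "summable (\<lambda>m. c * q ^ m)" for c using assms q_pos by (intro summable_mult summable_geometric) auto
  have s1: "summable (\<lambda>m. norm (?f m x))" for x
    by (rule summable_comparison_test'[where N = 0 and g = "\<lambda>m. \<bar>g x\<bar> * (\<kappa> / q) * q ^ m"])
      (use b geo in \<open>auto simp: mult.assoc\<close>)
  have s2: "summable (\<lambda>m. LINT x|M. norm (?f m x))"
  proof (rule summable_comparison_test'[where N = 0 and g = "\<lambda>m. (LINT x|M. \<bar>g x\<bar>) * (\<kappa> / q) * q ^ m"])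
    fix m
    have "(LINT x|M. norm (?f m x)) \<le> (LINT x|M. \<bar>g x\<bar> * (\<kappa> / q * q ^ m))"
      by (intro integral_mono integrable_norm i b) (use g_integrable in auto)
    then show "norm (LINT x|M. norm (?f m x)) \<le> (LINT x|M. \<bar>g x\<bar>) * (\<kappa> / q) * q ^ m"
      by (simp add: mult.assoc)
  qed (rule geo)
  have pt: "(\<Sum>m. ?f m x) = of_real (ln (1 + g x)) * K x x" for x
  proof -
    have "(\<lambda>m. - ((- g x) ^ m) / of_nat m) sums ln (1 + g x)"
      using g_bound[of x] assms(1) by (intro ln_series') auto
    then have "(\<lambda>m. complex_of_real (- ((- g x) ^ m) / of_nat m) * K x x) sums (of_real (ln (1 + g x)) * K x x)"
      by (intro sums_mult2 sums_of_real)
    moreover have "complex_of_real (- ((- g x) ^ m) / of_nat m) * K x x = ?f m x" for m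
      by (simp add: lmul_def G_def power_minus[of "g x"])
    ultimately have "(\<lambda>m. ?f m x) sums (of_real (ln (1 + g x)) * K x x)" by (simp only:)
    then show ?thesis by (rule sums_unique[symmetric])
  qed
  have "(\<lambda>m. LINT x|M. ?f m x) sums (LINT x|M. (\<Sum>m. ?f m x))"
    by (rule sums_integral[OF i _ s2]) (use s1 in auto)
  then show ?thesis unfolding pt by (simp add: trace_def)
qed

text \<open>The series of (n + 1) (- g) ^ n sums to 1 / (1 + g)^2 and is integrated termwise against
  the integrable function |D|^2.\<close>

lemma ip_series:
  assumes "q < 1"
  shows "(\<lambda>n. of_nat (Suc n) * (-1) ^ n * ip ((\<lambda>x. G x ^ n) \<star> D) D) sums
     of_real (LINT x|(M \<Otimes>\<^sub>M M). ((g (fst x) - g (snd x)) / (1 + g (fst x)))\<^sup>2 * (norm (K (fst x) (snd x)))\<^sup>2)"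
proof -
  let ?d = "\<lambda>x. (norm (D (fst x) (snd x)))\<^sup>2"
  let ?f = "\<lambda>n x. of_nat (Suc n) * (-1) ^ n * (((\<lambda>x. G x ^ n) \<star> D) (fst x) (snd x) * cnj (D (fst x) (snd x)))"
  have hn: "hsb ((\<lambda>x. G x ^ n) \<star> D) (q ^ n * A)" for n by (auto intro!: hsb_lmul hsb_D norm_G_power)
  have i: "integrable (M \<Otimes>\<^sub>M M) (?f n)" for n
    by (intro integrable_mult_right hsb_integrable[OF hn hsb_D])
  have feq: "?f n x = of_nat (Suc n) * (- G (fst x)) ^ n * of_real (?d x)" for n x
  proof -
    have "of_real (?d x) = D (fst x) (snd x) * cnj (D (fst x) (snd x))" by (simp only: complex_norm_square)
    then show ?thesis by (simp only: lmul_def power_minus[of "G (fst x)"] mult_ac)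
  qed
  have id: "integrable (M \<Otimes>\<^sub>M M) ?d"
    using integrable_norm[OF hsb_integrable[OF hsb_D hsb_D]] by (simp add: norm_mult power2_eq_square)
  have b: "norm (?f n x) \<le> real (Suc n) * q ^ n * ?d x" for n x
    unfolding feq norm_mult norm_of_nat norm_power norm_minus_cancel norm_of_real
    by (auto intro!: mult_right_mono mult_left_mono power_mono norm_G simp del: of_nat_Suc)
  have geo: "summable (\<lambda>n. real (Suc n) * q ^ n)"
    using geometric_deriv_sums[of q] assms q_pos by (auto simp: sums_iff)
  have s1: "summable (\<lambda>n. norm (?f n x))" for x
    by (rule summable_comparison_test'[where N = 0, OF summable_mult2[OF geo, of "?d x"]]) (use b in auto)
  have s2: "summable (\<lambda>n. LINT x|(M \<Otimes>\<^sub>M M). norm (?f n x))"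
  proof (rule summable_comparison_test'[where N = 0, OF summable_mult2[OF geo, of "LINT x|(M \<Otimes>\<^sub>M M). ?d x"]])
    fix n
    have "(LINT x|(M \<Otimes>\<^sub>M M). norm (?f n x)) \<le> (LINT x|(M \<Otimes>\<^sub>M M). real (Suc n) * q ^ n * ?d x)"
      by (intro integral_mono integrable_norm i b integrable_mult_right id)
    then show "norm (LINT x|(M \<Otimes>\<^sub>M M). norm (?f n x)) \<le> real (Suc n) * q ^ n * (LINT x|(M \<Otimes>\<^sub>M M). ?d x)"
      by (simp del: of_nat_Suc)
  qed
  have pt: "(\<Sum>n. ?f n x) = of_real (((g (fst x) - g (snd x)) / (1 + g (fst x)))\<^sup>2 * (norm (K (fst x) (snd x)))\<^sup>2)" for x
  proof -
    have "(\<lambda>n. of_nat (Suc n) * (- G (fst x)) ^ n) sums (1 / (1 - (- G (fst x)))\<^sup>2)"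
      using norm_G[of "fst x"] assms by (intro geometric_deriv_sums) auto
    then have "(\<lambda>n. ?f n x) sums (1 / (1 - (- G (fst x)))\<^sup>2 * of_real (?d x))"
      unfolding feq by (rule sums_mult2)
    moreover have "?d x = (g (fst x) - g (snd x))\<^sup>2 * (norm (K (fst x) (snd x)))\<^sup>2"
      unfolding commutator_def norm_mult power_mult_distrib G_def by (simp flip: of_real_diff)
    moreover have "1 / (1 - (- G (fst x)))\<^sup>2 = of_real (1 / (1 + g (fst x))\<^sup>2)" by (simp add: G_def)
    ultimately show ?thesis by (simp add: sums_iff power_divide)
  qed
  have "(\<lambda>n. LINT x|(M \<Otimes>\<^sub>M M). ?f n x) sums (LINT x|(M \<Otimes>\<^sub>M M). (\<Sum>n. ?f n x))"
    by (rule sums_integral[OF i _ s2]) (use s1 in auto)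
  then show ?thesis unfolding pt integral_complex_of_real by (simp add: ip_def del: of_nat_Suc)
qed

theorem fredholm_log_estimate:
  assumes q1: "q < 1" and \<kappa>: "\<And>x. norm (K x x) \<le> \<kappa>"
  shows "\<exists>L. suminf fredholm_coeff = exp L \<and>
    norm (L - (LINT x|M. of_real (ln (1 + g x)) * K x x)
      - of_real (LINT x|(M \<Otimes>\<^sub>M M). ((g (fst x) - g (snd x)) / (1 + g (fst x)))\<^sup>2 * (norm (K (fst x) (snd x)))\<^sup>2) / 4)
     \<le> series_constant q * (2 * A * E + \<epsilon> * A\<^sup>2)"
proof -
  define L where "L = (\<Sum>m. (-1) ^ m * trace (G \<star> T m) / of_nat (Suc m))"
  define X where "X = (LINT x|M. of_real (ln (1 + g x)) * K x x)"
  define J where "J = complex_of_real (LINT x|(M \<Otimes>\<^sub>M M). ((g (fst x) - g (snd x)) / (1 + g (fst x)))\<^sup>2 * (norm (K (fst x) (snd x)))\<^sup>2)"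
  \<comment> \<open>The value at 0 is 0, so the series beginning at m = 1 may be summed from
    0.\<close>
  define a :: "nat \<Rightarrow> complex" where "a m = (-1) ^ m / of_nat m" for m
  let ?t = "\<lambda>m. trace (G \<star> T (m - 1))" and ?x = "\<lambda>m. trace ((\<lambda>x. G x ^ m) \<star> K)"
  let ?p = "\<lambda>m. of_nat (m * (m - 1)) / 4 * ip ((\<lambda>x. G x ^ (m - 2)) \<star> D) D"
  define \<eta> where "\<eta> = 2 * A * E + \<epsilon> * A\<^sup>2"
  have \<eta>: "\<eta> \<ge> 0" unfolding \<eta>_def using A_nonneg E_nonneg eps_nonneg by auto
  have "(\<lambda>m. (-1) ^ m * trace (G \<star> T m) / of_nat (Suc m)) sums L"
    unfolding L_def by (rule summable_sums[OF fredholm_exp(2)[OF q1 \<kappa>]])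
  then have "(\<lambda>m. - a (Suc m) * ?t (Suc m)) sums L" by (simp add: a_def del: of_nat_Suc T.simps)
  then have 1: "(\<lambda>m. - a m * ?t m) sums L"
    by (subst (asm) sums_Suc_iff) (simp add: a_def)
  have 2: "(\<lambda>m. - a m * ?x m) sums X"
    using trace_log[OF q1 \<kappa>] unfolding X_def a_def by (simp only: minus_divide_left)
  have "(\<lambda>n. of_nat (Suc n) * (-1) ^ n * ip ((\<lambda>x. G x ^ n) \<star> D) D / 4) sums (J / 4)"
    using ip_series[OF q1] unfolding J_def by (rule sums_divide)
  \<comment> \<open>At m = n + 2 the factor m (m - 1) / 4, divided by m, leaves (n + 1) / 4.\<close>
  moreover have "of_nat (Suc n) * (-1) ^ n * ip ((\<lambda>x. G x ^ n) \<star> D) D / 4 = a (Suc (Suc n)) * ?p (Suc (Suc n))" for n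
    unfolding a_def of_nat_mult by (simp del: of_nat_Suc)
  ultimately have "(\<lambda>n. a (Suc (Suc n)) * ?p (Suc (Suc n))) sums (J / 4)" by (simp only:)
  then have 3: "(\<lambda>n. a n * ?p n) sums (J / 4)"
  proof -
    assume "(\<lambda>n. a (Suc (Suc n)) * ?p (Suc (Suc n))) sums (J / 4)"
    then have "(\<lambda>n. a (Suc n) * ?p (Suc n)) sums (J / 4)"
      by (subst (asm) sums_Suc_iff[of "\<lambda>n. a (Suc n) * ?p (Suc n)"]) simp
    then show ?thesis
      by (subst (asm) sums_Suc_iff[of "\<lambda>n. a n * ?p n"]) simp
  qed
  have "(\<lambda>m. (- a m * ?t m) - (- a m * ?x m) - a m * ?p m) sums (L - X - J / 4)"
    by (intro sums_diff 1 2 3)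
  moreover have "(- a m * ?t m) - (- a m * ?x m) - a m * ?p m = a m * (?x m - ?t m - ?p m)" for m
    by (simp add: algebra_simps)
  ultimately have s: "(\<lambda>m. a m * (?x m - ?t m - ?p m)) sums (L - X - J / 4)" by (simp only:)
  have b: "norm (a m * (?x m - ?t m - ?p m)) \<le> (real m)\<^sup>2 * (q ^ m / q ^ 3) * \<eta>" for m
  proof (cases "m = 0")
    case False
    have "norm (a m * (?x m - ?t m - ?p m)) = norm (?x m - ?t m - ?p m) / real m"
      unfolding norm_mult a_def norm_divide norm_power norm_of_nat by simp
    also have "\<dots> \<le> (real m ^ 3 * (q ^ m / q ^ 3) * \<eta>) / real m"
      unfolding \<eta>_def using False by (intro divide_right_mono trace_estimate) auto
    also have "\<dots> = (real m)\<^sup>2 * (q ^ m / q ^ 3) * \<eta>" using False by (simp add: power2_eq_square power3_eq_cube)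
    finally show ?thesis .
  qed (simp add: a_def)
  have sm: "summable (\<lambda>m. (real m)\<^sup>2 * (q ^ m / q ^ 3))"
    using summable_divide[OF summable_square_geometric[OF q_pos q1], of "q ^ 3"] by simp
  have sb: "summable (\<lambda>m. (real m)\<^sup>2 * (q ^ m / q ^ 3) * \<eta>)" by (rule summable_mult2[OF sm])
  have "norm (L - X - J / 4) \<le> (\<Sum>m. (real m)\<^sup>2 * (q ^ m / q ^ 3) * \<eta>)"
    unfolding sums_unique[OF s] by (rule norm_suminf_le[OF b sb])
  also have "\<dots> = series_constant q * \<eta>" unfolding series_constant_def by (rule suminf_mult2[OF sm, symmetric])
  finally show ?thesis using fredholm_exp(3)[OF q1 \<kappa>] unfolding L_def X_def J_def \<eta>_def by blast
qed

end

section \<open>Point measures and grids\<close>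

lemma point_measure_sets: "point_measure \<nu> \<Longrightarrow> sets \<nu> = sets borel"
  by (simp add: point_measure_def)

lemma point_measure_ge_1:
  assumes "point_measure \<nu>" "E \<in> sets borel" "emeasure \<nu> E \<noteq> 0" shows "emeasure \<nu> E \<ge> 1"
proof -
  obtain n where n: "emeasure \<nu> E = ennreal_of_enat n" using assms by (auto simp: point_measure_def)
  then have "n \<noteq> 0" using assms by auto
  then have "1 \<le> n" by (metis ileI1 one_eSuc iless_eSuc0 not_le_imp_less)
  then have "ennreal_of_enat 1 \<le> ennreal_of_enat n" by (simp only: ennreal_of_enat_le_iff)
  then show ?thesis using n by simp
qed

lemma point_measure_finite:
  assumes "point_measure \<nu>" "bounded E" shows "emeasure \<nu> E < \<infinity>"
proof -
  obtain R where "E \<subseteq> cball 0 R" using assms(2) bounded_subset_ballD[of E 0] ball_subset_cball by blast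
  moreover have "cball 0 R \<in> sets \<nu>" unfolding point_measure_sets[OF assms(1)] by simp
  ultimately have "emeasure \<nu> E \<le> emeasure \<nu> (cball 0 R)" by (intro emeasure_mono)
  also have "\<dots> < \<infinity>" using assms(1) by (simp add: point_measure_def)
  finally show ?thesis .
qed

text \<open>Every atom has mass at least 1, whereas a bounded set has finite mass.\<close>

lemma finite_points:
  assumes "point_measure \<nu>" "bounded E" shows "finite (points \<nu> \<inter> E)"
proof (rule ccontr)
  assume inf: "infinite (points \<nu> \<inter> E)"
  obtain R where R: "E \<subseteq> cball 0 R" using assms(2) bounded_subset_ballD[of E 0] ball_subset_cball by blast
  have S: "sets \<nu> = sets borel" by (rule point_measure_sets[OF assms(1)])
  have fin: "emeasure \<nu> (cball 0 R) < \<infinity>" using point_measure_finite[OF assms(1), of "cball 0 R"] by simp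
  obtain n :: nat where n: "emeasure \<nu> (cball 0 R) < of_nat n"
  proof -
    obtain r where r: "emeasure \<nu> (cball 0 R) = ennreal r" "r \<ge> 0"
      using fin by (cases "emeasure \<nu> (cball 0 R)") auto
    obtain n where "r < real n" using reals_Archimedean2 by blast
    with r show ?thesis by (intro that[of n]) (simp add: ennreal_of_nat_eq_real_of_nat ennreal_lessI)
  qed
  obtain F where F: "F \<subseteq> points \<nu> \<inter> E" "finite F" "card F = n"
    using infinite_arbitrarily_large[OF inf] by blast
  have "of_nat n = (\<Sum>x\<in>F. (1 :: ennreal))" using F by simp
  also have "\<dots> \<le> (\<Sum>x\<in>F. emeasure \<nu> {x})"
    using F by (intro sum_mono point_measure_ge_1[OF assms(1)]) (auto simp: points_def)
  also have "\<dots> = emeasure \<nu> F"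
    using F by (intro emeasure_eq_sum_singleton[symmetric]) (auto simp: S)
  also have "\<dots> \<le> emeasure \<nu> (cball 0 R)"
    using F R by (intro emeasure_mono) (auto simp: S)
  finally show False using n by (meson not_le)
qed

text \<open>An integer-valued measure without atoms vanishes near every point, hence on compact sets.\<close>

lemma emeasure_no_points:
  assumes "point_measure \<nu>" "E \<in> sets borel" "bounded E" "E \<inter> points \<nu> = {}"
  shows "emeasure \<nu> E = 0"
proof -
  have S: "sets \<nu> = sets borel" by (rule point_measure_sets[OF assms(1)])
  have loc: "\<exists>r>0. emeasure \<nu> (ball x r \<inter> E) = 0" for x
  proof -
    let ?A = "\<lambda>n::nat. ball x (1 / real (Suc n)) \<inter> E"
    have "(\<lambda>n. emeasure \<nu> (?A n)) \<longlonglongrightarrow> emeasure \<nu> (\<Inter>n. ?A n)"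
    proof (rule Lim_emeasure_decseq)
      show "range ?A \<subseteq> sets \<nu>" using assms by (auto simp: S)
      show "decseq ?A" by (auto simp: decseq_def frac_le elim!: order_less_le_trans intro!: frac_le)
      show "emeasure \<nu> (?A n) \<noteq> \<infinity>" for n
        using point_measure_finite[OF assms(1), of "?A n"] assms(3) by (simp add: bounded_Int less_top[symmetric])
    qed
    moreover have "emeasure \<nu> (\<Inter>n. ?A n) = 0"
    proof -
      have "(\<Inter>n. ?A n) \<subseteq> {x} \<inter> E"
      proof
        fix y assume y: "y \<in> (\<Inter>n. ?A n)"
        have d: "dist x y < 1 / real (Suc n)" for n using y by auto
        have "dist x y \<le> 0"
        proof (rule ccontr)
          assume "\<not> dist x y \<le> 0"
          then obtain n where "inverse (real (Suc n)) < dist x y" using reals_Archimedean[of "dist x y"] by auto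
          then show False using d[of n] by (simp add: inverse_eq_divide)
        qed
        then show "y \<in> {x} \<inter> E" using y by auto
      qed
      then have "emeasure \<nu> (\<Inter>n. ?A n) \<le> emeasure \<nu> ({x} \<inter> E)"
        using assms by (intro emeasure_mono) (auto simp: S)
      also have "\<dots> = 0"
        using assms(4) by (cases "x \<in> E") (auto simp: points_def)
      finally show ?thesis by simp
    qed
    ultimately have "(\<lambda>n. emeasure \<nu> (?A n)) \<longlonglongrightarrow> 0" by simp
    then have "eventually (\<lambda>n. emeasure \<nu> (?A n) < 1) sequentially" by (rule order_tendstoD) simp
    then obtain n where n: "emeasure \<nu> (?A n) < 1" by (auto simp: eventually_sequentially)
    have "emeasure \<nu> (?A n) = 0"
      using point_measure_ge_1[OF assms(1), of "?A n"] n assms(2) by (meson borel_open open_ball not_le sets.Int)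
    then show ?thesis by (intro exI[of _ "1 / real (Suc n)"]) simp
  qed
  then obtain r where r: "\<And>x. r x > 0" "\<And>x. emeasure \<nu> (ball x (r x) \<inter> E) = 0" by metis
  have "compact (closure E)" using assms(3) by (simp add: compact_closure)
  then obtain F where F: "F \<subseteq> closure E" "finite F" "closure E \<subseteq> (\<Union>x\<in>F. ball x (r x))"
    by (rule compactE_image[where f = "\<lambda>x. ball x (r x)" and C = "closure E"]) (use r(1) in auto)
  have "emeasure \<nu> E \<le> emeasure \<nu> (\<Union>x\<in>F. ball x (r x) \<inter> E)"
  proof (rule emeasure_mono)
    show "(\<Union>x\<in>F. ball x (r x) \<inter> E) \<in> sets \<nu>"
      unfolding S by (intro sets.finite_UN sets.Int borel_open open_ball F assms)
  qed (use F(3) closure_subset[of E] in auto)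
  also have "\<dots> \<le> (\<Sum>x\<in>F. emeasure \<nu> (ball x (r x) \<inter> E))"
    using F assms by (intro emeasure_subadditive_finite) (auto simp: S)
  also have "\<dots> = 0" using r(2) by simp
  finally show ?thesis by simp
qed

lemma emeasure_eq_sum_points:
  assumes "point_measure \<nu>" "E \<in> sets borel" "bounded E"
  shows "emeasure \<nu> E = (\<Sum>x\<in>points \<nu> \<inter> E. emeasure \<nu> {x})"
proof -
  let ?P = "points \<nu> \<inter> E"
  have S: "sets \<nu> = sets borel" by (rule point_measure_sets[OF assms(1)])
  have f: "finite ?P" by (rule finite_points[OF assms(1,3)])
  then have P: "?P \<in> sets borel" by (rule borel_closed[OF finite_imp_closed])
  have "emeasure \<nu> E = emeasure \<nu> ?P + emeasure \<nu> (E - ?P)"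
    using P assms(2) by (subst plus_emeasure) (auto simp: S intro!: arg_cong[of _ _ "emeasure \<nu>"])
  also have "emeasure \<nu> (E - ?P) = 0"
    using P assms by (intro emeasure_no_points[OF assms(1)]) (auto simp: bounded_diff)
  also have "emeasure \<nu> ?P = (\<Sum>x\<in>?P. emeasure \<nu> {x})"
    using f by (intro emeasure_eq_sum_singleton) (auto simp: S)
  finally show ?thesis by simp
qed

lemma emeasure_eq_0_iff_points:
  assumes "point_measure \<nu>" "E \<in> sets borel" "bounded E"
  shows "emeasure \<nu> E = 0 \<longleftrightarrow> points \<nu> \<inter> E = {}"
  unfolding emeasure_eq_sum_points[OF assms] using finite_points[OF assms(1,3)]
  by (auto simp: sum_nonneg_eq_0_iff points_def)

lemma emeasure_eq_card_points:
  assumes "point_measure \<nu>" "E \<in> sets borel" "bounded E" and simple: "\<And>x. emeasure \<nu> {x} \<le> 1"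
  shows "emeasure \<nu> E = of_nat (card (points \<nu> \<inter> E))"
proof -
  have "emeasure \<nu> {x} = 1" if "x \<in> points \<nu>" for x
    using simple[of x] point_measure_ge_1[OF assms(1), of "{x}"] that by (auto simp: points_def intro: antisym)
  then show ?thesis unfolding emeasure_eq_sum_points[OF assms(1-3)] by simp
qed

lemma linear_statistic_eq_sum:
  assumes "point_measure \<nu>" "bounded B" "\<And>x. x \<notin> B \<Longrightarrow> f x = 0"
  shows "linear_statistic f \<nu> = (\<Sum>x\<in>points \<nu> \<inter> B. f x)"
proof -
  have "linear_statistic f \<nu> = infsum f (points \<nu> \<inter> B)"
    unfolding linear_statistic_def by (rule infsum_cong_neutral) (use assms(3) in auto)
  then show ?thesis using finite_points[OF assms(1,2)] by simp
qed

section \<open>Discretization by square grids\<close>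

definition grid :: "nat \<Rightarrow> complex \<Rightarrow> complex" where
  "grid k z = Complex (\<lfloor>real (Suc k) * Re z\<rfloor> / real (Suc k)) (\<lfloor>real (Suc k) * Im z\<rfloor> / real (Suc k))"

lemma grid_measurable[measurable]: "grid k \<in> borel_measurable borel"
  unfolding grid_def Complex_eq by measurable

lemma floor_grid_dist:
  fixes x :: real and n :: nat
  assumes "n > 0" shows "\<bar>\<lfloor>real n * x\<rfloor> / real n - x\<bar> \<le> 1 / real n"
proof -
  have "real n * (\<lfloor>real n * x\<rfloor> / real n) = \<lfloor>real n * x\<rfloor>" using assms by simp
  then have "\<bar>real n * (\<lfloor>real n * x\<rfloor> / real n - x)\<bar> \<le> 1" unfolding right_diff_distrib by linarith
  then show ?thesis using assms by (simp add: abs_mult field_simps)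
qed

lemma grid_dist: "norm (grid k z - z) \<le> 2 / real (Suc k)"
proof -
  have "norm (grid k z - z) \<le> \<bar>Re (grid k z - z)\<bar> + \<bar>Im (grid k z - z)\<bar>" by (rule cmod_le)
  also have "\<dots> \<le> 1 / real (Suc k) + 1 / real (Suc k)"
    using floor_grid_dist[of "Suc k" "Re z"] floor_grid_dist[of "Suc k" "Im z"]
    by (intro add_mono) (auto simp: grid_def simp del: of_nat_Suc)
  finally show ?thesis by simp
qed

lemma grid_tendsto: "(\<lambda>k. grid k z) \<longlonglongrightarrow> z"
proof (rule LIM_zero_cancel, rule Lim_null_comparison)
  show "eventually (\<lambda>k. norm (grid k z - z) \<le> 2 / real (Suc k)) sequentially" using grid_dist by simp
  show "(\<lambda>k. 2 / real (Suc k)) \<longlonglongrightarrow> 0"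
    using LIMSEQ_Suc[OF lim_const_over_n[of "2::real"]] by simp
qed

lemma finite_grid_image:
  assumes "bounded B" shows "finite (grid k ` B)"
proof -
  obtain R where R: "\<And>z. z \<in> B \<Longrightarrow> norm z \<le> R" using assms by (auto simp: bounded_iff)
  let ?m = "\<lceil>real (Suc k) * R\<rceil> + 1"
  have "grid k ` B \<subseteq> (\<lambda>(i, j). Complex (real_of_int i / real (Suc k)) (real_of_int j / real (Suc k))) ` ({-?m..?m} \<times> {-?m..?m})"
  proof
    fix y assume "y \<in> grid k ` B"
    then obtain z where z: "z \<in> B" "y = grid k z" by auto
    have b: "\<lfloor>real (Suc k) * t\<rfloor> \<in> {-?m..?m}" if "\<bar>t\<bar> \<le> norm z" for t
    proof -
      have "\<bar>real (Suc k) * t\<bar> \<le> real (Suc k) * R"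
        unfolding abs_mult using that R[OF z(1)] by (intro mult_mono) auto
      then show ?thesis by (simp only: atLeastAtMost_iff) linarith
    qed
    show "y \<in> (\<lambda>(i, j). Complex (real_of_int i / real (Suc k)) (real_of_int j / real (Suc k))) ` ({-?m..?m} \<times> {-?m..?m})"
      using b[OF abs_Re_le_cmod] b[OF abs_Im_le_cmod] z(2)
      by (auto simp: grid_def simp del: of_nat_Suc intro!: image_eqI[of _ _ "(\<lfloor>real (Suc k) * Re z\<rfloor>, \<lfloor>real (Suc k) * Im z\<rfloor>)"])
  qed
  then show ?thesis by (rule finite_subset) auto
qed

lemma eventually_grid_inj_on:
  assumes "finite Z" shows "eventually (\<lambda>k. inj_on (grid k) Z) sequentially"
proof -
  have "eventually (\<lambda>k. \<forall>x\<in>Z. \<forall>y\<in>Z. x \<noteq> y \<longrightarrow> grid k x \<noteq> grid k y) sequentially"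
  proof (intro eventually_ball_finite assms ballI)
    fix x y assume "x \<in> Z" "y \<in> Z"
    show "eventually (\<lambda>k. x \<noteq> y \<longrightarrow> grid k x \<noteq> grid k y) sequentially"
    proof (cases "x = y")
      case False
      have "(\<lambda>k. dist (grid k x) (grid k y)) \<longlonglongrightarrow> dist x y" by (intro tendsto_dist grid_tendsto)
      then have "eventually (\<lambda>k. dist (grid k x) (grid k y) > 0) sequentially"
        by (rule order_tendstoD) (use False in simp)
      then show ?thesis by eventually_elim auto
    qed simp
  qed
  then show ?thesis by (rule eventually_mono) (auto simp: inj_on_def)
qed

text \<open>Cells are fibres of the rounding map inside \<open>B\<close>: disjoint for distinct
  labels, and for bounded \<open>B\<close> nonempty for finitely many labels only.\<close>

definition cell :: "complex set \<Rightarrow> nat \<Rightarrow> complex \<Rightarrow> complex set" where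
  "cell B k p = {x \<in> B. grid k x = p}"

lemma cell_measurable: "B \<in> sets borel \<Longrightarrow> cell B k p \<in> sets borel"
proof -
  assume [measurable]: "B \<in> sets borel"
  have "cell B k p = B \<inter> (grid k -` {p} \<inter> space borel)" by (auto simp: cell_def)
  then show ?thesis by (auto intro!: sets.Int measurable_sets[OF grid_measurable])
qed

lemma cell_bounded: "bounded B \<Longrightarrow> bounded (cell B k p)"
  by (rule bounded_subset) (auto simp: cell_def)

lemma cell_Int_inj:
  assumes "inj_on (grid k) Z" "x \<in> Z" "Z \<subseteq> B" shows "Z \<inter> cell B k (grid k x) = {x}"
  using assms by (auto simp: cell_def inj_on_def)

text \<open>Emptiness of cells is used rather than counts, because \<open>linear_statistic\<close>
  sums over points without multiplicity and emptiness can be read off from \<open>emeasure\<close>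
  for every outcome, simple or not.\<close>

lemma grid_sum_tendsto:
  fixes f :: "complex \<Rightarrow> real"
  assumes "finite Z" "Z \<subseteq> B" "bounded B" "continuous_on UNIV f"
  shows "(\<lambda>k. \<Sum>p\<in>grid k ` B. f p * (if Z \<inter> cell B k p = {} then 0 else 1)) \<longlonglongrightarrow> (\<Sum>x\<in>Z. f x)"
proof (rule Lim_transform_eventually)
  show "(\<lambda>k. \<Sum>x\<in>Z. f (grid k x)) \<longlonglongrightarrow> (\<Sum>x\<in>Z. f x)"
    by (intro tendsto_sum continuous_on_tendsto_compose[OF assms(4)] grid_tendsto) auto
  show "eventually (\<lambda>k. (\<Sum>x\<in>Z. f (grid k x)) = (\<Sum>p\<in>grid k ` B. f p * (if Z \<inter> cell B k p = {} then 0 else 1))) sequentially"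
    using eventually_grid_inj_on[OF assms(1)]
  proof eventually_elim
    case (elim k)
    have "(\<Sum>p\<in>grid k ` B. f p * (if Z \<inter> cell B k p = {} then 0 else 1)) = (\<Sum>p\<in>grid k ` Z. f p * (if Z \<inter> cell B k p = {} then 0 else 1))"
    proof (intro sum.mono_neutral_right ballI)
      fix p assume "p \<in> grid k ` B - grid k ` Z"
      then have "Z \<inter> cell B k p = {}" unfolding cell_def by blast
      then show "f p * (if Z \<inter> cell B k p = {} then 0 else 1) = 0" by simp
    qed (use assms finite_grid_image[OF assms(3)] in auto)
    also have "\<dots> = (\<Sum>x\<in>Z. f (grid k x))"
      using elim assms(2) by (subst sum.reindex) (auto simp: cell_Int_inj o_def intro!: sum.cong)
    finally show ?case by simp
  qed
qed

text \<open>Counts enter here because correlation functions give expectations of products of counts.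
  Once the grid separates the finite set \<open>Z\<close>, each count is 0 or 1.\<close>

lemma grid_prod_tendsto:
  fixes g :: "complex \<Rightarrow> real"
  assumes "finite Z" "Z \<subseteq> B" "bounded B" "continuous_on UNIV g"
  shows "(\<lambda>k. \<Prod>p\<in>grid k ` B. 1 + g p * real (card (Z \<inter> cell B k p))) \<longlonglongrightarrow> (\<Prod>x\<in>Z. 1 + g x)"
proof (rule Lim_transform_eventually)
  show "(\<lambda>k. \<Prod>x\<in>Z. 1 + g (grid k x)) \<longlonglongrightarrow> (\<Prod>x\<in>Z. 1 + g x)"
    by (intro tendsto_prod tendsto_add tendsto_const continuous_on_tendsto_compose[OF assms(4)] grid_tendsto) auto
  show "eventually (\<lambda>k. (\<Prod>x\<in>Z. 1 + g (grid k x)) = (\<Prod>p\<in>grid k ` B. 1 + g p * real (card (Z \<inter> cell B k p)))) sequentially"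
    using eventually_grid_inj_on[OF assms(1)]
  proof eventually_elim
    case (elim k)
    have "(\<Prod>p\<in>grid k ` B. 1 + g p * real (card (Z \<inter> cell B k p))) = (\<Prod>p\<in>grid k ` Z. 1 + g p * real (card (Z \<inter> cell B k p)))"
    proof (intro prod.mono_neutral_right ballI)
      fix p assume "p \<in> grid k ` B - grid k ` Z"
      then have "Z \<inter> cell B k p = {}" unfolding cell_def by blast
      then show "1 + g p * real (card (Z \<inter> cell B k p)) = 1" by simp
    qed (use assms finite_grid_image[OF assms(3)] in auto)
    also have "\<dots> = (\<Prod>x\<in>Z. 1 + g (grid k x))"
      using elim assms(2) by (subst prod.reindex) (auto simp: cell_Int_inj o_def intro!: prod.cong)
    finally show ?case by simp
  qed
qed

text \<open>The statistic is a pointwise limit of finite sums over cells, each depending only on the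
  measurable masses of cells.\<close>

lemma linear_statistic_measurable:
  assumes X: "point_process N X" and f: "continuous_on UNIV f" and B: "bounded B" "B \<in> sets borel" "\<And>x. x \<notin> B \<Longrightarrow> f x = 0"
  shows "(\<lambda>s. linear_statistic f (X s)) \<in> borel_measurable N"
proof (rule borel_measurable_LIMSEQ_real)
  fix s assume "s \<in> space N"
  then have pm: "point_measure (X s)" using X by (simp add: point_process_def)
  have "(\<lambda>k. \<Sum>p\<in>grid k ` B. f p * (if points (X s) \<inter> B \<inter> cell B k p = {} then 0 else 1)) \<longlonglongrightarrow> (\<Sum>x\<in>points (X s) \<inter> B. f x)"
    by (intro grid_sum_tendsto finite_points pm B f) auto
  moreover have "points (X s) \<inter> B \<inter> cell B k p = {} \<longleftrightarrow> emeasure (X s) (cell B k p) = 0" for k p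
    using emeasure_eq_0_iff_points[OF pm cell_measurable[OF B(2)] cell_bounded[OF B(1)], of k p] by (auto simp: cell_def)
  moreover have "linear_statistic f (X s) = (\<Sum>x\<in>points (X s) \<inter> B. f x)"
    by (rule linear_statistic_eq_sum[OF pm B(1)]) (rule B(3))
  ultimately show "(\<lambda>k. \<Sum>p\<in>grid k ` B. f p * (if emeasure (X s) (cell B k p) = 0 then 0 else 1)) \<longlonglongrightarrow> linear_statistic f (X s)"
    by simp
next
  fix k
  have [measurable]: "(\<lambda>s. emeasure (X s) (cell B k p)) \<in> borel_measurable N" for p
    using X cell_measurable[OF B(2)] by (simp add: point_process_def)
  show "(\<lambda>s. \<Sum>p\<in>grid k ` B. f p * (if emeasure (X s) (cell B k p) = 0 then 0 else 1)) \<in> borel_measurable N"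
    by measurable
qed

section \<open>Laplace functionals from correlation functions\<close>

definition injections :: "nat \<Rightarrow> 'a set \<Rightarrow> (nat \<Rightarrow> 'a) set" where
  "injections n I = {s \<in> {..<n} \<rightarrow>\<^sub>E I. inj_on s {..<n}}"

lemma finite_injections: "finite I \<Longrightarrow> finite (injections n I)"
  unfolding injections_def by (rule finite_subset[OF _ finite_PiE[of "{..<n}" "\<lambda>_. I"]]) auto

lemma card_injections_onto:
  assumes "finite S" "card S = n" shows "card (injections n S) = fact n"
  unfolding injections_def using assms card_inj_on_subset_funcset[of "{..<n}" S "{..<n}"]
  by (simp add: fact_prod_rev)

text \<open>Each n-element subset is the image of \<open>fact n\<close> injections.\<close>

lemma sum_injections:
  fixes h :: "'a set \<Rightarrow> real"
  assumes I: "finite I"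
  shows "(\<Sum>s\<in>injections n I. h (s ` {..<n})) = fact n * (\<Sum>S\<in>{S \<in> Pow I. card S = n}. h S)"
proof -
  let ?T = "{S \<in> Pow I. card S = n}"
  have "(\<Sum>s\<in>injections n I. h (s ` {..<n})) = (\<Sum>S\<in>?T. \<Sum>s\<in>{s \<in> injections n I. s ` {..<n} = S}. h (s ` {..<n}))"
    using I by (intro sum.group[symmetric] finite_injections) (auto simp: injections_def card_image PiE_iff)
  also have "\<dots> = (\<Sum>S\<in>?T. fact n * h S)"
  proof (intro sum.cong refl)
    fix S assume S: "S \<in> ?T"
    then have fS: "finite S" using I finite_subset by auto
    have "{s \<in> injections n I. s ` {..<n} = S} = injections n S"
    proof (intro Set.set_eqI iffI)
      fix s assume s: "s \<in> injections n S"
      then have "s ` {..<n} = S"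
        using S fS by (intro card_subset_eq) (auto simp: injections_def card_image PiE_iff)
      then show "s \<in> {s \<in> injections n I. s ` {..<n} = S}" using s S by (auto simp: injections_def PiE_iff)
    qed (auto simp: injections_def PiE_iff)
    then show "(\<Sum>s\<in>{s \<in> injections n I. s ` {..<n} = S}. h (s ` {..<n})) = fact n * h S"
    proof -
      assume eq: "{s \<in> injections n I. s ` {..<n} = S} = injections n S"
      have "(\<Sum>s\<in>{s \<in> injections n I. s ` {..<n} = S}. h (s ` {..<n})) = (\<Sum>s\<in>{s \<in> injections n I. s ` {..<n} = S}. h S)"
        by (intro sum.cong) auto
      then show ?thesis using S card_injections_onto[OF fS] unfolding eq by simp
    qed
  qed
  finally show ?thesis by (simp add: sum_distrib_left)
qed

text \<open>For fixed \<open>x\<close> only the labelling s j = grid k (x j) can contribute, and it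
  is among the injections when it is injective and all x j lie in \<open>B\<close>. If some x j lies
  outside \<open>B\<close>, both sides vanish.\<close>

lemma sum_injections_cells:
  fixes g :: "complex \<Rightarrow> real"
  assumes B: "bounded B"
  shows "(\<Sum>s\<in>injections n (grid k ` B). \<Prod>j<n. g (s j) * indicator (cell B k (s j)) (x j)) =
    (if inj_on (\<lambda>j. grid k (x j)) {..<n} then \<Prod>j<n. g (grid k (x j)) * indicator B (x j) else 0)"
proof -
  let ?I = "injections n (grid k ` B)"
  define s0 where "s0 = restrict (\<lambda>j. grid k (x j)) {..<n}"
  have fin: "finite ?I" by (intro finite_injections finite_grid_image B)
  have "(\<Prod>j<n. g (s j) * indicator (cell B k (s j)) (x j)) = (if s = s0 then \<Prod>j<n. g (grid k (x j)) * indicator B (x j) else 0)"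
    if s: "s \<in> ?I" for s
  proof (cases "s = s0")
    case True
    then show ?thesis by (auto simp: s0_def cell_def indicator_def intro!: prod.cong)
  next
    case False
    then obtain j where "j < n" "s j \<noteq> grid k (x j)"
      using s unfolding s0_def injections_def by (auto simp: PiE_iff extensional_def fun_eq_iff split: if_splits)
    then have "(\<Prod>j<n. g (s j) * indicator (cell B k (s j)) (x j)) = 0"
      by (intro prod_zero bexI[of _ j]) (auto simp: cell_def indicator_def)
    then show ?thesis using False by simp
  qed
  then have "(\<Sum>s\<in>?I. \<Prod>j<n. g (s j) * indicator (cell B k (s j)) (x j)) =
    (if s0 \<in> ?I then \<Prod>j<n. g (grid k (x j)) * indicator B (x j) else 0)"
    using fin by (simp add: sum.delta cong: sum.cong)
  also have "\<dots> = (if inj_on (\<lambda>j. grid k (x j)) {..<n} then \<Prod>j<n. g (grid k (x j)) * indicator B (x j) else 0)"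
  proof (cases "\<forall>j<n. x j \<in> B")
    case True
    then have "s0 \<in> ?I \<longleftrightarrow> inj_on (\<lambda>j. grid k (x j)) {..<n}"
      by (auto simp: s0_def injections_def PiE_iff inj_on_def)
    then show ?thesis by simp
  next
    case False
    then obtain j where "j < n" "x j \<notin> B" by auto
    then have "(\<Prod>j<n. g (grid k (x j)) * indicator B (x j)) = 0"
      by (intro prod_zero bexI[of _ j]) (auto simp: indicator_def)
    then show ?thesis by simp
  qed
  finally show ?thesis .
qed

section \<open>Expectations of products over points as series of correlation integrals\<close>

abbreviation PL :: "nat \<Rightarrow> (nat \<Rightarrow> complex) measure" where
  "PL n \<equiv> Pi\<^sub>M {..<n} (\<lambda>_. lborel)"

text \<open>\<open>r_summable\<close> provides an exponential moment for the number of points in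
  \<open>B\<close>, and \<open>r_eq_0\<close> disposes of coinciding points at every configuration
  rather than almost everywhere.\<close>

locale correlated_process =
  fixes N :: "'w measure" and X :: "'w \<Rightarrow> complex measure"
    and r :: "nat \<Rightarrow> (nat \<Rightarrow> complex) \<Rightarrow> real" and B :: "complex set" and q :: real
  assumes simple: "simple_point_process N X"
    and corr: "\<And>n. correlation_function N X n (r n)"
    and r_eq_0: "\<And>n x. \<not> inj_on x {..<n} \<Longrightarrow> r n x = 0"
    and B: "bounded B" "B \<in> sets borel"
    and q: "0 \<le> q"
    and r_integrable: "\<And>n. integrable (PL n) (\<lambda>x. (\<Prod>j<n. indicator B (x j)) * r n x)"
    and r_summable: "summable (\<lambda>n. q ^ n / fact n * (LINT x|PL n. (\<Prod>j<n. indicator B (x j)) * r n x))"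
begin

lemma r_nonneg: "0 \<le> r n x" and r_measurable[measurable]: "r n \<in> borel_measurable (PL n)"
  using corr[of n] by (auto simp: correlation_function_def)

lemma pp: "point_process N X" and AE_simple: "AE s in N. \<forall>x. emeasure (X s) {x} \<le> 1"
  using simple by (auto simp: simple_point_process_def)

sublocale prob_space N using pp by (simp add: point_process_def)

lemma pm: "s \<in> space N \<Longrightarrow> point_measure (X s)"
  using pp by (simp add: point_process_def)

definition cnt :: "'w \<Rightarrow> complex set \<Rightarrow> real" where "cnt s E = enn2real (emeasure (X s) E)"

lemma cnt_measurable: "E \<in> sets borel \<Longrightarrow> (\<lambda>s. cnt s E) \<in> borel_measurable N"
  using pp unfolding point_process_def cnt_def by auto

lemma cnt_nonneg[simp]: "cnt s E \<ge> 0" by (simp add: cnt_def)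

lemma ennreal_cnt: "s \<in> space N \<Longrightarrow> bounded E \<Longrightarrow> ennreal (cnt s E) = emeasure (X s) E"
  unfolding cnt_def using point_measure_finite[OF pm] by (intro ennreal_enn2real) auto

lemma cell_integrable:
  "integrable (PL n) (\<lambda>x. (\<Prod>j<n. indicator (cell B k (s j)) (x j)) * r n x)"
proof (rule Bochner_Integration.integrable_bound[OF r_integrable[of n]])
  note [measurable] = cell_measurable[OF B(2)]
  show "(\<lambda>x. (\<Prod>j<n. indicator (cell B k (s j)) (x j)) * r n x) \<in> borel_measurable (PL n)" by measurable
  show "AE x in PL n. norm ((\<Prod>j<n. indicator (cell B k (s j)) (x j)) * r n x) \<le> norm ((\<Prod>j<n. indicator B (x j)) * r n x)"
  proof (intro AE_I2)
    fix x :: "nat \<Rightarrow> complex"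
    have "(\<Prod>j<n. indicator (cell B k (s j)) (x j)) \<le> (\<Prod>j<n. indicator B (x j) :: real)"
      by (intro prod_mono) (auto simp: indicator_def cell_def)
    then show "norm ((\<Prod>j<n. indicator (cell B k (s j)) (x j)) * r n x) \<le> norm ((\<Prod>j<n. indicator B (x j)) * r n x)"
      using r_nonneg[of n x] by (auto simp: abs_mult abs_prod intro!: mult_right_mono)
  qed
qed

text \<open>Distinct labels give disjoint cells, so the defining identity of the correlation
  function applies; real counts represent the masses faithfully because cells are bounded.\<close>

lemma expectation_cells:
  assumes s: "inj_on s {..<n}"
  shows "has_bochner_integral N (\<lambda>t. \<Prod>j<n. cnt t (cell B k (s j)))
    (LINT x|PL n. (\<Prod>j<n. indicator (cell B k (s j)) (x j)) * r n x)"
proof (rule has_bochner_integral_nn_integral)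
  note [measurable] = cell_measurable[OF B(2)] cnt_measurable
  let ?E = "\<lambda>j. cell B k (s j)"
  show "(\<lambda>t. \<Prod>j<n. cnt t (?E j)) \<in> borel_measurable N" by measurable
  show "AE t in N. 0 \<le> (\<Prod>j<n. cnt t (?E j))" by (auto intro!: prod_nonneg)
  show "0 \<le> (LINT x|PL n. (\<Prod>j<n. indicator (?E j) (x j)) * r n x)"
    by (intro integral_nonneg_AE AE_I2 mult_nonneg_nonneg prod_nonneg r_nonneg) auto
  have "(\<integral>\<^sup>+t. ennreal (\<Prod>j<n. cnt t (?E j)) \<partial>N) = (\<integral>\<^sup>+t. (\<Prod>j<n. emeasure (X t) (?E j)) \<partial>N)"
    by (intro nn_integral_cong) (auto simp: prod_ennreal[symmetric] ennreal_cnt cell_bounded[OF B(1)])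
  also have "\<dots> = (\<integral>\<^sup>+x\<in>(\<Pi>\<^sub>E j\<in>{..<n}. ?E j). ennreal (r n x) \<partial>PL n)"
  proof -
    have "disjoint_family_on ?E {..<n}"
      using s by (auto simp: disjoint_family_on_def cell_def inj_on_def)
    then show ?thesis using corr[of n] cell_measurable[OF B(2)] by (auto simp: correlation_function_def)
  qed
  also have "\<dots> = (\<integral>\<^sup>+x. ennreal ((\<Prod>j<n. indicator (?E j) (x j)) * r n x) \<partial>PL n)"
  proof (intro nn_integral_cong)
    fix x assume "x \<in> space (PL n)"
    then have x: "x \<in> (\<Pi>\<^sub>E j\<in>{..<n}. ?E j) \<longleftrightarrow> (\<forall>j<n. x j \<in> ?E j)"
      by (auto simp: space_PiM PiE_iff)
    show "ennreal (r n x) * indicator (\<Pi>\<^sub>E j\<in>{..<n}. ?E j) x = ennreal ((\<Prod>j<n. indicator (?E j) (x j)) * r n x)"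
    proof (cases "\<forall>j<n. x j \<in> ?E j")
      case True
      then show ?thesis using x by (simp add: indicator_def)
    next
      case False
      then have 0: "(\<Prod>j<n. indicator (?E j) (x j) :: real) = 0" by (intro prod_zero) (auto simp: indicator_def)
      have "x \<notin> (\<Pi>\<^sub>E j\<in>{..<n}. ?E j)" using x False by simp
      then show ?thesis unfolding 0 by simp
    qed
  qed
  also have "\<dots> = ennreal (LINT x|PL n. (\<Prod>j<n. indicator (?E j) (x j)) * r n x)"
    by (intro nn_integral_eq_integral cell_integrable AE_I2 mult_nonneg_nonneg prod_nonneg r_nonneg) auto
  finally show "(\<integral>\<^sup>+t. ennreal (\<Prod>j<n. cnt t (?E j)) \<partial>N) = ennreal (LINT x|PL n. (\<Prod>j<n. indicator (?E j) (x j)) * r n x)" .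
qed

definition grid_functional :: "(complex \<Rightarrow> real) \<Rightarrow> nat \<Rightarrow> 'w \<Rightarrow> real" where
  "grid_functional g k t = (\<Prod>p\<in>grid k ` B. 1 + g p * cnt t (cell B k p))"

definition grid_term :: "(complex \<Rightarrow> real) \<Rightarrow> nat \<Rightarrow> nat \<Rightarrow> real" where
  "grid_term g k n = (LINT x|PL n. (if inj_on (\<lambda>j. grid k (x j)) {..<n} then \<Prod>j<n. g (grid k (x j)) * indicator B (x j) else 0) * r n x) / fact n"

text \<open>Expanding the product over cells gives a sum over sets of cells. Grouped by cardinality,
  each group becomes a single integral through \<open>sum_injections\<close> and
  \<open>sum_injections_cells\<close>. The series over n is finite, since there are finitely many
  cells.\<close>

lemma expectation_grid_functional:
  "has_bochner_integral N (grid_functional g k) (\<Sum>n. grid_term g k n)"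
proof -
  let ?I = "grid k ` B"
  have fI: "finite ?I" by (rule finite_grid_image[OF B(1)])
  let ?h = "\<lambda>S t. \<Prod>p\<in>S. g p * cnt t (cell B k p)"
  define h where "h S = expectation (?h S)" for S
  have S: "has_bochner_integral N (?h (s ` {..<n}))
      (LINT x|PL n. (\<Prod>j<n. g (s j) * indicator (cell B k (s j)) (x j)) * r n x)" if "inj_on s {..<n}" for s n
  proof -
    have "?h (s ` {..<n}) = (\<lambda>t. (\<Prod>j<n. g (s j)) * (\<Prod>j<n. cnt t (cell B k (s j))))"
      using that by (simp add: prod.reindex o_def prod.distrib)
    moreover have "(LINT x|PL n. (\<Prod>j<n. g (s j) * indicator (cell B k (s j)) (x j)) * r n x) =
       (\<Prod>j<n. g (s j)) * (LINT x|PL n. (\<Prod>j<n. indicator (cell B k (s j)) (x j)) * r n x)"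
      by (simp add: prod.distrib mult.assoc)
    ultimately show ?thesis using has_bochner_integral_mult_right[OF expectation_cells[OF that]] by simp
  qed
  have hint: "has_bochner_integral N (?h T) (h T)" if T: "T \<in> Pow ?I" for T
  proof -
    have "finite T" using T fI finite_subset by auto
    then obtain s where "bij_betw s {..<card T} T" using ex_bij_betw_nat_finite[of T] by (auto simp: atLeast0LessThan)
    then have "inj_on s {..<card T}" "s ` {..<card T} = T" by (auto simp: bij_betw_def)
    then have "integrable N (?h T)"
      using S[of s "card T"] by (auto intro: integrable.intros)
    then show ?thesis unfolding h_def by (rule has_bochner_integral_integrable)
  qed
  have term_eq: "grid_term g k n = (\<Sum>T\<in>{T \<in> Pow ?I. card T = n}. h T)" for n
  proof -
    have "(\<Sum>s\<in>injections n ?I. h (s ` {..<n})) =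
      (\<Sum>s\<in>injections n ?I. LINT x|PL n. (\<Prod>j<n. g (s j) * indicator (cell B k (s j)) (x j)) * r n x)"
      unfolding h_def by (intro sum.cong refl has_bochner_integral_integral_eq S) (auto simp: injections_def)
    also have "\<dots> = (LINT x|PL n. (\<Sum>s\<in>injections n ?I. (\<Prod>j<n. g (s j) * indicator (cell B k (s j)) (x j)) * r n x))"
    proof (rule Bochner_Integration.integral_sum[symmetric])
      show "integrable (PL n) (\<lambda>x. (\<Prod>j<n. g (s j) * indicator (cell B k (s j)) (x j)) * r n x)" for s
        using integrable_mult_right[OF cell_integrable[of n k s], of "\<Prod>j<n. g (s j)"] by (simp add: prod.distrib mult.assoc)
    qed
    also have "\<dots> = fact n * grid_term g k n"
      unfolding grid_term_def sum_distrib_right[symmetric] sum_injections_cells[OF B(1)] by simp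
    finally show ?thesis using sum_injections[OF fI, of h n] by simp
  qed
  have "grid_functional g k = (\<lambda>t. \<Sum>T\<in>Pow ?I. ?h T t)"
  proof
    fix t
    show "grid_functional g k t = (\<Sum>T\<in>Pow ?I. ?h T t)"
      unfolding grid_functional_def
      using prod_add[OF fI, of "\<lambda>p. g p * cnt t (cell B k p)" "\<lambda>p. 1"] by (simp add: add.commute)
  qed
  moreover have "has_bochner_integral N (\<lambda>t. \<Sum>T\<in>Pow ?I. ?h T t) (\<Sum>T\<in>Pow ?I. h T)"
    by (intro has_bochner_integral_sum hint)
  moreover have "(\<Sum>T\<in>Pow ?I. h T) = (\<Sum>n. grid_term g k n)"
  proof -
    have "(\<Sum>T\<in>Pow ?I. h T) = (\<Sum>n\<in>{..card ?I}. \<Sum>T\<in>{T \<in> Pow ?I. card T = n}. h T)"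
      using fI by (intro sum.group[symmetric]) (auto intro: card_mono)
    also have "\<dots> = (\<Sum>n\<in>{..card ?I}. grid_term g k n)" by (simp add: term_eq)
    also have "\<dots> = (\<Sum>n. grid_term g k n)"
    proof (rule suminf_finite[symmetric])
      fix n assume "n \<notin> {..card ?I}"
      then have "{T \<in> Pow ?I. card T = n} = {}" using card_mono[OF fI] by fastforce
      then show "grid_term g k n = 0" unfolding term_eq by (simp only: sum.empty)
    qed simp
    finally show ?thesis .
  qed
  ultimately show ?thesis by simp
qed

definition limit_term :: "(complex \<Rightarrow> real) \<Rightarrow> nat \<Rightarrow> real" where
  "limit_term g n = (LINT x|PL n. (\<Prod>j<n. g (x j) * indicator B (x j)) * r n x) / fact n"

lemma grid_term_integrand_le:
  assumes "\<And>x. \<bar>g x\<bar> \<le> q"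
  shows "\<bar>(if inj_on (\<lambda>j. grid k (x j)) {..<n} then \<Prod>j<n. g (grid k (x j)) * indicator B (x j) else 0) * r n x\<bar>
    \<le> q ^ n * ((\<Prod>j<n. indicator B (x j)) * r n x)"
proof -
  have "\<bar>\<Prod>j<n. g (grid k (x j)) * indicator B (x j)\<bar> \<le> (\<Prod>j<n. q * indicator B (x j))"
    unfolding abs_prod using assms q by (intro prod_mono) (auto simp: abs_mult indicator_def)
  also have "\<dots> = q ^ n * (\<Prod>j<n. indicator B (x j))" by (simp add: prod.distrib)
  finally have "\<bar>\<Prod>j<n. g (grid k (x j)) * indicator B (x j)\<bar> \<le> q ^ n * (\<Prod>j<n. indicator B (x j))" .
  moreover have "0 \<le> q ^ n * (\<Prod>j<n. indicator B (x j) :: real)" using q by (auto intro!: mult_nonneg_nonneg prod_nonneg)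
  ultimately show ?thesis using r_nonneg[of n x]
    unfolding abs_mult mult.assoc[symmetric] by (intro mult_mono) auto
qed

lemma grid_term_integrable:
  "integrable (PL n) (\<lambda>x. (if inj_on (\<lambda>j. grid k (x j)) {..<n} then \<Prod>j<n. g (grid k (x j)) * indicator B (x j) else 0) * r n x)"
proof -
  have "integrable (PL n) (\<lambda>x. (\<Prod>j<n. g (s j) * indicator (cell B k (s j)) (x j)) * r n x)" for s
    using integrable_mult_right[OF cell_integrable[of n k s], of "\<Prod>j<n. g (s j)"] by (simp add: prod.distrib mult.assoc)
  then have "integrable (PL n) (\<lambda>x. \<Sum>s\<in>injections n (grid k ` B). (\<Prod>j<n. g (s j) * indicator (cell B k (s j)) (x j)) * r n x)"
    by (intro Bochner_Integration.integrable_sum)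
  then show ?thesis unfolding sum_distrib_right[symmetric] sum_injections_cells[OF B(1)] .
qed

lemma abs_grid_term_le:
  assumes "\<And>x. \<bar>g x\<bar> \<le> q"
  shows "\<bar>grid_term g k n\<bar> \<le> q ^ n / fact n * (LINT x|PL n. (\<Prod>j<n. indicator B (x j)) * r n x)"
proof -
  let ?f = "\<lambda>x. (if inj_on (\<lambda>j. grid k (x j)) {..<n} then \<Prod>j<n. g (grid k (x j)) * indicator B (x j) else 0) * r n x"
  have "norm (LINT x|PL n. ?f x) \<le> (LINT x|PL n. norm (?f x))" by (rule integral_norm_bound)
  also have "\<dots> \<le> (LINT x|PL n. q ^ n * ((\<Prod>j<n. indicator B (x j)) * r n x))"
    unfolding real_norm_def
    by (intro integral_mono integrable_abs grid_term_integrable integrable_mult_right r_integrable grid_term_integrand_le assms)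
  finally have "\<bar>LINT x|PL n. ?f x\<bar> \<le> q ^ n * (LINT x|PL n. (\<Prod>j<n. indicator B (x j)) * r n x)" by simp
  then show ?thesis unfolding grid_term_def abs_divide by (simp add: divide_right_mono)
qed

text \<open>At an injective configuration the grid eventually separates the points; at any other the
  correlation function is 0. So the integrands converge everywhere, under a majorant independent of
  the mesh.\<close>

lemma grid_term_tendsto:
  assumes g: "\<And>x. \<bar>g x\<bar> \<le> q" "continuous_on UNIV g"
  shows "(\<lambda>k. grid_term g k n) \<longlonglongrightarrow> limit_term g n"
proof -
  have [measurable]: "g \<in> borel_measurable borel" using g(2) by (rule borel_measurable_continuous_onI)
  have "(\<lambda>k. LINT x|PL n. (if inj_on (\<lambda>j. grid k (x j)) {..<n} then \<Prod>j<n. g (grid k (x j)) * indicator B (x j) else 0) * r n x)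
     \<longlonglongrightarrow> (LINT x|PL n. (\<Prod>j<n. g (x j) * indicator B (x j)) * r n x)"
  proof (rule integral_dominated_convergence)
    show "(\<lambda>x. (\<Prod>j<n. g (x j) * indicator B (x j)) * r n x) \<in> borel_measurable (PL n)"
      using B(2) by measurable
    show "integrable (PL n) (\<lambda>x. q ^ n * ((\<Prod>j<n. indicator B (x j)) * r n x))"
      by (intro integrable_mult_right r_integrable)
    show "(\<lambda>x. (if inj_on (\<lambda>j. grid k (x j)) {..<n} then \<Prod>j<n. g (grid k (x j)) * indicator B (x j) else 0) * r n x)
       \<in> borel_measurable (PL n)" for k
      by (rule borel_measurable_integrable[OF grid_term_integrable])
    show "AE x in PL n. norm ((if inj_on (\<lambda>j. grid k (x j)) {..<n} then \<Prod>j<n. g (grid k (x j)) * indicator B (x j) else 0) * r n x)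
        \<le> q ^ n * ((\<Prod>j<n. indicator B (x j)) * r n x)" for k
      unfolding real_norm_def by (intro AE_I2 grid_term_integrand_le g)
    show "AE x in PL n. (\<lambda>k. (if inj_on (\<lambda>j. grid k (x j)) {..<n} then \<Prod>j<n. g (grid k (x j)) * indicator B (x j) else 0) * r n x)
        \<longlonglongrightarrow> (\<Prod>j<n. g (x j) * indicator B (x j)) * r n x"
    proof (intro AE_I2)
      fix x :: "nat \<Rightarrow> complex"
      show "(\<lambda>k. (if inj_on (\<lambda>j. grid k (x j)) {..<n} then \<Prod>j<n. g (grid k (x j)) * indicator B (x j) else 0) * r n x)
        \<longlonglongrightarrow> (\<Prod>j<n. g (x j) * indicator B (x j)) * r n x"
      proof (cases "inj_on x {..<n}")
        case True
        have "eventually (\<lambda>k. inj_on (\<lambda>j. grid k (x j)) {..<n}) sequentially"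
        proof -
          have "eventually (\<lambda>k. inj_on (grid k) (x ` {..<n})) sequentially" by (rule eventually_grid_inj_on) simp
          then show ?thesis by eventually_elim (use comp_inj_on[OF True] in \<open>simp add: o_def\<close>)
        qed
        then have "eventually (\<lambda>k. (\<Prod>j<n. g (grid k (x j)) * indicator B (x j)) * r n x =
          (if inj_on (\<lambda>j. grid k (x j)) {..<n} then \<Prod>j<n. g (grid k (x j)) * indicator B (x j) else 0) * r n x) sequentially"
          by eventually_elim simp
        moreover have "(\<lambda>k. (\<Prod>j<n. g (grid k (x j)) * indicator B (x j)) * r n x) \<longlonglongrightarrow> (\<Prod>j<n. g (x j) * indicator B (x j)) * r n x"
          by (intro tendsto_mult tendsto_prod tendsto_const continuous_on_tendsto_compose[OF g(2)] grid_tendsto) auto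
        ultimately show ?thesis by (rule Lim_transform_eventually[rotated])
      qed (simp add: r_eq_0)
    qed
  qed
  then show ?thesis unfolding grid_term_def limit_term_def by (intro tendsto_divide tendsto_const) auto
qed

lemma suminf_grid_term_tendsto:
  assumes g: "\<And>x. \<bar>g x\<bar> \<le> q" "continuous_on UNIV g"
  shows "(\<lambda>k. \<Sum>n. grid_term g k n) \<longlonglongrightarrow> (\<Sum>n. limit_term g n)"
proof -
  have "eventually (\<lambda>(n, k). norm (grid_term g k n) \<le> q ^ n / fact n * (LINT x|PL n. (\<Prod>j<n. indicator B (x j)) * r n x))
      (at_top \<times>\<^sub>F sequentially)"
    unfolding real_norm_def by (intro always_eventually) (auto intro: abs_grid_term_le g(1) simp del: times_divide_eq_left)
  from tannerys_theorem[where a = "\<lambda>n k. grid_term g k n" and b = "limit_term g", OF grid_term_tendsto[OF g] this r_summable]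
  show ?thesis by simp
qed

text \<open>For simple outcomes this is (1 + q) to the number of points in \<open>B\<close>. The
  exponential of the real count is defined and measurable for all outcomes.\<close>

definition dominator :: "'w \<Rightarrow> real" where "dominator t = exp (ln (1 + q) * cnt t B)"

lemma grid_functional_simple:
  assumes t: "t \<in> space N" "\<forall>x. emeasure (X t) {x} \<le> 1"
  shows "grid_functional g k t = (\<Prod>p\<in>grid k ` B. 1 + g p * real (card (points (X t) \<inter> B \<inter> cell B k p)))"
    and "dominator t = (1 + q) ^ card (points (X t) \<inter> B)"
proof -
  have c: "cnt t E = card (points (X t) \<inter> E)" if "E \<in> sets borel" "bounded E" for E
    using emeasure_eq_card_points[OF pm[OF t(1)] that] t(2) by (simp add: cnt_def ennreal_of_nat_eq_real_of_nat)
  have "points (X t) \<inter> B \<inter> cell B k p = points (X t) \<inter> cell B k p" for p by (auto simp: cell_def)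
  then show "grid_functional g k t = (\<Prod>p\<in>grid k ` B. 1 + g p * real (card (points (X t) \<inter> B \<inter> cell B k p)))"
    unfolding grid_functional_def using c[OF cell_measurable[OF B(2)] cell_bounded[OF B(1)]] by simp
  have "exp (ln (1 + q) * real n) = (1 + q) ^ n" for n
    using q by (simp add: exp_of_nat2_mult exp_ln)
  then show "dominator t = (1 + q) ^ card (points (X t) \<inter> B)"
    unfolding dominator_def using c[OF B(2,1)] by simp
qed

lemma grid_functional_le_dominator:
  assumes t: "t \<in> space N" "\<forall>x. emeasure (X t) {x} \<le> 1" and g: "\<And>x. \<bar>g x\<bar> \<le> q"
  shows "\<bar>grid_functional g k t\<bar> \<le> dominator t"
proof -
  let ?Z = "points (X t) \<inter> B"
  have fZ: "finite ?Z" by (rule finite_points[OF pm[OF t(1)] B(1)])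
  have fI: "finite (grid k ` B)" by (rule finite_grid_image[OF B(1)])
  have "\<bar>grid_functional g k t\<bar> \<le> (\<Prod>p\<in>grid k ` B. (1 + q) ^ card (?Z \<inter> cell B k p))"
    unfolding grid_functional_simple(1)[OF t] abs_prod
  proof (intro prod_mono conjI)
    fix p
    let ?n = "card (?Z \<inter> cell B k p)"
    have "\<bar>1 + g p * real ?n\<bar> \<le> 1 + \<bar>g p\<bar> * real ?n"
      using abs_triangle_ineq[of 1 "g p * real ?n"] by (simp add: abs_mult)
    also have "\<dots> \<le> 1 + real ?n * q" using mult_right_mono[OF g[of p], of "real ?n"] by (simp add: mult.commute)
    \<comment> \<open>Bernoulli's inequality turns the linear factor of a cell into a power, so that
      exponents add up over the cells.\<close>
    also have "\<dots> \<le> (1 + q) ^ ?n" by (rule Bernoulli_inequality) (use q in simp)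
    finally show "\<bar>1 + g p * real ?n\<bar> \<le> (1 + q) ^ ?n" .
  qed auto
  also have "\<dots> = (1 + q) ^ (\<Sum>p\<in>grid k ` B. card (?Z \<inter> cell B k p))" by (rule power_sum[symmetric])
  also have "(\<Sum>p\<in>grid k ` B. card (?Z \<inter> cell B k p)) = card ?Z"
  proof -
    have "(\<Sum>p\<in>grid k ` B. \<Sum>x\<in>{x \<in> ?Z. grid k x = p}. 1) = (\<Sum>x\<in>?Z. 1 :: nat)"
      using fZ fI by (intro sum.group) auto
    moreover have "?Z \<inter> cell B k p = {x \<in> ?Z. grid k x = p}" for p by (auto simp: cell_def)
    ultimately show ?thesis by simp
  qed
  finally show ?thesis using grid_functional_simple(2)[OF t] by simp
qed

lemma dominator_measurable[measurable]: "dominator \<in> borel_measurable N"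
  unfolding dominator_def[abs_def] using cnt_measurable[OF B(2)] by measurable

lemma grid_functional_AE_tendsto:
  assumes "continuous_on UNIV g"
  shows "AE t in N. (\<lambda>k. grid_functional g k t) \<longlonglongrightarrow> (\<Prod>x\<in>points (X t) \<inter> B. 1 + g x)"
  using AE_simple AE_space
proof eventually_elim
  case (elim t)
  show ?case unfolding grid_functional_simple(1)[OF elim(2,1)]
    by (intro grid_prod_tendsto assms B finite_points pm elim) auto
qed

text \<open>The dominator is the almost sure limit of the grid functionals of the constant
  \<open>q\<close>, whose expectations are known and converge. Fatou's lemma bounds its integral at
  a stage where dominated convergence is not yet available.\<close>

lemma dominator_integrable: "integrable N dominator"
proof (rule integrableI_bounded)
  have m: "grid_functional (\<lambda>_. q) k \<in> borel_measurable N" for k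
    using expectation_grid_functional by (auto dest: borel_measurable_has_bochner_integral)
  have lim: "AE t in N. (\<lambda>k. grid_functional (\<lambda>_. q) k t) \<longlonglongrightarrow> dominator t"
    using grid_functional_AE_tendsto[of "\<lambda>_. q", OF continuous_on_const] AE_simple AE_space
    by eventually_elim (simp add: grid_functional_simple(2))
  have "(\<integral>\<^sup>+t. ennreal (norm (dominator t)) \<partial>N) \<le> (\<integral>\<^sup>+t. liminf (\<lambda>k. ennreal (grid_functional (\<lambda>_. q) k t)) \<partial>N)"
  proof (rule nn_integral_mono_AE)
    show "AE t in N. ennreal (norm (dominator t)) \<le> liminf (\<lambda>k. ennreal (grid_functional (\<lambda>_. q) k t))"
      using lim
    proof eventually_elim
      case (elim t)
      then have "(\<lambda>k. ennreal (grid_functional (\<lambda>_. q) k t)) \<longlonglongrightarrow> ennreal (dominator t)" by (rule tendsto_ennrealI)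
      then have "liminf (\<lambda>k. ennreal (grid_functional (\<lambda>_. q) k t)) = ennreal (dominator t)"
        by (rule lim_imp_Liminf[rotated]) simp
      then show ?case by (simp add: dominator_def)
    qed
  qed
  also have "\<dots> \<le> liminf (\<lambda>k. \<integral>\<^sup>+t. ennreal (grid_functional (\<lambda>_. q) k t) \<partial>N)"
    by (rule nn_integral_liminf) (use m in measurable)
  also have "\<dots> = liminf (\<lambda>k. ennreal (\<Sum>n. grid_term (\<lambda>_. q) k n))"
  proof -
    have "(\<integral>\<^sup>+t. ennreal (grid_functional (\<lambda>_. q) k t) \<partial>N) = ennreal (\<Sum>n. grid_term (\<lambda>_. q) k n)" for k
    proof -
      have "integrable N (grid_functional (\<lambda>_. q) k)" "expectation (grid_functional (\<lambda>_. q) k) = (\<Sum>n. grid_term (\<lambda>_. q) k n)"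
        using expectation_grid_functional[of "\<lambda>_. q" k] by (auto simp: has_bochner_integral_iff)
      moreover have "grid_functional (\<lambda>_. q) k t \<ge> 0" for t
        unfolding grid_functional_def using q by (intro prod_nonneg ballI add_nonneg_nonneg mult_nonneg_nonneg) auto
      ultimately show ?thesis by (simp add: nn_integral_eq_integral)
    qed
    then show ?thesis by simp
  qed
  also have "\<dots> = ennreal (\<Sum>n. limit_term (\<lambda>_. q) n)"
    by (rule lim_imp_Liminf) (auto intro!: tendsto_ennrealI suminf_grid_term_tendsto q)
  finally show "(\<integral>\<^sup>+t. ennreal (norm (dominator t)) \<partial>N) < \<infinity>" by (auto simp: order_le_less_trans)
qed measurable

text \<open>The grid functionals converge almost surely under \<open>dominator\<close>, and their
  expectations converge to the series. The product is represented by a measurable \<open>Y\<close>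
  that equals it almost surely.\<close>

theorem expectation_prod_points:
  assumes g: "\<And>x. \<bar>g x\<bar> \<le> q" "continuous_on UNIV g"
    and Y[measurable]: "Y \<in> borel_measurable N" and Y_eq: "AE t in N. Y t = (\<Prod>x\<in>points (X t) \<inter> B. 1 + g x)"
  shows "integrable N Y" "expectation Y = (\<Sum>n. limit_term g n)"
proof -
  have m: "grid_functional g k \<in> borel_measurable N" for k
    using expectation_grid_functional by (auto dest: borel_measurable_has_bochner_integral)
  have lim: "AE t in N. (\<lambda>k. grid_functional g k t) \<longlonglongrightarrow> Y t"
    using grid_functional_AE_tendsto[OF g(2)] Y_eq by eventually_elim simp
  have dom: "AE t in N. norm (grid_functional g k t) \<le> dominator t" for k
    using AE_simple AE_space by eventually_elim (simp add: grid_functional_le_dominator g)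
  show "integrable N Y"
    by (rule integrable_dominated_convergence[OF Y m dominator_integrable lim dom])
  have "(\<lambda>k. expectation (grid_functional g k)) \<longlonglongrightarrow> expectation Y"
    by (rule integral_dominated_convergence[OF Y m dominator_integrable lim dom])
  moreover have "expectation (grid_functional g k) = (\<Sum>n. grid_term g k n)" for k
    using expectation_grid_functional[of g k] by (simp add: has_bochner_integral_iff)
  ultimately show "expectation Y = (\<Sum>n. limit_term g n)"
    using suminf_grid_term_tendsto[OF g] LIMSEQ_unique by simp
qed

end

section \<open>Kernels with stationary modulus\<close>

lemma nn_integral_lborel_affine:
  fixes f :: "complex \<Rightarrow> ennreal" and c :: real
  assumes f[measurable]: "f \<in> borel_measurable borel" and c: "c \<noteq> 0"
  shows "(\<integral>\<^sup>+x. f x \<partial>lborel) = ennreal (c\<^sup>2) * (\<integral>\<^sup>+x. f (t + c *\<^sub>R x) \<partial>lborel)"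
proof -
  have "(\<integral>\<^sup>+x. f x \<partial>lborel) = (\<integral>\<^sup>+x. f x \<partial>density (distr lborel borel (\<lambda>x. t + c *\<^sub>R x)) (\<lambda>_. \<bar>c\<bar> ^ DIM(complex)))"
    using lborel_affine[OF c, of t] by (simp only:)
  also have "\<dots> = (\<integral>\<^sup>+x. ennreal (c\<^sup>2) * f x \<partial>distr lborel borel (\<lambda>x. t + c *\<^sub>R x))"
    by (subst nn_integral_density) auto
  also have "\<dots> = ennreal (c\<^sup>2) * (\<integral>\<^sup>+x. f (t + c *\<^sub>R x) \<partial>lborel)"
    by (simp add: nn_integral_cmult nn_integral_distr)
  finally show ?thesis .
qed

lemma integral_lborel_affine:
  fixes f :: "complex \<Rightarrow> complex" and c :: real
  assumes f[measurable]: "f \<in> borel_measurable borel" and c: "c \<noteq> 0"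
  shows "(LINT x|lborel. f x) = of_real (c\<^sup>2) * (LINT x|lborel. f (t + c *\<^sub>R x))"
proof -
  have "(LINT x|lborel. f x) = (LINT x|density (distr lborel borel (\<lambda>x. t + c *\<^sub>R x)) (\<lambda>_. \<bar>c\<bar> ^ DIM(complex)). f x)"
    using lborel_affine[OF c, of t] by (simp only:)
  also have "\<dots> = (LINT x|distr lborel borel (\<lambda>x. t + c *\<^sub>R x). (\<bar>c\<bar> ^ DIM(complex)) *\<^sub>R f x)"
    by (rule integral_density) auto
  also have "\<dots> = (LINT x|lborel. (\<bar>c\<bar> ^ DIM(complex)) *\<^sub>R f (t + c *\<^sub>R x))"
    by (subst integral_distr) auto
  finally show ?thesis by (simp add: scaleR_conv_of_real)
qed

lemma nn_integral_lborel_reflect: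
  fixes f :: "complex \<Rightarrow> ennreal"
  assumes [measurable]: "f \<in> borel_measurable borel"
  shows "(\<integral>\<^sup>+w. f (z - w) \<partial>lborel) = (\<integral>\<^sup>+w. f w \<partial>lborel)" "(\<integral>\<^sup>+z. f (z - w) \<partial>lborel) = (\<integral>\<^sup>+w. f w \<partial>lborel)"
  using nn_integral_lborel_affine[OF assms, of "-1" z] nn_integral_lborel_affine[OF assms, of 1 "- w"] by simp_all

section \<open>Measurability of the kernel and its dilations\<close>

interpretation plane: kernel_space "lborel :: complex measure"
  by standard simp

text \<open>A countable range allows a measurable function to be assembled from its restrictions to
  the cells, one label at a time.\<close>

lemma countable_range_grid: "countable (range (grid k))"
proof -
  have "range (grid k) \<subseteq> (\<lambda>(i :: int, j :: int). Complex (i / real (Suc k)) (j / real (Suc k))) ` UNIV"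
    by (auto simp: grid_def simp del: of_nat_Suc intro!: image_eqI[of _ _ "(\<lfloor>real (Suc k) * Re _\<rfloor>, \<lfloor>real (Suc k) * Im _\<rfloor>)"])
  then show ?thesis by (rule countable_subset) (auto intro: countable_image)
qed

lemma grid_count_space: "grid k \<in> borel \<rightarrow>\<^sub>M count_space (range (grid k))"
  by (subst measurable_count_space_eq_countable[OF countable_range_grid])
     (use measurable_sets[OF grid_measurable, of "{_}"] in auto)

locale stationary_kernel =
  fixes K :: "complex \<Rightarrow> complex \<Rightarrow> complex" and \<phi> :: "complex \<Rightarrow> real"
  assumes kernel: "hermitian_reproducing_kernel K"
    and \<phi>_nonneg: "0 \<le> \<phi> z" and \<phi>_continuous: "continuous_on UNIV \<phi>" and \<phi>_bounded: "bounded (range \<phi>)"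
    and modulus: "norm (K z w) = \<phi> (z - w)"
    and moment: "integrable lborel (\<lambda>z. (1 + norm z ^ 3) * \<phi> z)"
begin

lemma \<phi>_measurable[measurable]: "\<phi> \<in> borel_measurable borel"
  using \<phi>_continuous by (rule borel_measurable_continuous_onI)

lemma \<phi>_integrable: "integrable lborel \<phi>"
  by (rule Bochner_Integration.integrable_bound[OF moment])
     (use \<phi>_nonneg in \<open>auto simp: algebra_simps\<close>)

text \<open>The sections of the kernel lie in the reproducing space, hence are Borel, and the
  reproducing property applied to them gives the integral formula. Conjugating that formula gives
  the symmetry.\<close>

lemma hermitian: "K w z = cnj (K z w)"
  and reproducing: "K z w = (LINT u|lborel. K z u * K u w)"
  and col_measurable: "(\<lambda>z. K z w) \<in> borel_measurable borel"
proof -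
  obtain H where H: "closed_function_subspace H" "reproducing_kernel_of H K"
    using kernel by (auto simp: hermitian_reproducing_kernel_def)
  have KH: "(\<lambda>z. K z w) \<in> H" for w using H by (auto simp: reproducing_kernel_of_def)
  have rep: "K z w = (LINT u|lborel. K u w * cnj (K u z))" for z w
    using H(2) KH[of w] by (auto simp: reproducing_kernel_of_def)
  have herm: "K w z = cnj (K z w)" for z w
    unfolding rep[of z w] rep[of w z] by (simp flip: Bochner_Integration.integral_cnj add: mult.commute)
  show "K w z = cnj (K z w)" by (rule herm)
  show "K z w = (LINT u|lborel. K z u * K u w)"
  proof -
    have "K z w = (LINT u|lborel. K u w * cnj (K u z))" by (rule rep)
    also have "\<dots> = (LINT u|lborel. K z u * K u w)"
      by (intro Bochner_Integration.integral_cong refl) (simp only: herm[of z, symmetric] mult.commute)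
    finally show ?thesis .
  qed
  show "(\<lambda>z. K z w) \<in> borel_measurable borel"
    using H(1) KH[of w] by (auto simp: closed_function_subspace_def L2_functions_def)
qed

lemma row_measurable: "K z \<in> borel_measurable borel"
proof -
  have "K z = (\<lambda>w. cnj (K w z))" by (intro ext) (rule hermitian)
  then show ?thesis using borel_measurable_cnj[OF col_measurable[of z]] by simp
qed

text \<open>A diagonal value is the squared norm of a section, hence nonnegative and equal to its
  modulus.\<close>

lemma diag: "K z z = of_real (\<phi> 0)"
proof -
  have "K z u * K u z = of_real ((norm (K z u))\<^sup>2)" for u
    by (simp only: hermitian[of u z] complex_norm_square)
  then have "K z z = of_real (LINT u|lborel. (norm (K z u))\<^sup>2)"
    using reproducing[of z z] by (simp only: integral_complex_of_real)
  moreover have "(LINT u|lborel. (norm (K z u))\<^sup>2) \<ge> 0" by simp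
  ultimately show ?thesis using modulus[of z z] by (metis abs_of_nonneg diff_self norm_of_real)
qed

lemma integrable_row: "integrable lborel (\<lambda>u. \<phi> (z - u))"
proof (rule integrableI_bounded)
  have "(\<integral>\<^sup>+u. ennreal (norm (\<phi> (z - u))) \<partial>lborel) = (\<integral>\<^sup>+u. ennreal (norm (\<phi> u)) \<partial>lborel)"
    by (rule nn_integral_lborel_reflect(1)[of "\<lambda>u. ennreal (norm (\<phi> u))"]) measurable
  then show "(\<integral>\<^sup>+u. ennreal (norm (\<phi> (z - u))) \<partial>lborel) < \<infinity>" using \<phi>_integrable by (simp add: integrable_iff_bounded)
qed measurable

lemma integrable_prod: "integrable lborel (\<lambda>v. K z v * K v w)"
proof -
  obtain b where b: "\<And>z. \<bar>\<phi> z\<bar> \<le> b" using \<phi>_bounded by (auto simp: bounded_iff)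
  note [measurable] = row_measurable col_measurable
  show ?thesis
  proof (rule Bochner_Integration.integrable_bound[OF integrable_mult_right[OF integrable_row[of z], of b]])
    have "norm (K z v * K v w) \<le> norm (b * \<phi> (z - v))" for v
    proof -
      have "\<phi> (z - v) * \<phi> (v - w) \<le> \<phi> (z - v) * b"
        using abs_le_D1[OF b] \<phi>_nonneg by (intro mult_left_mono)
      then show ?thesis using abs_ge_self[of "b * \<phi> (z - v)"] by (simp add: norm_mult modulus mult.commute)
    qed
    then show "AE v in lborel. norm (K z v * K v w) \<le> norm (b * \<phi> (z - v))" by simp
  qed measurable
qed

text \<open>Since \<open>\<bar>K z u\<bar>\<close> is close to \<open>\<phi> 0\<close> for \<open>u\<close> close to \<open>z\<close>, the section at \<open>z\<close> is nearly a multiple of the section at \<open>u\<close>.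
  This makes the kernel jointly measurable although only its modulus is continuous.\<close>

lemma rank_one_approx:
  assumes "\<phi> 0 > 0"
  shows "(norm (K z w - K z u * K u w / of_real (\<phi> 0)))\<^sup>2 \<le> (\<phi> 0)\<^sup>2 - (\<phi> (z - u))\<^sup>2"
proof -
  define c where "c = K z u / of_real (\<phi> 0)"
  \<comment> \<open>The part of the row at \<open>z\<close> that is orthogonal to the row at
    \<open>u\<close>.\<close>
  define d where "d v = K z v - c * K u v" for v
  note [measurable] = row_measurable col_measurable
  have d_meas[measurable]: "d \<in> borel_measurable borel" unfolding d_def[abs_def] by measurable
  have id: "integrable lborel (\<lambda>v. d v * K v w)" for w
  proof -
    have "integrable lborel (\<lambda>v. K z v * K v w - c * (K u v * K v w))"
      by (intro Bochner_Integration.integrable_diff integrable_mult_right integrable_prod)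
    then show ?thesis by (simp add: d_def algebra_simps)
  qed
  have dK: "(LINT v|lborel. d v * K v w) = K z w - c * K u w" for w
  proof -
    have "(LINT v|lborel. d v * K v w) = (LINT v|lborel. K z v * K v w - c * (K u v * K v w))"
      by (simp add: d_def algebra_simps)
    also have "\<dots> = K z w - c * K u w"
      by (simp only: Bochner_Integration.integral_diff[OF integrable_prod integrable_mult_right[OF integrable_prod]]
          integral_mult_right_zero reproducing[symmetric])
    finally show ?thesis .
  qed
  have d2: "of_real ((norm (d v))\<^sup>2) = d v * K v z - cnj c * (d v * K v u)" for v
  proof -
    have "cnj (d v) = K v z - cnj c * K v u"
      by (simp only: d_def complex_cnj_diff complex_cnj_mult hermitian[of v z] hermitian[of v u])
    then show ?thesis by (simp only: complex_norm_square right_diff_distrib mult.left_commute)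
  qed
  have i2: "integrable lborel (\<lambda>v. complex_of_real ((norm (d v))\<^sup>2))"
    unfolding d2 by (intro Bochner_Integration.integrable_diff integrable_mult_right id)
  have "complex_of_real (LINT v|lborel. (norm (d v))\<^sup>2) = (LINT v|lborel. d v * K v z - cnj c * (d v * K v u))"
    unfolding d2[symmetric] integral_complex_of_real ..
  also have "\<dots> = (K z z - c * K u z) - cnj c * (K z u - c * K u u)"
    using id dK by (subst Bochner_Integration.integral_diff) auto
  \<comment> \<open>Orthogonality removes the term with \<open>cnj c\<close>, and the Pythagorean
    value of the squared norm remains.\<close>
  also have "\<dots> = of_real (\<phi> 0 - (\<phi> (z - u))\<^sup>2 / \<phi> 0)"
  proof -
    have "K z u * K u z = of_real ((\<phi> (z - u))\<^sup>2)"
      by (simp only: hermitian[of u z] modulus[symmetric] complex_norm_square)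
    then have "c * K u z = of_real ((\<phi> (z - u))\<^sup>2 / \<phi> 0)" by (simp add: c_def)
    moreover have "K z u - c * K u u = 0" using assms by (simp add: c_def diag)
    ultimately show ?thesis by (simp add: diag)
  qed
  finally have nd: "(LINT v|lborel. (norm (d v))\<^sup>2) = \<phi> 0 - (\<phi> (z - u))\<^sup>2 / \<phi> 0" by (simp only: of_real_eq_iff)
  have nK: "(\<integral>\<^sup>+v. ennreal ((norm (K v w))\<^sup>2) \<partial>lborel) = ennreal (\<phi> 0)"
  proof -
    have k2: "K w v * K v w = of_real ((norm (K v w))\<^sup>2)" for v
      by (simp only: hermitian[of w v] complex_norm_square mult.commute)
    have "integrable lborel (\<lambda>v. complex_of_real ((norm (K v w))\<^sup>2))"
      using integrable_prod[of w w] unfolding k2 .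
    then have "integrable lborel (\<lambda>v. (norm (K v w))\<^sup>2)" by (simp only: complex_of_real_integrable_eq)
    moreover have "(LINT v|lborel. (norm (K v w))\<^sup>2) = \<phi> 0"
      using reproducing[of w w] unfolding k2 integral_complex_of_real diag by (simp only: of_real_eq_iff)
    ultimately show ?thesis by (simp add: nn_integral_eq_integral)
  qed
  have nD: "(\<integral>\<^sup>+v. ennreal ((norm (d v))\<^sup>2) \<partial>lborel) = ennreal (\<phi> 0 - (\<phi> (z - u))\<^sup>2 / \<phi> 0)"
    unfolding nd[symmetric] using i2 by (intro nn_integral_eq_integral) (simp_all only: complex_of_real_integrable_eq, simp)
  have pos: "0 \<le> \<phi> 0 - (\<phi> (z - u))\<^sup>2 / \<phi> 0" unfolding nd[symmetric] by simp
  \<comment> \<open>By reproduction this value is a pairing of \<open>d\<close> with the section at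
    \<open>w\<close>, whose squared norm is \<phi> 0.\<close>
  have "ennreal (norm (K z w - c * K u w)) \<le> (\<integral>\<^sup>+v. ennreal (norm (d v)) * ennreal (norm (K v w)) \<partial>lborel)"
    unfolding dK[symmetric] using integral_norm_bound_ennreal[OF id[of w]] by (simp add: norm_mult ennreal_mult)
  then have "ennreal (norm (K z w - c * K u w)) ^ 2 \<le> (\<integral>\<^sup>+v. ennreal (norm (d v)) * ennreal (norm (K v w)) \<partial>lborel) ^ 2"
    by (rule power_mono) simp
  also have "\<dots> \<le> (\<integral>\<^sup>+v. ennreal (norm (d v)) ^ 2 \<partial>lborel) * (\<integral>\<^sup>+v. ennreal (norm (K v w)) ^ 2 \<partial>lborel)"
    by (rule Cauchy_Schwarz_nn_integral) measurable
  also have "\<dots> = ennreal ((\<phi> 0 - (\<phi> (z - u))\<^sup>2 / \<phi> 0) * \<phi> 0)"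
    using pos \<phi>_nonneg by (simp add: ennreal_power nD nK ennreal_mult)
  also have "(\<phi> 0 - (\<phi> (z - u))\<^sup>2 / \<phi> 0) * \<phi> 0 = (\<phi> 0)\<^sup>2 - (\<phi> (z - u))\<^sup>2"
    using assms by (simp add: field_simps power2_eq_square)
  finally have le: "ennreal ((norm (K z w - c * K u w))\<^sup>2) \<le> ennreal ((\<phi> 0)\<^sup>2 - (\<phi> (z - u))\<^sup>2)"
    by (simp add: ennreal_power)
  have "0 \<le> (\<phi> 0)\<^sup>2 - (\<phi> (z - u))\<^sup>2"
    using mult_nonneg_nonneg[OF pos \<phi>_nonneg[of 0]] assms by (simp add: field_simps power2_eq_square)
  with le have "(norm (K z w - c * K u w))\<^sup>2 \<le> (\<phi> 0)\<^sup>2 - (\<phi> (z - u))\<^sup>2" by (simp add: ennreal_le_iff)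
  then show ?thesis by (simp add: c_def)
qed

text \<open>Rounding the middle point to the countable grid reduces joint measurability to
  measurability of sections. By \<open>rank_one_approx\<close> and continuity of \<phi> at 0 the
  approximations converge pointwise. If \<phi> 0 = 0, every section has norm 0 and the kernel
  vanishes.\<close>

lemma kernel_measurable: "case_prod K \<in> borel_measurable (lborel \<Otimes>\<^sub>M lborel)"
proof (cases "\<phi> 0 > 0")
  case True
  let ?F = "\<lambda>n x. K (fst x) (grid n (fst x)) * K (grid n (fst x)) (snd x) / of_real (\<phi> 0)"
  note [measurable] = row_measurable col_measurable
  show ?thesis
  proof (rule borel_measurable_LIMSEQ_metric[where f = ?F])
    fix n
    have "(\<lambda>x :: complex \<times> complex. grid n (fst x)) \<in> (lborel \<Otimes>\<^sub>M lborel) \<rightarrow>\<^sub>M count_space (range (grid n))"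
      by (rule measurable_compose[OF _ grid_count_space]) measurable
    then show "?F n \<in> borel_measurable (lborel \<Otimes>\<^sub>M lborel)"
      by (rule measurable_compose_countable'[where f = "\<lambda>p x. K (fst x) p * K p (snd x) / of_real (\<phi> 0)", rotated])
        (auto intro: countable_range_grid)
  next
    fix x :: "complex \<times> complex"
    have "(\<lambda>n. \<phi> (fst x - grid n (fst x))) \<longlonglongrightarrow> \<phi> (fst x - fst x)"
      by (intro continuous_on_tendsto_compose[OF \<phi>_continuous] tendsto_diff tendsto_const grid_tendsto) auto
    then have lim: "(\<lambda>n. sqrt ((\<phi> 0)\<^sup>2 - (\<phi> (fst x - grid n (fst x)))\<^sup>2)) \<longlonglongrightarrow> sqrt ((\<phi> 0)\<^sup>2 - (\<phi> (fst x - fst x))\<^sup>2)"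
      by (intro tendsto_intros)
    have "(\<lambda>n. K (fst x) (snd x) - ?F n x) \<longlonglongrightarrow> 0"
    proof (rule Lim_null_comparison)
      show "eventually (\<lambda>n. norm (K (fst x) (snd x) - ?F n x) \<le> sqrt ((\<phi> 0)\<^sup>2 - (\<phi> (fst x - grid n (fst x)))\<^sup>2)) sequentially"
        using rank_one_approx[OF True] by (intro always_eventually allI real_le_rsqrt)
    qed (use lim in simp)
    from tendsto_diff[OF tendsto_const[of "K (fst x) (snd x)"] this]
    show "(\<lambda>n. ?F n x) \<longlonglongrightarrow> case_prod K x" by (simp add: case_prod_beta)
  qed
next
  case False
  then have z: "\<phi> 0 = 0" using \<phi>_nonneg[of 0] by simp
  have "K z w = 0" for z w
  proof -
    have k2: "K z v * K v z = of_real ((norm (K z v))\<^sup>2)" for v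
      by (simp only: hermitian[of v z] complex_norm_square)
    have i: "integrable lborel (\<lambda>v. (norm (K z v))\<^sup>2)"
      using integrable_prod[of z z] unfolding k2 by (simp only: complex_of_real_integrable_eq)
    have "(LINT v|lborel. (norm (K z v))\<^sup>2) = 0"
      using reproducing[of z z] unfolding k2 integral_complex_of_real diag z by simp
    then have "AE v in lborel. (norm (K z v))\<^sup>2 = 0"
      using i by (subst (asm) integral_nonneg_eq_0_iff_AE) auto
    then have "AE v in lborel. K z v * K v w = 0" by eventually_elim simp
    then show ?thesis unfolding reproducing[of z w] by (rule integral_eq_zero_AE)
  qed
  then show ?thesis by (simp add: case_prod_beta')
qed

text \<open>In the row integrals the Jacobian cancels the factor \<rho>, so they are bounded by the
  integral of \<phi> for every \<rho>; only the supremum grows.\<close>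

lemma schur_dilated:
  assumes r: "\<rho> > 0"
  shows "plane.schur (dilated_kernel \<rho> K)"
proof -
  have s: "sqrt \<rho> \<noteq> 0" using r by simp
  obtain b where b: "\<And>z. \<bar>\<phi> z\<bar> \<le> b" using \<phi>_bounded by (auto simp: bounded_iff)
  define c where "c = max (\<rho> * b) (LINT z|lborel. \<phi> z)"
  have nn: "(\<integral>\<^sup>+u. ennreal (\<rho> * \<phi> (of_real (sqrt \<rho>) * u)) \<partial>lborel) \<le> ennreal c"
  proof -
    have "(\<integral>\<^sup>+u. ennreal (\<rho> * \<phi> (of_real (sqrt \<rho>) * u)) \<partial>lborel) = ennreal \<rho> * (\<integral>\<^sup>+u. ennreal (\<phi> (of_real (sqrt \<rho>) * u)) \<partial>lborel)"
      using r by (simp add: ennreal_mult \<phi>_nonneg nn_integral_cmult)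
    also have "\<dots> = (\<integral>\<^sup>+u. ennreal (\<phi> u) \<partial>lborel)"
      using nn_integral_lborel_affine[of "\<lambda>u. ennreal (\<phi> u)", OF _ s, of 0] r by (simp add: scaleR_conv_of_real)
    also have "\<dots> = ennreal (LINT z|lborel. \<phi> z)"
      by (rule nn_integral_eq_integral[OF \<phi>_integrable]) (simp add: \<phi>_nonneg)
    finally show ?thesis by (simp add: c_def ennreal_leI)
  qed
  have mod: "norm (dilated_kernel \<rho> K z w) = \<rho> * \<phi> (of_real (sqrt \<rho>) * (z - w))" for z w
    using r by (simp add: dilated_kernel_def norm_mult modulus right_diff_distrib)
  have [measurable]: "case_prod K \<in> borel_measurable (borel \<Otimes>\<^sub>M borel)"
    using kernel_measurable by (simp cong: measurable_cong_sets sets_pair_measure_cong)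
  have m: "case_prod (dilated_kernel \<rho> K) \<in> borel_measurable (lborel \<Otimes>\<^sub>M lborel)"
  proof -
    have "case_prod (dilated_kernel \<rho> K) = (\<lambda>x. of_real \<rho> * case_prod K (of_real (sqrt \<rho>) * fst x, of_real (sqrt \<rho>) * snd x))"
      by (auto simp: dilated_kernel_def fun_eq_iff)
    then show ?thesis by simp
  qed
  show ?thesis unfolding plane.schur_def
  proof (intro conjI exI[of _ c] allI m)
    have "0 \<le> b" using b[of 0] by linarith
    then show "0 \<le> c" using r unfolding c_def by (simp add: le_max_iff_disj)
    show "norm (dilated_kernel \<rho> K z w) \<le> c" for z w
      using mult_left_mono[OF abs_le_D1[OF b], of \<rho>] r unfolding mod c_def by (simp add: le_max_iff_disj)
    show "(\<integral>\<^sup>+w. ennreal (norm (dilated_kernel \<rho> K z w)) \<partial>lborel) \<le> ennreal c" for z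
      unfolding mod using nn nn_integral_lborel_reflect(1)[of "\<lambda>u. ennreal (\<rho> * \<phi> (of_real (sqrt \<rho>) * u))" z] by simp
    show "(\<integral>\<^sup>+z. ennreal (norm (dilated_kernel \<rho> K z w)) \<partial>lborel) \<le> ennreal c" for w
      unfolding mod using nn nn_integral_lborel_reflect(2)[of "\<lambda>u. ennreal (\<rho> * \<phi> (of_real (sqrt \<rho>) * u))" w] by simp
  qed
qed

text \<open>In the composition the Jacobian cancels one of the two factors \<rho>.\<close>

lemma projection_dilated:
  assumes r: "\<rho> > 0"
  shows "projection_kernel lborel (dilated_kernel \<rho> K)"
proof
  show "plane.schur (dilated_kernel \<rho> K)" by (rule schur_dilated[OF r])
  show "dilated_kernel \<rho> K w z = cnj (dilated_kernel \<rho> K z w)" for w z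
    unfolding dilated_kernel_def complex_cnj_mult complex_cnj_complex_of_real
    by (simp only: hermitian[of "of_real (sqrt \<rho>) * w" "of_real (sqrt \<rho>) * z"])
  have s: "sqrt \<rho> \<noteq> 0" using r by simp
  note [measurable] = row_measurable col_measurable
  show "plane.comp (dilated_kernel \<rho> K) (dilated_kernel \<rho> K) = dilated_kernel \<rho> K"
  proof (intro ext)
    fix z w :: complex
    let ?z = "of_real (sqrt \<rho>) * z" and ?w = "of_real (sqrt \<rho>) * w"
    have "plane.comp (dilated_kernel \<rho> K) (dilated_kernel \<rho> K) z w =
      of_real \<rho> * (of_real ((sqrt \<rho>)\<^sup>2) * (LINT u|lborel. K ?z (of_real (sqrt \<rho>) * u) * K (of_real (sqrt \<rho>) * u) ?w))"
      using r by (simp add: plane.comp_def dilated_kernel_def mult_ac)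
    also have "of_real ((sqrt \<rho>)\<^sup>2) * (LINT u|lborel. K ?z (of_real (sqrt \<rho>) * u) * K (of_real (sqrt \<rho>) * u) ?w) = K ?z ?w"
      using integral_lborel_affine[of "\<lambda>u. K ?z u * K u ?w", OF _ s, of 0] reproducing[of ?z ?w]
      by (simp add: scaleR_conv_of_real)
    finally show "plane.comp (dilated_kernel \<rho> K) (dilated_kernel \<rho> K) z w = dilated_kernel \<rho> K z w"
      by (simp only: dilated_kernel_def[of \<rho> K z w])
  qed
qed

lemma norm_dilated: "\<rho> > 0 \<Longrightarrow> norm (dilated_kernel \<rho> K z w) = \<rho> * \<phi> (of_real (sqrt \<rho>) * (z - w))"
  by (simp add: dilated_kernel_def norm_mult modulus right_diff_distrib)

lemma dilated_diag: "dilated_kernel \<rho> K z z = of_real (\<rho> * \<phi> 0)"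
  by (simp add: dilated_kernel_def diag)

end

section \<open>Convergence of Laplace transforms\<close>

text \<open>One integrable majorant for all partial sums of norms supplies both the pointwise and
  the integrated summability.\<close>

lemma summable_nonneg_sums_integral:
  fixes f :: "nat \<Rightarrow> 'a \<Rightarrow> complex"
  assumes f: "\<And>k. f k \<in> borel_measurable M" and w: "integrable M w"
    and le: "\<And>n x. (\<Sum>k<n. norm (f k x)) \<le> w x"
  shows "(\<lambda>k. LINT x|M. f k x) sums (LINT x|M. (\<Sum>k. f k x))"
proof -
  have b: "norm (f k x) \<le> w x" for k x
    using le[where n = "Suc k" and x = x] sum_nonneg[of "{..<k}" "\<lambda>k. norm (f k x)"] by simp
  have i: "integrable M (f k)" for k
    by (rule Bochner_Integration.integrable_bound[OF w f]) (auto intro!: AE_I2 order_trans[OF b])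
  have s1: "summable (\<lambda>k. norm (f k x))" for x
    by (rule summableI_nonneg_bounded[OF _ le]) simp
  have s2: "summable (\<lambda>k. LINT x|M. norm (f k x))"
  proof (rule summableI_nonneg_bounded)
    fix n
    have "(\<Sum>k<n. LINT x|M. norm (f k x)) = (LINT x|M. (\<Sum>k<n. norm (f k x)))"
      by (rule Bochner_Integration.integral_sum[symmetric]) (intro integrable_norm i)
    also have "\<dots> \<le> (LINT x|M. w x)"
      by (intro integral_mono Bochner_Integration.integrable_sum integrable_norm i w le)
    finally show "(\<Sum>k<n. LINT x|M. norm (f k x)) \<le> (LINT x|M. w x)" .
  qed simp
  show ?thesis by (rule sums_integral[OF i _ s2]) (use s1 in auto)
qed

section \<open>Laplace transforms in a vertical strip\<close>

definition laplace :: "real measure \<Rightarrow> complex \<Rightarrow> complex" where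
  "laplace M z = (LINT x|M. exp (z * of_real x))"

text \<open>Removes the absolute value, so that real exponentials at the two parameters b + c and b
  - c control the left side.\<close>

lemma exp_abs_le: "exp (c * \<bar>x\<bar> + b * x) \<le> exp ((b + c) * x) + exp ((b - c) * x)" for x :: real
  by (cases "x \<ge> 0") (auto simp: algebra_simps)

text \<open>Near \<open>z0\<close> the exponential is expanded in powers of w - z0 and integrated
  termwise. As long as |w - z0| is less than the distance from \<open>z0\<close> to the edge of the
  strip, the majorant consists of two real exponentials that are integrable by assumption.\<close>

lemma laplace_holomorphic:
  assumes M: "sets M = sets borel" and int: "\<And>t. \<bar>t\<bar> < r \<Longrightarrow> integrable M (\<lambda>x. exp (t * x))"
  shows "laplace M holomorphic_on {z. \<bar>Re z\<bar> < r}"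
proof -
  have [measurable_cong]: "sets M = sets borel" by (rule M)
  have "\<exists>e>0. laplace M holomorphic_on ball z0 e" if z0: "\<bar>Re z0\<bar> < r" for z0
  proof (intro exI conjI)
    let ?e = "r - \<bar>Re z0\<bar>"
    show "?e > 0" using z0 by simp
    let ?a = "\<lambda>k. LINT x|M. of_real x ^ k * exp (z0 * of_real x) / fact k"
    show "laplace M holomorphic_on ball z0 ?e"
    proof (rule power_series_holomorphic[where a = ?a])
      fix w assume "w \<in> ball z0 ?e"
      then have w: "norm (w - z0) < ?e" by (simp add: dist_norm norm_minus_commute)
      let ?d = "norm (w - z0)"
      let ?f = "\<lambda>k x. of_real x ^ k * exp (z0 * of_real x) / fact k * (w - z0) ^ k"
      have "(\<lambda>k. LINT x|M. ?f k x) sums (LINT x|M. (\<Sum>k. ?f k x))"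
      proof (rule summable_nonneg_sums_integral)
        show "?f k \<in> borel_measurable M" for k by measurable
        show "integrable M (\<lambda>x. exp ((Re z0 + ?d) * x) + exp ((Re z0 - ?d) * x))"
        proof (intro Bochner_Integration.integrable_add int)
          have "0 \<le> ?d" by simp
          with w show "\<bar>Re z0 + ?d\<bar> < r" "\<bar>Re z0 - ?d\<bar> < r" by arith+
        qed
        fix n :: nat and x :: real
        have "(\<Sum>k<n. norm (?f k x)) = (\<Sum>k<n. (?d * \<bar>x\<bar>) ^ k / fact k) * exp (Re z0 * x)"
          unfolding sum_distrib_right
          by (intro sum.cong refl) (simp add: norm_mult norm_divide norm_power power_mult_distrib mult_ac)
        also have "\<dots> \<le> exp (?d * \<bar>x\<bar>) * exp (Re z0 * x)"
        proof (rule mult_right_mono)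
          have s: "(\<lambda>k. (?d * \<bar>x\<bar>) ^ k / fact k) sums exp (?d * \<bar>x\<bar>)"
            using exp_converges[of "?d * \<bar>x\<bar>"] by (simp add: divide_inverse mult.commute)
          show "(\<Sum>k<n. (?d * \<bar>x\<bar>) ^ k / fact k) \<le> exp (?d * \<bar>x\<bar>)"
            unfolding sums_unique[OF s] by (rule sum_le_suminf[OF sums_summable[OF s]]) auto
        qed simp
        also have "\<dots> \<le> exp ((Re z0 + ?d) * x) + exp ((Re z0 - ?d) * x)"
          using exp_abs_le[of ?d x "Re z0"] by (simp add: exp_add)
        finally show "(\<Sum>k<n. norm (?f k x)) \<le> exp ((Re z0 + ?d) * x) + exp ((Re z0 - ?d) * x)" .
      qed
      moreover have "(\<Sum>k. ?f k x) = exp (w * of_real x)" for x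
      proof -
        have "(\<lambda>k. ((w - z0) * of_real x) ^ k /\<^sub>R fact k) sums exp ((w - z0) * of_real x)" by (rule exp_converges)
        then have "(\<lambda>k. ((w - z0) * of_real x) ^ k /\<^sub>R fact k * exp (z0 * of_real x)) sums (exp ((w - z0) * of_real x) * exp (z0 * of_real x))"
          by (rule sums_mult2)
        moreover have "((w - z0) * of_real x) ^ k /\<^sub>R fact k * exp (z0 * of_real x) = ?f k x" for k
          by (simp add: scaleR_conv_of_real power_mult_distrib divide_inverse mult_ac)
        moreover have "exp ((w - z0) * of_real x) * exp (z0 * of_real x) = exp (w * of_real x)"
          by (simp add: exp_add[symmetric] algebra_simps)
        ultimately have "(\<lambda>k. ?f k x) sums exp (w * of_real x)" by (simp only:)
        then show ?thesis by (rule sums_unique[symmetric])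
      qed
      ultimately show "(\<lambda>k. ?a k * (w - z0) ^ k) sums laplace M w"
        unfolding laplace_def by simp
    qed
  qed
  then have "laplace M field_differentiable (at z0 within {z. \<bar>Re z\<bar> < r})" if "\<bar>Re z0\<bar> < r" for z0
    using that by (meson centre_in_ball field_differentiable_at_within holomorphic_on_imp_differentiable_at open_ball)
  then show ?thesis by (simp add: holomorphic_on_def)
qed

lemma strip: "open {z. \<bar>Re z\<bar> < r}" "connected {z. \<bar>Re z\<bar> < r}"
proof -
  have eq: "{z. \<bar>Re z\<bar> < r} = {z. Re z < r} \<inter> {z. Re z > - r}" by auto
  show "open {z. \<bar>Re z\<bar> < r}" unfolding eq by (intro open_Int open_halfspace_Re_lt open_halfspace_Re_gt)
  show "connected {z. \<bar>Re z\<bar> < r}" unfolding eq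
    by (intro convex_connected convex_Int convex_halfspace_Re_lt convex_halfspace_Re_gt)
qed

lemma laplace_of_real: "laplace M (of_real t) = of_real (LINT x|M. exp (t * x))"
  unfolding laplace_def integral_complex_of_real[symmetric] by (simp only: exp_of_real[symmetric] of_real_mult)

lemma norm_laplace_le: "norm (laplace M z) \<le> (LINT x|M. exp (Re z * x))"
  unfolding laplace_def by (rule order_trans[OF integral_norm_bound]) simp

text \<open>Vitali's theorem: Laplace transforms are bounded on closed substrips by their values on the real axis,
  so Montel's theorem propagates convergence from the real segment to the strip.\<close>

lemma laplace_tendsto_strip:
  fixes M :: "nat \<Rightarrow> real measure"
  assumes M: "\<And>n. sets (M n) = sets borel" and r: "r > 0"
    and int: "\<And>n t. \<bar>t\<bar> < r \<Longrightarrow> integrable (M n) (\<lambda>x. exp (t * x))"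
    and G: "G holomorphic_on {z. \<bar>Re z\<bar> < r}"
    and lim: "\<And>t. \<bar>t\<bar> < r \<Longrightarrow> (\<lambda>n. laplace (M n) (of_real t)) \<longlonglongrightarrow> G (of_real t)"
    and w: "\<bar>Re w\<bar> < r"
  shows "(\<lambda>n. laplace (M n) w) \<longlonglongrightarrow> G w"
proof (rule ccontr)
  let ?S = "{z. \<bar>Re z\<bar> < r}"
  assume "\<not> (\<lambda>n. laplace (M n) w) \<longlonglongrightarrow> G w"
  then obtain e where e: "e > 0" "\<not> eventually (\<lambda>n. dist (laplace (M n) w) (G w) < e) sequentially"
    unfolding tendsto_iff by blast
  \<comment> \<open>If convergence fails at \<open>w\<close>, some subsequence keeps a distance
    \<open>e\<close> from the expected limit; a convergent further subsequence will contradict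
    this.\<close>
  then have "infinite {n. \<not> dist (laplace (M n) w) (G w) < e}"
    by (simp add: eventually_cofinite[symmetric] cofinite_eq_sequentially)
  then obtain s :: "nat \<Rightarrow> nat" where s: "strict_mono s" "\<And>n. \<not> dist (laplace (M (s n)) w) (G w) < e"
    using infinite_enumerate by blast
  have bnd: "\<exists>b. \<forall>n. (LINT x|M n. exp (t * x)) \<le> b" if "\<bar>t\<bar> < r" for t
  proof -
    have "Bseq (\<lambda>n. laplace (M n) (of_real t))"
      using lim[OF that] by (intro convergent_imp_Bseq) (auto simp: convergent_def)
    then obtain b where "\<And>n. norm (laplace (M n) (of_real t)) \<le> b" by (auto simp: Bseq_def)
    then show ?thesis unfolding laplace_of_real norm_of_real by (meson abs_le_D1)
  qed
  let ?H = "range (\<lambda>n. laplace (M n))"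
  have bounded: "\<exists>b. \<forall>h\<in>?H. \<forall>z\<in>C. norm (h z) \<le> b" if C: "compact C" "C \<subseteq> ?S" for C
  proof (cases "C = {}")
    case False
    have "compact ((\<lambda>z. \<bar>Re z\<bar>) ` C)" by (intro compact_continuous_image C continuous_intros)
    then obtain z0 where z0: "z0 \<in> C" "\<And>z. z \<in> C \<Longrightarrow> \<bar>Re z\<bar> \<le> \<bar>Re z0\<bar>"
      using compact_attains_sup[of "(\<lambda>z. \<bar>Re z\<bar>) ` C"] False by blast
    define c where "c = \<bar>Re z0\<bar>"
    have c: "c < r" "c \<ge> 0" using C z0 by (auto simp: c_def)
    obtain b1 where b1: "\<And>n. (LINT x|M n. exp (c * x)) \<le> b1" using bnd[of c] c by auto
    obtain b2 where b2: "\<And>n. (LINT x|M n. exp (- c * x)) \<le> b2" using bnd[of "- c"] c by auto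
    have "norm (laplace (M n) z) \<le> b1 + b2" if "z \<in> C" for n z
    proof -
      have z: "\<bar>Re z\<bar> \<le> c" using z0(2)[OF that] by (simp add: c_def)
      have "norm (laplace (M n) z) \<le> (LINT x|M n. exp (Re z * x))" by (rule norm_laplace_le)
      also have "\<dots> \<le> (LINT x|M n. exp (c * x) + exp (- c * x))"
      proof (rule integral_mono)
        show "integrable (M n) (\<lambda>x. exp (Re z * x))" using z c by (intro int) linarith
        show "integrable (M n) (\<lambda>x. exp (c * x) + exp (- c * x))"
          using c by (intro Bochner_Integration.integrable_add int) auto
        fix x :: real
        have "Re z * x \<le> \<bar>Re z\<bar> * \<bar>x\<bar>" by (metis abs_ge_self abs_mult)
        also have "\<dots> \<le> c * \<bar>x\<bar>" using z by (intro mult_right_mono) auto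
        finally have "exp (Re z * x) \<le> exp (c * \<bar>x\<bar> + 0 * x)" by simp
        also have "\<dots> \<le> exp (c * x) + exp (- c * x)" using exp_abs_le[of c x 0] by simp
        finally show "exp (Re z * x) \<le> exp (c * x) + exp (- c * x)" .
      qed
      also have "\<dots> = (LINT x|M n. exp (c * x)) + (LINT x|M n. exp (- c * x))"
        using c by (intro Bochner_Integration.integral_add int) auto
      also have "\<dots> \<le> b1 + b2" by (intro add_mono b1 b2)
      finally show ?thesis .
    qed
    then show ?thesis by blast
  qed auto
  obtain h k where h: "h holomorphic_on ?S" "strict_mono (k :: nat \<Rightarrow> nat)"
      "\<And>z. z \<in> ?S \<Longrightarrow> (\<lambda>n. laplace (M (s (k n))) z) \<longlonglongrightarrow> h z"
    by (rule Montel[OF strip(1)[of r], of ?H "\<lambda>n. laplace (M (s n))"]) (use laplace_holomorphic[OF M int] bounded in auto)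
  have sk: "strict_mono (s \<circ> k)" by (rule strict_mono_o[OF s(1) h(2)])
  have real: "h (of_real t) - G (of_real t) = 0" if "\<bar>t\<bar> < r" for t
    using LIMSEQ_unique[OF h(3)[of "of_real t"] LIMSEQ_subseq_LIMSEQ[OF lim[OF that] sk, unfolded o_def]] that by simp
  \<comment> \<open>The real segment accumulates at 0, so agreement there extends to the connected
    strip by the identity theorem.\<close>
  have "h w - G w = 0"
  proof (rule analytic_continuation[where f = "\<lambda>z. h z - G z" and S = ?S and U = "of_real ` {-r<..<r}" and \<xi> = 0])
    show "(0 :: complex) islimpt of_real ` {-r<..<r}"
      unfolding islimpt_approachable
    proof (intro allI impI)
      fix e :: real assume "e > 0"
      then show "\<exists>x'\<in>of_real ` {-r<..<r}. x' \<noteq> (0 :: complex) \<and> dist x' 0 < e"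
        using r by (intro bexI[of _ "of_real (min e r / 2)"] conjI imageI) (auto simp: min_def)
    qed
  qed (use G h(1) strip r w real in \<open>auto intro: holomorphic_on_diff\<close>)
  then have "(\<lambda>n. laplace (M (s (k n))) w) \<longlonglongrightarrow> G w" using h(3)[of w] w by simp
  then have "eventually (\<lambda>n. dist (laplace (M (s (k n))) w) (G w) < e) sequentially"
    using e(1) by (rule tendstoD)
  then show False using s(2) by simp
qed

text \<open>The degenerate law v = 0 is a point mass and is treated apart; otherwise rescaling by
  the standard deviation reduces to the standard normal law.\<close>

lemma char_normal_law:
  assumes "v \<ge> 0" shows "char (normal_law 0 v) t = exp (- of_real (v * t\<^sup>2 / 2))" "real_distribution (normal_law 0 v)"
proof -
  have "char (normal_law 0 v) t = exp (- of_real (v * t\<^sup>2 / 2)) \<and> real_distribution (normal_law 0 v)"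
  proof (cases "v = 0")
    case True
    have "prob_space (return borel (0::real))" by (rule prob_space_return) simp
    then show ?thesis using True
      by (auto simp: normal_law_def char_def integral_return real_distribution_def real_distribution_axioms_def)
  next
    case False
    define \<sigma> where "\<sigma> = sqrt v"
    have "v > 0" using assms False by simp
    then have \<sigma>: "\<sigma> > 0" "\<sigma>\<^sup>2 = v" unfolding \<sigma>_def by simp_all
    let ?N = "density lborel (normal_density 0 \<sigma>)"
    interpret prob_space ?N by (rule prob_space_normal_density[OF \<sigma>(1)])
    have "distributed ?N lborel (\<lambda>x. x) (normal_density 0 \<sigma>)"
      by (auto simp: distributed_def intro!: distr_id2)
    then have "distributed ?N lborel (\<lambda>x. (x - 0) / \<sigma>) std_normal_density"
      using normal_standard_normal_convert[OF \<sigma>(1)] by (simp only:)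
    then have d: "distr ?N lborel (\<lambda>x. x / \<sigma>) = std_normal_distribution" by (simp add: distributed_def)
    have "char ?N t = (CLINT x|?N. iexp ((t * \<sigma>) * (x / \<sigma>)))"
      unfolding char_def using \<sigma> by simp
    also have "\<dots> = (CLINT y|distr ?N lborel (\<lambda>x. x / \<sigma>). iexp ((t * \<sigma>) * y))"
      by (rule integral_distr[symmetric]) auto
    also have "\<dots> = char std_normal_distribution (t * \<sigma>)" unfolding d char_def ..
    also have "\<dots> = exp (- of_real (v * t\<^sup>2 / 2))"
      by (simp add: char_std_normal_distribution \<sigma>(2)[symmetric] power_mult_distrib mult.commute exp_of_real[symmetric])
    finally show ?thesis using False prob_space_axioms
      by (simp add: normal_law_def \<sigma>_def[symmetric] real_distribution_def real_distribution_axioms_def)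
  qed
  then show "char (normal_law 0 v) t = exp (- of_real (v * t\<^sup>2 / 2))" "real_distribution (normal_law 0 v)" by auto
qed

theorem weak_conv_normal_of_laplace:
  fixes M :: "nat \<Rightarrow> real measure"
  assumes M: "\<And>n. real_distribution (M n)" and r: "r > 0" and v: "v \<ge> 0"
    and int: "\<And>n t. \<bar>t\<bar> < r \<Longrightarrow> integrable (M n) (\<lambda>x. exp (t * x))"
    and lim: "\<And>t. \<bar>t\<bar> < r \<Longrightarrow> (\<lambda>n. LINT x|M n. exp (t * x)) \<longlonglongrightarrow> exp (v * t\<^sup>2 / 2)"
  shows "weak_conv_m M (normal_law 0 v)"
proof (rule levy_continuity[OF M char_normal_law(2)[OF v]])
  fix t
  let ?G = "\<lambda>z::complex. exp (of_real v * z\<^sup>2 / 2)"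
  have "(\<lambda>n. laplace (M n) (\<i> * of_real t)) \<longlonglongrightarrow> ?G (\<i> * of_real t)"
  proof (rule laplace_tendsto_strip[OF _ r int])
    show "sets (M n) = sets borel" for n
      using M[of n] by (simp add: real_distribution_def real_distribution_axioms_def)
    show "?G holomorphic_on {z. \<bar>Re z\<bar> < r}" by (intro holomorphic_intros) simp
    show "(\<lambda>n. laplace (M n) (of_real t)) \<longlonglongrightarrow> ?G (of_real t)" if "\<bar>t\<bar> < r" for t
    proof -
      have "?G (of_real t) = of_real (exp (v * t\<^sup>2 / 2))" by (simp add: exp_of_real[symmetric])
      then show ?thesis unfolding laplace_of_real using tendsto_of_real[OF lim[OF that]] by (simp only:)
    qed
  qed (use r in auto)
  moreover have "laplace (M n) (\<i> * of_real t) = char (M n) t" for n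
    by (simp add: laplace_def char_def mult.assoc)
  moreover have "?G (\<i> * of_real t) = char (normal_law 0 v) t"
    unfolding char_normal_law(1)[OF v] by (simp add: power_mult_distrib)
  ultimately show "(\<lambda>n. char (M n) t) \<longlonglongrightarrow> char (normal_law 0 v) t" by simp
qed

section \<open>The Laplace functional of the dilated process\<close>

lemma nn_integral_convolution_ball:
  fixes \<eta> :: "complex \<Rightarrow> ennreal"
  assumes [measurable]: "\<eta> \<in> borel_measurable borel" "B \<in> sets borel"
  shows "(\<integral>\<^sup>+x. (indicator B (fst x) + indicator B (snd x)) * \<eta> (fst x - snd x) \<partial>(lborel \<Otimes>\<^sub>M lborel)) =
    2 * emeasure lborel B * (\<integral>\<^sup>+v. \<eta> v \<partial>lborel)"
proof -
  have "(\<integral>\<^sup>+x. (indicator B (fst x) + indicator B (snd x)) * \<eta> (fst x - snd x) \<partial>(lborel \<Otimes>\<^sub>M lborel)) =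
    (\<integral>\<^sup>+x. indicator B (fst x) * \<eta> (fst x - snd x) + indicator B (snd x) * \<eta> (fst x - snd x) \<partial>(lborel \<Otimes>\<^sub>M lborel))"
    by (simp add: distrib_right)
  also have "\<dots> = (\<integral>\<^sup>+x. indicator B (fst x) * \<eta> (fst x - snd x) \<partial>(lborel \<Otimes>\<^sub>M lborel)) +
      (\<integral>\<^sup>+x. indicator B (snd x) * \<eta> (fst x - snd x) \<partial>(lborel \<Otimes>\<^sub>M lborel))"
    by (rule nn_integral_add) measurable
  also have "(\<integral>\<^sup>+x. indicator B (fst x) * \<eta> (fst x - snd x) \<partial>(lborel \<Otimes>\<^sub>M lborel)) = emeasure lborel B * (\<integral>\<^sup>+v. \<eta> v \<partial>lborel)"
    by (subst lborel.nn_integral_fst[symmetric]) (simp_all add: nn_integral_cmult nn_integral_multc nn_integral_lborel_reflect)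
  also have "(\<integral>\<^sup>+x. indicator B (snd x) * \<eta> (fst x - snd x) \<partial>(lborel \<Otimes>\<^sub>M lborel)) = emeasure lborel B * (\<integral>\<^sup>+v. \<eta> v \<partial>lborel)"
    by (subst lborel_pair.nn_integral_snd[symmetric]) (simp_all add: nn_integral_cmult nn_integral_multc nn_integral_lborel_reflect)
  finally show ?thesis by (simp add: mult_2 distrib_right)
qed

lemma nn_integral_dilate:
  fixes \<psi> :: "complex \<Rightarrow> real"
  assumes [measurable]: "\<psi> \<in> borel_measurable borel" and "integrable lborel \<psi>" "\<And>u. \<psi> u \<ge> 0" "\<rho> > 0" "c \<ge> 0"
  shows "(\<integral>\<^sup>+v. ennreal (c * \<rho> * \<psi> (of_real (sqrt \<rho>) * v)) \<partial>lborel) = ennreal (c * (LINT u|lborel. \<psi> u))"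
proof -
  have s: "sqrt \<rho> \<noteq> 0" using assms by simp
  have "(\<integral>\<^sup>+v. ennreal (c * \<rho> * \<psi> (of_real (sqrt \<rho>) * v)) \<partial>lborel) = ennreal c * (ennreal \<rho> * (\<integral>\<^sup>+v. ennreal (\<psi> (of_real (sqrt \<rho>) * v)) \<partial>lborel))"
    using assms by (simp add: ennreal_mult nn_integral_cmult mult.assoc)
  also have "ennreal \<rho> * (\<integral>\<^sup>+v. ennreal (\<psi> (of_real (sqrt \<rho>) * v)) \<partial>lborel) = (\<integral>\<^sup>+u. ennreal (\<psi> u) \<partial>lborel)"
    using nn_integral_lborel_affine[of "\<lambda>u. ennreal (\<psi> u)", OF _ s, of 0] assms by (simp add: scaleR_conv_of_real)
  also have "\<dots> = ennreal (LINT u|lborel. \<psi> u)"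
    using assms by (intro nn_integral_eq_integral) auto
  finally show ?thesis using assms by (simp add: ennreal_mult)
qed

context stationary_kernel begin

text \<open>The three moments measure, in this order, the row integrals of the commutator, its
  Hilbert--Schmidt norm, and the Hilbert--Schmidt norm of the double commutator.\<close>

definition moment1 :: real where "moment1 = (LINT u|lborel. norm u * \<phi> u)"
definition moment2 :: real where "moment2 = (LINT u|lborel. (norm u)\<^sup>2 * (\<phi> u)\<^sup>2)"
definition moment3 :: real where "moment3 = (LINT u|lborel. norm u ^ 3 * (\<phi> u)\<^sup>2)"

text \<open>All powers that occur are at most 1 + |u|^3, and where \<phi> is squared one factor is
  bounded by a constant, so the assumption \<open>moment\<close> dominates all three.\<close>

lemma moments_integrable:
  "integrable lborel (\<lambda>u. norm u * \<phi> u)" "integrable lborel (\<lambda>u. (norm u)\<^sup>2 * (\<phi> u)\<^sup>2)"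
  "integrable lborel (\<lambda>u. norm u ^ 3 * (\<phi> u)\<^sup>2)"
proof -
  obtain b where b: "\<And>z. \<bar>\<phi> z\<bar> \<le> b" using \<phi>_bounded by (auto simp: bounded_iff)
  have b0: "b \<ge> 0" using b[of 0] by linarith
  have pw: "x \<le> 1 + x ^ 3" "x\<^sup>2 \<le> 1 + x ^ 3" if "x \<ge> 0" for x :: real
  proof -
    have "x \<le> 1 + x ^ 3 \<and> x\<^sup>2 \<le> 1 + x ^ 3"
    proof (cases "x \<le> 1")
      case True
      then have "x\<^sup>2 \<le> 1" "x ^ 3 \<ge> 0" using that by (auto simp: power_le_one)
      then show ?thesis using True by linarith
    next
      case False
      then have "x ^ 1 \<le> x ^ 3" "x ^ 2 \<le> x ^ 3" by (intro power_increasing; simp)+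
      then show ?thesis by simp
    qed
    then show "x \<le> 1 + x ^ 3" "x\<^sup>2 \<le> 1 + x ^ 3" by auto
  qed
  have dom: "integrable lborel (\<lambda>u. p u * \<phi> u)"
    if [measurable]: "p \<in> borel_measurable borel" and p: "\<And>u. 0 \<le> p u" "\<And>u. p u \<le> (1 + b) * (1 + norm u ^ 3)" for p :: "complex \<Rightarrow> real"
  proof (rule Bochner_Integration.integrable_bound[OF integrable_mult_right[OF moment, of "1 + b"]])
    have "norm (p u * \<phi> u) \<le> norm ((1 + b) * ((1 + norm u ^ 3) * \<phi> u))" for u
      using mult_right_mono[OF p(2)[of u] \<phi>_nonneg[of u]] p(1)[of u] \<phi>_nonneg[of u] abs_ge_self[of "(1 + b) * ((1 + norm u ^ 3) * \<phi> u)"]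
      by (simp add: mult.assoc)
    then show "AE u in lborel. norm (p u * \<phi> u) \<le> norm ((1 + b) * ((1 + norm u ^ 3) * \<phi> u))" by simp
  qed measurable
  have b1: "x \<le> (1 + b) * x" if "x \<ge> 0" for x using b0 that by (simp add: distrib_right)
  show "integrable lborel (\<lambda>u. norm u * \<phi> u)"
    by (rule dom) (auto intro: order_trans[OF pw(1) b1])
  have q: "p * \<phi> u \<le> (1 + b) * (1 + norm u ^ 3)" if "p \<ge> 0" "p \<le> 1 + norm u ^ 3" for p u
  proof -
    have "p * \<phi> u \<le> (1 + norm u ^ 3) * (1 + b)"
      using that b[of u] \<phi>_nonneg[of u] by (intro mult_mono) auto
    then show ?thesis by (simp add: mult.commute)
  qed
  have "integrable lborel (\<lambda>u. ((norm u)\<^sup>2 * \<phi> u) * \<phi> u)"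
    by (rule dom) (auto intro!: q pw \<phi>_nonneg mult_nonneg_nonneg)
  then show "integrable lborel (\<lambda>u. (norm u)\<^sup>2 * (\<phi> u)\<^sup>2)" by (simp add: power2_eq_square mult.assoc)
  have "integrable lborel (\<lambda>u. (norm u ^ 3 * \<phi> u) * \<phi> u)"
    by (rule dom) (auto intro!: q \<phi>_nonneg mult_nonneg_nonneg)
  then show "integrable lborel (\<lambda>u. norm u ^ 3 * (\<phi> u)\<^sup>2)" by (simp add: power2_eq_square mult.assoc)
qed

lemma moments_nonneg: "moment1 \<ge> 0" "moment2 \<ge> 0" "moment3 \<ge> 0"
  unfolding moment1_def moment2_def moment3_def using \<phi>_nonneg by (auto intro!: integral_nonneg_AE)

text \<open>The kernel is supported where one of the two points lies in \<open>B\<close>, and its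
  square is bounded by a function of the difference. Integration gives twice the measure of
  \<open>B\<close> times a dilation-invariant integral, so dependence on \<rho> is confined to
  \<open>c\<close>.\<close>

lemma dilated_bound:
  fixes \<psi> :: "complex \<Rightarrow> real" and B :: "complex set"
  assumes \<rho>: "\<rho> > 0" and c: "c \<ge> 0" and B: "B \<in> sets borel" "emeasure lborel B < \<infinity>"
    and \<psi>: "\<psi> \<in> borel_measurable borel" "integrable lborel \<psi>" "\<And>u. \<psi> u \<ge> 0"
    and k: "case_prod k \<in> borel_measurable (lborel \<Otimes>\<^sub>M lborel)"
    and le: "\<And>z w. (norm (k z w))\<^sup>2 \<le> c * \<rho> * \<psi> (of_real (sqrt \<rho>) * (z - w))"
    and supp: "\<And>z w. z \<notin> B \<Longrightarrow> w \<notin> B \<Longrightarrow> k z w = 0"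
  shows "plane.hsb k (sqrt (2 * measure lborel B * (c * (LINT u|lborel. \<psi> u))))"
proof -
  let ?\<eta> = "\<lambda>v. ennreal (c * \<rho> * \<psi> (of_real (sqrt \<rho>) * v))"
  note [measurable] = \<psi>(1) B(1)
  have nn: "0 \<le> 2 * measure lborel B * (c * (LINT u|lborel. \<psi> u))"
    using c \<psi>(3) by (auto intro!: mult_nonneg_nonneg integral_nonneg_AE)
  have "(\<integral>\<^sup>+x. ennreal ((norm (k (fst x) (snd x)))\<^sup>2) \<partial>(lborel \<Otimes>\<^sub>M lborel)) \<le>
     (\<integral>\<^sup>+x. (indicator B (fst x) + indicator B (snd x)) * ?\<eta> (fst x - snd x) \<partial>(lborel \<Otimes>\<^sub>M lborel))"
  proof (intro nn_integral_mono)
    fix x :: "complex \<times> complex"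
    show "ennreal ((norm (k (fst x) (snd x)))\<^sup>2) \<le> (indicator B (fst x) + indicator B (snd x)) * ?\<eta> (fst x - snd x)"
    proof (cases "fst x \<in> B \<or> snd x \<in> B")
      case True
      have "ennreal ((norm (k (fst x) (snd x)))\<^sup>2) \<le> 1 * ?\<eta> (fst x - snd x)"
        using le[of "fst x" "snd x"] by (simp add: ennreal_leI)
      also have "\<dots> \<le> (indicator B (fst x) + indicator B (snd x)) * ?\<eta> (fst x - snd x)"
        using True by (intro mult_right_mono) (auto simp: indicator_def)
      finally show ?thesis .
    qed (use supp in simp)
  qed
  also have "\<dots> = 2 * emeasure lborel B * (\<integral>\<^sup>+v. ?\<eta> v \<partial>lborel)"
    by (rule nn_integral_convolution_ball) measurable
  also have "\<dots> = 2 * ennreal (measure lborel B) * ennreal (c * (LINT u|lborel. \<psi> u))"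
    using B by (simp add: nn_integral_dilate[OF \<psi> \<rho> c] emeasure_eq_ennreal_measure less_top)
  also have "\<dots> = ennreal (2 * measure lborel B * (c * (LINT u|lborel. \<psi> u)))"
    by (metis ennreal_mult' ennreal_numeral mult_nonneg_nonneg measure_nonneg zero_le_numeral)
  finally show ?thesis unfolding plane.hsb_def using k nn by simp
qed

text \<open>Each factor |z - w| from the Lipschitz bound is worth 1 / sqrt \<rho> after dilation.
  Two of them compensate the row integral of the squared kernel, of order \<rho>, so
  \<open>A\<close> stays bounded; a third one makes the square of \<open>E\<close> of order 1 / sqrt
  \<rho>.\<close>

lemma projection_estimate_dilated:
  fixes g :: "complex \<Rightarrow> real"
  assumes \<rho>: "\<rho> > 0" and g[measurable]: "g \<in> borel_measurable borel" and gb: "\<And>x. \<bar>g x\<bar> \<le> 1 / 2"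
    and lip: "\<And>z w. \<bar>g z - g w\<bar> \<le> \<Lambda> * norm (z - w)"
    and B: "B \<in> sets borel" "emeasure lborel B < \<infinity>" and supp: "\<And>x. x \<notin> B \<Longrightarrow> g x = 0"
  shows "projection_estimate lborel (dilated_kernel \<rho> K) g (1 / 2)
     (sqrt (2 * measure lborel B * (\<Lambda>\<^sup>2 * moment2))) (sqrt (2 * measure lborel B * (\<Lambda> ^ 3 / sqrt \<rho> * moment3)))
     (\<Lambda> / sqrt \<rho> * moment1)"
proof -
  interpret P: projection_kernel lborel "dilated_kernel \<rho> K" by (rule projection_dilated[OF \<rho>])
  have \<Lambda>: "\<Lambda> \<ge> 0" using lip[of 1 0] abs_ge_zero[of "g 1 - g 0"] by simp
  have gi: "integrable lborel g"
  proof (rule Bochner_Integration.integrable_bound[of _ "\<lambda>x. indicator B x :: real"])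
    show "integrable lborel (\<lambda>x. indicator B x :: real)" using B by simp
    show "AE x in lborel. norm (g x) \<le> norm (indicator B x :: real)"
    proof (intro AE_I2)
      fix x show "norm (g x) \<le> norm (indicator B x :: real)"
        using gb[of x] supp[of x] by (cases "x \<in> B") auto
    qed
  qed simp
  interpret S: projection_symbol lborel "dilated_kernel \<rho> K" g "1 / 2"
    by standard (use gi gb in auto)
  note K_meas[measurable (raw)] = plane.schur_measurable'[OF P.schur_K]
  have nK: "norm (dilated_kernel \<rho> K z w) = \<rho> * \<phi> (of_real (sqrt \<rho>) * (z - w))" for z w by (rule norm_dilated[OF \<rho>])
  have nd: "norm (S.G z - S.G w) = \<bar>g z - g w\<bar>" for z w unfolding S.G_def by (simp flip: of_real_diff)
  have ns: "norm (of_real (sqrt \<rho>) * v) = sqrt \<rho> * norm v" for v :: complex using \<rho> by (simp add: norm_mult)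
  have sr: "sqrt \<rho> * sqrt \<rho> = \<rho>" "sqrt \<rho> > 0" using \<rho> by auto
  have "plane.hsb S.D (sqrt (2 * measure lborel B * (\<Lambda>\<^sup>2 * (LINT u|lborel. (norm u)\<^sup>2 * (\<phi> u)\<^sup>2))))"
  proof (rule dilated_bound[OF \<rho> _ B])
    show "case_prod S.D \<in> borel_measurable (lborel \<Otimes>\<^sub>M lborel)" by (rule plane.schur_measurable[OF S.schur_D])
    fix z w
    have "(norm (S.D z w))\<^sup>2 = (g z - g w)\<^sup>2 * (\<rho> * \<phi> (of_real (sqrt \<rho>) * (z - w)))\<^sup>2"
      unfolding P.commutator_def norm_mult power_mult_distrib nd nK by simp
    also have "\<dots> \<le> (\<Lambda> * norm (z - w))\<^sup>2 * (\<rho> * \<phi> (of_real (sqrt \<rho>) * (z - w)))\<^sup>2"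
      using power_mono[OF lip[of z w] abs_ge_zero, of 2] by (intro mult_right_mono) auto
    also have "\<dots> = \<Lambda>\<^sup>2 * \<rho> * ((norm (of_real (sqrt \<rho>) * (z - w)))\<^sup>2 * (\<phi> (of_real (sqrt \<rho>) * (z - w)))\<^sup>2)"
      unfolding ns power_mult_distrib using \<rho> by (simp add: power2_eq_square mult_ac)
    finally show "(norm (S.D z w))\<^sup>2 \<le> \<Lambda>\<^sup>2 * \<rho> * ((norm (of_real (sqrt \<rho>) * (z - w)))\<^sup>2 * (\<phi> (of_real (sqrt \<rho>) * (z - w)))\<^sup>2)" .
    show "z \<notin> B \<Longrightarrow> w \<notin> B \<Longrightarrow> S.D z w = 0" by (simp add: P.commutator_def S.G_def supp)
  qed (use moments_integrable \<phi>_nonneg in auto)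
  moreover have "plane.hsb (\<lambda>z w. (S.G z - S.G w)\<^sup>2 * dilated_kernel \<rho> K z w)
     (sqrt (2 * measure lborel B * (\<Lambda> ^ 3 / sqrt \<rho> * (LINT u|lborel. norm u ^ 3 * (\<phi> u)\<^sup>2))))"
  proof (rule dilated_bound[OF \<rho> _ B])
    have [measurable]: "S.G \<in> borel_measurable borel" unfolding S.G_def[abs_def] by measurable
    have "case_prod (\<lambda>z w. (S.G z - S.G w)\<^sup>2 * dilated_kernel \<rho> K z w) =
      (\<lambda>x. (S.G (fst x) - S.G (snd x))\<^sup>2 * dilated_kernel \<rho> K (fst x) (snd x))" by auto
    then show "case_prod (\<lambda>z w. (S.G z - S.G w)\<^sup>2 * dilated_kernel \<rho> K z w) \<in> borel_measurable (lborel \<Otimes>\<^sub>M lborel)"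
      by simp
    show "0 \<le> \<Lambda> ^ 3 / sqrt \<rho>" using \<Lambda> sr by simp
    fix z w
    let ?d = "\<bar>g z - g w\<bar>"
    \<comment> \<open>This lowers the fourth power of the difference to a cube, so that the third
      moment suffices.\<close>
    have d1: "?d \<le> 1" using gb[of z] gb[of w] by linarith
    have "(norm ((S.G z - S.G w)\<^sup>2 * dilated_kernel \<rho> K z w))\<^sup>2 = ?d ^ 4 * (\<rho> * \<phi> (of_real (sqrt \<rho>) * (z - w)))\<^sup>2"
      unfolding norm_mult norm_power power_mult_distrib nd nK by (simp add: power_mult[symmetric])
    also have "\<dots> \<le> (\<Lambda> * norm (z - w)) ^ 3 * (\<rho> * \<phi> (of_real (sqrt \<rho>) * (z - w)))\<^sup>2"
    proof (rule mult_right_mono)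
      have "?d ^ 4 = ?d ^ 3 * ?d" by (simp add: power_Suc2[symmetric])
      also have "\<dots> \<le> ?d ^ 3 * 1" using d1 by (intro mult_left_mono) auto
      also have "\<dots> \<le> (\<Lambda> * norm (z - w)) ^ 3" using power_mono[OF lip[of z w] abs_ge_zero, of 3] by simp
      finally show "?d ^ 4 \<le> (\<Lambda> * norm (z - w)) ^ 3" .
    qed simp
    also have "\<dots> = \<Lambda> ^ 3 / sqrt \<rho> * \<rho> * (norm (of_real (sqrt \<rho>) * (z - w)) ^ 3 * (\<phi> (of_real (sqrt \<rho>) * (z - w)))\<^sup>2)"
    proof -
      have "\<rho>\<^sup>2 = 1 / sqrt \<rho> * \<rho> * sqrt \<rho> ^ 3"
        using sr by (simp add: power3_eq_cube power2_eq_square)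
      then show ?thesis unfolding ns power_mult_distrib by (simp add: mult_ac)
    qed
    finally show "(norm ((S.G z - S.G w)\<^sup>2 * dilated_kernel \<rho> K z w))\<^sup>2 \<le>
       \<Lambda> ^ 3 / sqrt \<rho> * \<rho> * (norm (of_real (sqrt \<rho>) * (z - w)) ^ 3 * (\<phi> (of_real (sqrt \<rho>) * (z - w)))\<^sup>2)" .
    show "z \<notin> B \<Longrightarrow> w \<notin> B \<Longrightarrow> (S.G z - S.G w)\<^sup>2 * dilated_kernel \<rho> K z w = 0" by (simp add: S.G_def supp)
  qed (use moments_integrable \<phi>_nonneg in auto)
  moreover have "(\<integral>\<^sup>+w. ennreal (norm (S.D z w)) \<partial>lborel) \<le> ennreal (\<Lambda> / sqrt \<rho> * moment1)" for z
  proof -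
    let ?\<psi> = "\<lambda>u. norm u * \<phi> u"
    have "(\<integral>\<^sup>+w. ennreal (norm (S.D z w)) \<partial>lborel) \<le> (\<integral>\<^sup>+w. ennreal (\<Lambda> / sqrt \<rho> * \<rho> * ?\<psi> (of_real (sqrt \<rho>) * (z - w))) \<partial>lborel)"
    proof (intro nn_integral_mono ennreal_leI)
      fix w
      have "norm (S.D z w) \<le> \<Lambda> * norm (z - w) * (\<rho> * \<phi> (of_real (sqrt \<rho>) * (z - w)))"
        unfolding P.commutator_def norm_mult nd nK using lip[of z w] \<rho> \<phi>_nonneg by (intro mult_right_mono) auto
      also have "\<dots> = \<Lambda> / sqrt \<rho> * \<rho> * ?\<psi> (of_real (sqrt \<rho>) * (z - w))"
        unfolding ns using sr by simp
      finally show "norm (S.D z w) \<le> \<Lambda> / sqrt \<rho> * \<rho> * ?\<psi> (of_real (sqrt \<rho>) * (z - w))" .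
    qed
    also have "\<dots> = (\<integral>\<^sup>+v. ennreal (\<Lambda> / sqrt \<rho> * \<rho> * ?\<psi> (of_real (sqrt \<rho>) * v)) \<partial>lborel)"
      by (rule nn_integral_lborel_reflect(1)[of "\<lambda>v. ennreal (\<Lambda> / sqrt \<rho> * \<rho> * ?\<psi> (of_real (sqrt \<rho>) * v))"]) measurable
    also have "\<dots> = ennreal (\<Lambda> / sqrt \<rho> * moment1)"
      unfolding moment1_def by (rule nn_integral_dilate) (use moments_integrable \<phi>_nonneg \<rho> \<Lambda> in auto)
    finally show ?thesis .
  qed
  ultimately show ?thesis
    using \<Lambda> sr moments_nonneg
    by (unfold_locales) (auto simp: moment2_def moment3_def)
qed

end

text \<open>Uses exp (1 / 3) \<le> 1 + 1 / 3 + 1 / 9 < 3 / 2. With b = 0 it yields |exp a - 1| \<le>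
  1 / 2, the bound on the symbol used later.\<close>

lemma abs_exp_diff_le:
  fixes a b :: real
  assumes "\<bar>a\<bar> \<le> 1 / 3" "\<bar>b\<bar> \<le> 1 / 3" shows "\<bar>exp a - exp b\<bar> \<le> 3 / 2 * \<bar>a - b\<bar>"
proof -
  have third: "exp x \<le> 3 / 2" if "\<bar>x\<bar> \<le> 1 / 3" for x :: real
  proof -
    have "exp x \<le> exp (1 / 3)" using that by simp
    also have "\<dots> \<le> 1 + 1 / 3 + (1 / 3)\<^sup>2" by (rule exp_bound) auto
    finally show ?thesis by (simp add: power2_eq_square)
  qed
  have le: "exp a - exp b \<le> 3 / 2 * (a - b)" if "b \<le> a" "\<bar>a\<bar> \<le> 1 / 3" for a b :: real
  proof -
    have "exp a - exp b = exp a * (1 - exp (b - a))" by (simp add: exp_diff field_simps)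
    also have "\<dots> \<le> exp a * (a - b)" proof (rule mult_left_mono)
      show "1 - exp (b - a) \<le> a - b" using exp_ge_add_one_self[of "b - a"] by linarith
    qed simp
    also have "\<dots> \<le> 3 / 2 * (a - b)" using third[OF that(2)] that(1) by (intro mult_right_mono) auto
    finally show ?thesis .
  qed
  show ?thesis
    using le[of b a] le[of a b] assms by (cases "b \<le> a") (auto simp: abs_if)
qed

text \<open>\<open>determinantal_process\<close> speaks of n \<ge> 1, while the expansion of the
  Laplace functional begins with n = 0.\<close>

lemma correlation_function_0:
  assumes "prob_space N" shows "correlation_function N X 0 (\<lambda>_. 1)"
proof -
  interpret prob_space N by fact
  show ?thesis
    unfolding correlation_function_def
    by (auto simp: PiM_empty nn_integral_count_space_finite emeasure_space_1)
qed

section \<open>The Laplace functional as a Fredholm series\<close>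

context stationary_kernel begin

definition energy :: "real \<Rightarrow> (complex \<Rightarrow> real) \<Rightarrow> real" where
  "energy \<rho> g = (LINT x|(lborel \<Otimes>\<^sub>M lborel). ((g (fst x) - g (snd x)) / (1 + g (fst x)))\<^sup>2 *
     (norm (dilated_kernel \<rho> K (fst x) (snd x)))\<^sup>2)"

text \<open>\<open>fredholm_exp\<close> with half the indicator of \<open>B\<close> as symbol
  provides the summable majorant; the commutator estimates, which ask for a Lipschitz symbol, play
  no part here. Coinciding points give equal rows, hence a vanishing determinant.\<close>

lemma correlated_process_dilated:
  assumes \<rho>: "\<rho> > 0" and X: "determinantal_process N X (dilated_kernel \<rho> K)"
    and B: "bounded B" "B \<in> sets borel"
  shows "correlated_process N X (\<lambda>n x. Re (Determinant.det (mat n n (\<lambda>(k, j). dilated_kernel \<rho> K (x k) (x j))))) B (1 / 2)"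
    and "of_real (Re (Determinant.det (mat n n (\<lambda>(k, j). dilated_kernel \<rho> K (x k) (x j))))) =
      Determinant.det (mat n n (\<lambda>(k, j). dilated_kernel \<rho> K (x k) (x j)))"
proof -
  let ?K = "dilated_kernel \<rho> K"
  let ?d = "\<lambda>n x. Determinant.det (mat n n (\<lambda>(k, j). ?K (x k) (x j)))"
  let ?r = "\<lambda>n x. Re (?d n x)"
  have corr: "\<exists>r. correlation_function N X n r \<and> (\<forall>x. of_real (r x) = ?d n x)" for n
  proof (cases n)
    case 0
    have "prob_space N" using X by (simp add: determinantal_process_def simple_point_process_def point_process_def)
    then show ?thesis using correlation_function_0[of N X] 0 by (intro exI[of _ "\<lambda>_. 1"]) simp
  qed (use X in \<open>auto simp: determinantal_process_def\<close>)
  have rd: "of_real (?r n x) = ?d n x" for n x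
    using corr[of n] by (metis Re_complex_of_real)
  show "of_real (?r n x) = ?d n x" by (rule rd)
  interpret P: projection_kernel lborel ?K by (rule projection_dilated[OF \<rho>])
  let ?g = "\<lambda>x. 1 / 2 * indicator B x :: real"
  have fin: "emeasure lborel B < \<infinity>" using emeasure_bounded_finite[OF B(1)] .
  interpret S: projection_symbol lborel ?K ?g "1 / 2"
  proof
    show "integrable lborel ?g"
      by (intro integrable_mult_right integrable_real_indicator) (use B fin in simp_all)
    show "\<bar>?g x\<bar> \<le> 1 / 2" for x by (simp add: indicator_def)
  qed simp
  have int_eq: "(\<Prod>i<n. S.G (x i)) * ?d n x = of_real ((1 / 2) ^ n * ((\<Prod>j<n. indicator B (x j)) * ?r n x))" for n x
  proof -
    have "(\<Prod>i<n. S.G (x i)) = of_real ((1 / 2) ^ n * (\<Prod>j<n. indicator B (x j)))"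
      unfolding S.G_def of_real_prod[symmetric] prod.distrib by simp
    then show ?thesis by (simp only: of_real_mult rd mult.assoc)
  qed
  have int: "integrable (PL n) (\<lambda>x. (1 / 2) ^ n * ((\<Prod>j<n. indicator B (x j)) * ?r n x))" for n
  proof -
    have "integrable (PL n) (\<lambda>x. complex_of_real ((1 / 2) ^ n * ((\<Prod>j<n. indicator B (x j)) * ?r n x)))"
      by (rule back_subst[of "integrable (PL n)", OF S.integrable_det[of n] ext[OF int_eq]])
    then show ?thesis by (simp only: complex_of_real_integrable_eq)
  qed
  have coeff: "S.fredholm_coeff n = of_real ((1 / 2) ^ n / fact n * (LINT x|PL n. (\<Prod>j<n. indicator B (x j)) * ?r n x))" for n
  proof -
    have "S.fredholm_det n = (LINT x|PL n. complex_of_real ((1 / 2) ^ n * ((\<Prod>j<n. indicator B (x j)) * ?r n x)))"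
      unfolding S.fredholm_det_def by (intro Bochner_Integration.integral_cong refl int_eq)
    also have "\<dots> = of_real ((1 / 2) ^ n * (LINT x|PL n. (\<Prod>j<n. indicator B (x j)) * ?r n x))"
      by (simp only: integral_complex_of_real integral_mult_right_zero)
    finally show ?thesis unfolding S.fredholm_coeff_def by simp
  qed
  show "correlated_process N X ?r B (1 / 2)"
  proof
    show "simple_point_process N X" using X by (simp add: determinantal_process_def)
    show "correlation_function N X n (?r n)" for n
    proof -
      obtain r where r: "correlation_function N X n r" "\<And>x. of_real (r x) = ?d n x" using corr[of n] by auto
      have "r = ?r n" using r(2) by (metis Re_complex_of_real)
      then show ?thesis using r(1) by simp
    qed
    show "?r n x = 0" if ninj: "\<not> inj_on x {..<n}" for n and x :: "nat \<Rightarrow> complex"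
    proof -
      obtain i j where ij: "i < n" "j < n" "i \<noteq> j" "x i = x j" using ninj by (auto simp: inj_on_def)
      have "?d n x = 0"
        by (rule det_identical_rows[OF mat_carrier ij(3,1,2)]) (use ij in \<open>auto simp: row_def\<close>)
      then show ?thesis by simp
    qed
    show "integrable (PL n) (\<lambda>x. (\<Prod>j<n. indicator B (x j)) * ?r n x)" for n
      using integrable_mult_right[OF int[of n], of "2 ^ n"] by (simp add: power_divide)
    have "summable (\<lambda>n. norm (S.fredholm_coeff n))"
      by (rule S.fredholm_exp(1)[of "\<rho> * \<phi> 0"]) (use \<rho> \<phi>_nonneg[of 0] in \<open>auto simp: dilated_diag norm_mult\<close>)
    then have "summable (\<lambda>n. norm ((1 / 2) ^ n / fact n * (LINT x|PL n. (\<Prod>j<n. indicator B (x j)) * ?r n x)))"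
      unfolding coeff norm_of_real real_norm_def .
    then show "summable (\<lambda>n. (1 / 2) ^ n / fact n * (LINT x|PL n. (\<Prod>j<n. indicator B (x j)) * ?r n x))"
      by (rule summable_norm_cancel)
  qed (use B in auto)
qed

text \<open>With g = exp (t f) - 1 the exponential of the statistic is the product of 1 + g over the
  points, so its expectation is the sum of the Fredholm coefficients. The logarithm \<open>l\<close>
  is complex because that sum is computed over the complex numbers.\<close>

theorem laplace_functional_estimate:
  fixes f :: "complex \<Rightarrow> real" and t :: real
  assumes \<rho>: "\<rho> > 0" and X: "determinantal_process N X (dilated_kernel \<rho> K)"
    and B: "bounded B" "B \<in> sets borel" and f: "continuous_on UNIV f" "\<And>x. x \<notin> B \<Longrightarrow> f x = 0"
    and lip: "\<And>z w. \<bar>f z - f w\<bar> \<le> L * norm (z - w)" and t: "\<And>x. \<bar>t * f x\<bar> \<le> 1 / 3"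
  defines "\<Lambda> \<equiv> 3 / 2 * (\<bar>t\<bar> * L)"
  defines "A \<equiv> sqrt (2 * measure lborel B * (\<Lambda>\<^sup>2 * moment2))"
  defines "E \<equiv> sqrt (2 * measure lborel B * (\<Lambda> ^ 3 / sqrt \<rho> * moment3))"
  shows "integrable N (\<lambda>s. exp (t * linear_statistic f (X s)))"
    and "\<exists>l :: complex. of_real (LINT s|N. exp (t * linear_statistic f (X s))) = exp l \<and>
      norm (l - of_real (t * (\<rho> * limit_mean \<phi> f)) - of_real (energy \<rho> (\<lambda>x. exp (t * f x) - 1)) / 4)
       \<le> series_constant (1 / 2) * (2 * A * E + \<Lambda> / sqrt \<rho> * moment1 * A\<^sup>2)"
proof -
  let ?K = "dilated_kernel \<rho> K"
  let ?g = "\<lambda>x. exp (t * f x) - 1"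
  have [measurable]: "f \<in> borel_measurable borel" using f(1) by (rule borel_measurable_continuous_onI)
  have g0: "?g x = 0" if "x \<notin> B" for x using f(2)[OF that] by simp
  have glip: "\<bar>?g z - ?g w\<bar> \<le> \<Lambda> * norm (z - w)" for z w
  proof -
    have "\<bar>?g z - ?g w\<bar> \<le> 3 / 2 * \<bar>t * f z - t * f w\<bar>" using abs_exp_diff_le[OF t[of z] t[of w]] by simp
    also have "\<bar>t * f z - t * f w\<bar> = \<bar>t\<bar> * \<bar>f z - f w\<bar>" by (simp add: abs_mult flip: right_diff_distrib)
    also have "3 / 2 * (\<bar>t\<bar> * \<bar>f z - f w\<bar>) \<le> 3 / 2 * (\<bar>t\<bar> * (L * norm (z - w)))"
      by (intro mult_left_mono lip) auto
    finally show ?thesis by (simp add: \<Lambda>_def mult.assoc)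
  qed
  have gb: "\<bar>?g x\<bar> \<le> 1 / 2" for x
    using abs_exp_diff_le[OF t[of x], of 0] t[of x] by simp
  have gc: "continuous_on UNIV ?g" by (intro continuous_intros f)
  have fin: "emeasure lborel B < \<infinity>" using emeasure_bounded_finite[OF B(1)] .
  interpret S: projection_estimate lborel ?K ?g "1 / 2" A E "\<Lambda> / sqrt \<rho> * moment1"
    unfolding A_def E_def by (rule projection_estimate_dilated[OF \<rho> _ gb glip B(2) fin g0]) auto
  interpret C: correlated_process N X "\<lambda>n x. Re (Determinant.det (mat n n (\<lambda>(k, j). ?K (x k) (x j))))" B "1 / 2"
    by (rule correlated_process_dilated(1)[OF \<rho> X B])
  let ?Y = "\<lambda>s. exp (t * linear_statistic f (X s))"
  have [measurable]: "(\<lambda>s. linear_statistic f (X s)) \<in> borel_measurable N"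
    by (rule linear_statistic_measurable[OF C.pp f(1) B f(2)])
  have Y: "?Y \<in> borel_measurable N" by measurable
  have Yeq: "AE s in N. ?Y s = (\<Prod>x\<in>points (X s) \<inter> B. 1 + ?g x)"
  proof (intro AE_I2)
    fix s assume s: "s \<in> space N"
    have "linear_statistic f (X s) = (\<Sum>x\<in>points (X s) \<inter> B. f x)"
      by (rule linear_statistic_eq_sum[OF C.pm[OF s] B(1)]) (rule f(2))
    then show "?Y s = (\<Prod>x\<in>points (X s) \<inter> B. 1 + ?g x)"
      using finite_points[OF C.pm[OF s] B(1)] by (simp add: sum_distrib_left exp_sum)
  qed
  show "integrable N ?Y" by (rule C.expectation_prod_points(1)[OF gb gc Y Yeq])
  have EY: "(LINT s|N. ?Y s) = (\<Sum>n. C.limit_term ?g n)" by (rule C.expectation_prod_points(2)[OF gb gc Y Yeq])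
  have coeff: "S.fredholm_coeff n = of_real (C.limit_term ?g n)" for n
  proof -
    have "(\<Prod>i<n. S.G (x i)) * Determinant.det (mat n n (\<lambda>(k, l). ?K (x k) (x l))) =
       of_real ((\<Prod>j<n. ?g (x j) * indicator B (x j)) * Re (Determinant.det (mat n n (\<lambda>(k, j). ?K (x k) (x j)))))" for x
    proof -
      have "?g y * indicator B y = ?g y" for y using g0[of y] by (cases "y \<in> B") auto
      then show ?thesis
        unfolding S.G_def of_real_mult correlated_process_dilated(2)[OF \<rho> X B] by (simp only: of_real_prod)
    qed
    then show ?thesis
    proof -
      assume e: "\<And>x. (\<Prod>i<n. S.G (x i)) * Determinant.det (mat n n (\<lambda>(k, l). ?K (x k) (x l))) =
       of_real ((\<Prod>j<n. ?g (x j) * indicator B (x j)) * Re (Determinant.det (mat n n (\<lambda>(k, j). ?K (x k) (x j)))))"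
      have "S.fredholm_det n = (LINT x|PL n. complex_of_real ((\<Prod>j<n. ?g (x j) * indicator B (x j)) * Re (Determinant.det (mat n n (\<lambda>(k, j). ?K (x k) (x j))))))"
        unfolding S.fredholm_det_def by (intro Bochner_Integration.integral_cong refl e)
      then show ?thesis unfolding S.fredholm_coeff_def C.limit_term_def by (simp only: integral_complex_of_real of_real_divide of_real_fact)
    qed
  qed
  have \<kappa>: "norm (?K x x) \<le> \<rho> * \<phi> 0" for x
    unfolding dilated_diag norm_of_real using \<rho> \<phi>_nonneg[of 0] by simp
  have q1: "(1 / 2 :: real) < 1" by simp
  have sum: "summable (\<lambda>n. norm (S.fredholm_coeff n))" by (rule S.fredholm_exp(1)[OF q1 \<kappa>])
  then have "summable (\<lambda>n. norm (C.limit_term ?g n))" unfolding coeff norm_of_real real_norm_def .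
  then have sl: "summable (C.limit_term ?g)" by (rule summable_norm_cancel)
  have sumeq: "of_real (LINT s|N. ?Y s) = suminf S.fredholm_coeff"
    unfolding EY coeff[abs_def] using suminf_of_real[OF sl, where 'a = complex] by simp
  obtain l where l: "suminf S.fredholm_coeff = exp l"
    "norm (l - (LINT x|lborel. of_real (ln (1 + ?g x)) * ?K x x) - of_real (energy \<rho> ?g) / 4)
      \<le> series_constant (1 / 2) * (2 * A * E + \<Lambda> / sqrt \<rho> * moment1 * A\<^sup>2)"
    using S.fredholm_log_estimate[OF q1 \<kappa>] unfolding energy_def by blast
  \<comment> \<open>Since ln (1 + g) = t f, the term of order \<rho> is exactly linear in t and is
    removed entirely by centring.\<close>
  have "(LINT x|lborel. of_real (ln (1 + ?g x)) * ?K x x) = of_real (t * (\<rho> * limit_mean \<phi> f))"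
  proof -
    have "(LINT x|lborel. of_real (ln (1 + ?g x)) * ?K x x) = (LINT x|lborel. complex_of_real ((t * \<rho> * \<phi> 0) * f x))"
      by (intro Bochner_Integration.integral_cong refl) (simp add: dilated_diag)
    also have "\<dots> = of_real ((t * \<rho> * \<phi> 0) * (LINT x|lborel. f x))"
      unfolding integral_complex_of_real by simp
    finally show ?thesis by (simp add: limit_mean_def mult_ac)
  qed
  then have l2: "norm (l - of_real (t * (\<rho> * limit_mean \<phi> f)) - of_real (energy \<rho> ?g) / 4)
      \<le> series_constant (1 / 2) * (2 * A * E + \<Lambda> / sqrt \<rho> * moment1 * A\<^sup>2)"
    using l(2) by (simp only:)
  show "\<exists>l :: complex. of_real (LINT s|N. ?Y s) = exp l \<and>
      norm (l - of_real (t * (\<rho> * limit_mean \<phi> f)) - of_real (energy \<rho> ?g) / 4)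
       \<le> series_constant (1 / 2) * (2 * A * E + \<Lambda> / sqrt \<rho> * moment1 * A\<^sup>2)"
    by (rule exI[of _ l], rule conjI[OF trans[OF sumeq l(1)] l2])
qed

end

section \<open>Limit of the energy\<close>

lemma C_k_imp_continuous: "C_k n f \<Longrightarrow> continuous_on UNIV f"
  by (cases n) (auto simp: continuous_at_imp_continuous_on differentiable_imp_continuous_within)

section \<open>Smooth compactly supported test functions\<close>

locale test_function =
  fixes f :: "complex \<Rightarrow> real"
  assumes smooth: "C_k 3 f" and support: "compactly_supported f"
begin

lemma f_differentiable: "f differentiable (at z)" and C_2_partial: "b \<in> Basis \<Longrightarrow> C_k 2 (\<lambda>z. frechet_derivative f (at z) b)"
  using smooth by (auto simp: numeral_3_eq_3 numeral_2_eq_2)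

lemma f_continuous: "continuous_on UNIV f" by (rule C_k_imp_continuous[OF smooth])

lemma f_measurable[measurable]: "f \<in> borel_measurable borel"
  using f_continuous by (rule borel_measurable_continuous_onI)

lemma f_has_derivative: "(f has_derivative (\<lambda>h. inner (gradient f z) h)) (at z)"
proof -
  let ?D = "frechet_derivative f (at z)"
  have D: "(f has_derivative ?D) (at z)" using f_differentiable by (simp add: frechet_derivative_works)
  then have l: "linear ?D" by (rule has_derivative_linear)
  have "?D h = inner (gradient f z) h" for h
  proof -
    have "h = Re h *\<^sub>R 1 + Im h *\<^sub>R \<i>" by (simp add: complex_eq_iff)
    then have "?D h = Re h * ?D 1 + Im h * ?D \<i>"
      using linear_add[OF l] linear_scale[OF l] by (metis real_scaleR_def)
    then show ?thesis by (simp add: gradient_def inner_complex_def mult.commute)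
  qed
  then show ?thesis using D by presburger
qed

lemma gradient_continuous: "continuous_on UNIV (gradient f)"
proof -
  have "continuous_on UNIV (\<lambda>z. frechet_derivative f (at z) b)" if "b \<in> Basis" for b
    by (rule C_k_imp_continuous[OF C_2_partial[OF that]])
  then have "continuous_on UNIV (\<lambda>z. frechet_derivative f (at z) 1)" "continuous_on UNIV (\<lambda>z. frechet_derivative f (at z) \<i>)"
    by (auto simp: Basis_complex_def)
  then show ?thesis unfolding gradient_def[abs_def] Complex_eq by (intro continuous_intros)
qed

lemma gradient_measurable[measurable]: "gradient f \<in> borel_measurable borel"
  using gradient_continuous by (rule borel_measurable_continuous_onI)

definition S :: "complex set" where "S = closure {x. f x \<noteq> 0}"

lemma S_compact: "compact S" using support by (simp add: compactly_supported_def S_def)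

lemma f_eq_0: "x \<notin> S \<Longrightarrow> f x = 0"
  using closure_subset[of "{x. f x \<noteq> 0}"] by (auto simp: S_def)

lemma gradient_eq_0: assumes "x \<notin> S" shows "gradient f x = 0"
proof -
  have "((\<lambda>_. 0) has_derivative (\<lambda>_. 0)) (at x)" by simp
  then have "(f has_derivative (\<lambda>_. 0)) (at x)"
  proof (rule has_derivative_transform_within_open[where s = "- S"])
    show "open (- S)" using S_compact by (simp add: compact_imp_closed open_Compl)
  qed (use assms f_eq_0 in auto)
  then have "(\<lambda>h. inner (gradient f x) h) = (\<lambda>_. 0)" by (rule has_derivative_unique[OF f_has_derivative])
  then have "inner (gradient f x) (gradient f x) = 0" by (rule fun_cong)
  then show ?thesis by simp
qed

lemma bounds:
  obtains L F R where "L \<ge> 0" "F \<ge> 0" "R \<ge> 0" "\<And>x. norm (gradient f x) \<le> L" "\<And>x. \<bar>f x\<bar> \<le> F"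
    "\<And>x. x \<notin> cball 0 R \<Longrightarrow> f x = 0" "\<And>x. x \<notin> cball 0 R \<Longrightarrow> gradient f x = 0"
    "\<And>z w. \<bar>f z - f w\<bar> \<le> L * norm (z - w)"
proof -
  have "bounded (gradient f ` S)"
    by (intro compact_imp_bounded compact_continuous_image continuous_on_subset[OF gradient_continuous] S_compact) auto
  then obtain L where L: "L > 0" "\<And>x. x \<in> S \<Longrightarrow> norm (gradient f x) \<le> L" by (auto simp: bounded_pos)
  have L': "norm (gradient f x) \<le> L" for x
    using L gradient_eq_0[of x] by (cases "x \<in> S") auto
  have "bounded (f ` S)"
    by (intro compact_imp_bounded compact_continuous_image continuous_on_subset[OF f_continuous] S_compact) auto
  then obtain F where F: "F > 0" "\<And>x. x \<in> S \<Longrightarrow> norm (f x) \<le> F" by (auto simp: bounded_pos)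
  have F': "\<bar>f x\<bar> \<le> F" for x using F f_eq_0[of x] by (cases "x \<in> S") auto
  obtain R where R: "R > 0" "\<And>x. x \<in> S \<Longrightarrow> norm x \<le> R" using compact_imp_bounded[OF S_compact] by (auto simp: bounded_pos)
  have R': "x \<notin> S" if "x \<notin> cball 0 R" for x using R that by auto
  have lip: "\<bar>f z - f w\<bar> \<le> L * norm (z - w)" for z w
  proof -
    have "norm (f z - f w) \<le> L * norm (z - w)"
    proof (rule differentiable_bound[where S = UNIV and f' = "\<lambda>z h. inner (gradient f z) h"])
      show "onorm (\<lambda>h. inner (gradient f x) h) \<le> L" for x
      proof (rule onorm_le)
        show "norm (inner (gradient f x) h) \<le> L * norm h" for h
          using Cauchy_Schwarz_ineq2[of "gradient f x" h] mult_right_mono[OF L'[of x] norm_ge_zero[of h]] by simp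
      qed
    qed (use f_has_derivative in auto)
    then show ?thesis by simp
  qed
  show ?thesis
    by (rule that[of L F R]) (use L(1) F(1) R(1) L' F' lip f_eq_0 gradient_eq_0 R' in auto)
qed

text \<open>This is the derivative at s = 0; the sign from z - s u cancels the sign in front of the
  exponential.\<close>

lemma difference_quotient_tendsto:
  assumes s: "s \<longlonglongrightarrow> 0" "\<And>n. s n \<noteq> 0"
  shows "(\<lambda>n. (1 - exp (t * (f (z - s n *\<^sub>R u) - f z))) / s n) \<longlonglongrightarrow> t * inner (gradient f z) u"
proof -
  let ?\<psi> = "\<lambda>s. 1 - exp (t * (f (z - s *\<^sub>R u) - f z))"
  have lin: "((\<lambda>s. z - s *\<^sub>R u) has_derivative (\<lambda>s. - (s *\<^sub>R u))) (at 0)"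
    by (auto intro!: derivative_eq_intros)
  have "((\<lambda>s. f (z - s *\<^sub>R u)) has_derivative (\<lambda>s. inner (gradient f z) (- (s *\<^sub>R u)))) (at 0)"
    using has_derivative_compose[OF lin, of f "\<lambda>h. inner (gradient f z) h"] f_has_derivative by simp
  moreover have "(\<lambda>s. inner (gradient f z) (- (s *\<^sub>R u))) = (*) (- inner (gradient f z) u)"
    by (auto simp: fun_eq_iff)
  ultimately have d: "((\<lambda>s. f (z - s *\<^sub>R u)) has_real_derivative (- inner (gradient f z) u)) (at 0)"
    by (simp add: has_field_derivative_def)
  have "(?\<psi> has_real_derivative (t * inner (gradient f z) u)) (at 0)"
    by (rule derivative_eq_intros d refl | simp)+
  then have "((\<lambda>s. (?\<psi> s - ?\<psi> 0) / (s - 0)) \<longlongrightarrow> t * inner (gradient f z) u) (at 0)"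
    by (simp only: has_field_derivative_iff)
  moreover have "filterlim s (at 0) sequentially" using s by (auto simp: filterlim_at)
  ultimately have "(\<lambda>n. (?\<psi> (s n) - ?\<psi> 0) / (s n - 0)) \<longlonglongrightarrow> t * inner (gradient f z) u"
    by (rule filterlim_compose)
  then show ?thesis by simp
qed

end

section \<open>Convergence of the energy to the limiting variance\<close>

locale clt_setting = stationary_kernel K \<phi> + test_function f for K \<phi> f
begin

text \<open>Substitutes w = z - u / sqrt \<rho>. The Jacobian 1 / \<rho> against \<rho>^2 in the
  squared kernel leaves one factor \<rho>, which turns the difference into a difference quotient of
  step 1 / sqrt \<rho>. Tonelli then makes u the outer variable.\<close>

lemma energy_substitution:
  assumes \<rho>: "\<rho> > 0"
  shows "(\<integral>\<^sup>+x. ennreal ((((exp (t * f (fst x)) - 1) - (exp (t * f (snd x)) - 1)) / (1 + (exp (t * f (fst x)) - 1)))\<^sup>2 *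
      (norm (dilated_kernel \<rho> K (fst x) (snd x)))\<^sup>2) \<partial>(lborel \<Otimes>\<^sub>M lborel)) =
    (\<integral>\<^sup>+u. \<integral>\<^sup>+z. ennreal (((1 - exp (t * (f (z - (1 / sqrt \<rho>) *\<^sub>R u) - f z))) / (1 / sqrt \<rho>))\<^sup>2 * (\<phi> u)\<^sup>2) \<partial>lborel \<partial>lborel)"
proof -
  have sr: "sqrt \<rho> > 0" "sqrt \<rho> * sqrt \<rho> = \<rho>" using \<rho> by auto
  let ?H = "\<lambda>z v. ennreal ((1 - exp (t * (f (z - v) - f z)))\<^sup>2 * (\<rho> * \<phi> (of_real (sqrt \<rho>) * v))\<^sup>2)"
  have eq: "ennreal ((((exp (t * f (fst x)) - 1) - (exp (t * f (snd x)) - 1)) / (1 + (exp (t * f (fst x)) - 1)))\<^sup>2 *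
      (norm (dilated_kernel \<rho> K (fst x) (snd x)))\<^sup>2) = ?H (fst x) (fst x - snd x)" for x
  proof -
    have "((exp (t * f (fst x)) - 1) - (exp (t * f (snd x)) - 1)) / (1 + (exp (t * f (fst x)) - 1)) = 1 - exp (t * (f (fst x - (fst x - snd x)) - f (fst x)))"
      by (simp add: right_diff_distrib exp_diff diff_divide_distrib)
    then show ?thesis by (simp only: norm_dilated[OF \<rho>])
  qed
  have "(\<integral>\<^sup>+x. ?H (fst x) (fst x - snd x) \<partial>(lborel \<Otimes>\<^sub>M lborel)) = (\<integral>\<^sup>+z. \<integral>\<^sup>+w. ?H z (z - w) \<partial>lborel \<partial>lborel)"
    by (subst lborel.nn_integral_fst[symmetric]) simp_all
  also have "\<dots> = (\<integral>\<^sup>+z. \<integral>\<^sup>+v. ?H z v \<partial>lborel \<partial>lborel)"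
  proof (rule nn_integral_cong)
    fix z show "(\<integral>\<^sup>+w. ?H z (z - w) \<partial>lborel) = (\<integral>\<^sup>+v. ?H z v \<partial>lborel)"
      by (rule nn_integral_lborel_reflect(1)[of "?H z"]) measurable
  qed
  also have "\<dots> = (\<integral>\<^sup>+z. \<integral>\<^sup>+u. ennreal (((1 - exp (t * (f (z - (1 / sqrt \<rho>) *\<^sub>R u) - f z))) / (1 / sqrt \<rho>))\<^sup>2 * (\<phi> u)\<^sup>2) \<partial>lborel \<partial>lborel)"
  proof (rule nn_integral_cong)
    fix z
    have "(\<integral>\<^sup>+v. ?H z v \<partial>lborel) = ennreal ((1 / sqrt \<rho>)\<^sup>2) * (\<integral>\<^sup>+u. ?H z (0 + (1 / sqrt \<rho>) *\<^sub>R u) \<partial>lborel)"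
      by (rule nn_integral_lborel_affine) (use sr in auto)
    also have "\<dots> = (\<integral>\<^sup>+u. ennreal ((1 / sqrt \<rho>)\<^sup>2) * ?H z (0 + (1 / sqrt \<rho>) *\<^sub>R u) \<partial>lborel)"
      by (rule nn_integral_cmult[symmetric]) measurable
    also have "\<dots> = (\<integral>\<^sup>+u. ennreal (((1 - exp (t * (f (z - (1 / sqrt \<rho>) *\<^sub>R u) - f z))) / (1 / sqrt \<rho>))\<^sup>2 * (\<phi> u)\<^sup>2) \<partial>lborel)"
    proof (intro nn_integral_cong)
      fix u :: complex
      have "of_real (sqrt \<rho>) * (0 + (1 / sqrt \<rho>) *\<^sub>R u) = u" using sr by (simp add: scaleR_conv_of_real)
      moreover have "(1 / sqrt \<rho>)\<^sup>2 * (a\<^sup>2 * (\<rho> * b)\<^sup>2) = (a / (1 / sqrt \<rho>))\<^sup>2 * b\<^sup>2" for a b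
        using sr \<rho> by (simp add: power_divide power_mult_distrib) (simp add: power2_eq_square)
      ultimately show "ennreal ((1 / sqrt \<rho>)\<^sup>2) * ?H z (0 + (1 / sqrt \<rho>) *\<^sub>R u) =
         ennreal (((1 - exp (t * (f (z - (1 / sqrt \<rho>) *\<^sub>R u) - f z))) / (1 / sqrt \<rho>))\<^sup>2 * (\<phi> u)\<^sup>2)"
        by (subst ennreal_mult[symmetric]) (simp_all del: power_divide)
    qed
    finally show "(\<integral>\<^sup>+v. ?H z v \<partial>lborel) = (\<integral>\<^sup>+u. ennreal (((1 - exp (t * (f (z - (1 / sqrt \<rho>) *\<^sub>R u) - f z))) / (1 / sqrt \<rho>))\<^sup>2 * (\<phi> u)\<^sup>2) \<partial>lborel)" .
  qed
  also have "\<dots> = (\<integral>\<^sup>+u. \<integral>\<^sup>+z. ennreal (((1 - exp (t * (f (z - (1 / sqrt \<rho>) *\<^sub>R u) - f z))) / (1 / sqrt \<rho>))\<^sup>2 * (\<phi> u)\<^sup>2) \<partial>lborel \<partial>lborel)"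
    by (rule lborel_pair.Fubini') measurable
  finally show ?thesis by (simp only: eq)
qed

text \<open>The variance is built from Bochner integrals, which default to 0 when they diverge. The
  compact support of the gradient and the second moment rule this out, so they agree with the
  extended integrals.\<close>

lemma gradient_energy:
  "(\<integral>\<^sup>+u. \<integral>\<^sup>+z. ennreal ((t * inner (gradient f z) u)\<^sup>2 * (\<phi> u)\<^sup>2) \<partial>lborel \<partial>lborel) = ennreal (2 * t\<^sup>2 * limit_variance \<phi> f)"
  and limit_variance_nonneg: "limit_variance \<phi> f \<ge> 0"
proof -
  obtain L F R where b: "L \<ge> 0" "R \<ge> 0" "\<And>x. norm (gradient f x) \<le> L" "\<And>x. x \<notin> cball 0 R \<Longrightarrow> gradient f x = 0"
    using bounds by metis
  let ?B = "cball (0::complex) R"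
  let ?i = "\<lambda>u z. (inner (gradient f z) u)\<^sup>2 * (\<phi> u)\<^sup>2"
  let ?I = "\<lambda>u. LINT z|lborel. ?i u z"
  have finB: "emeasure lborel ?B < \<infinity>" by (rule emeasure_bounded_finite) simp
  have le: "?i u z \<le> indicator ?B z * (L\<^sup>2 * ((norm u)\<^sup>2 * (\<phi> u)\<^sup>2))" for u z
  proof (cases "z \<in> ?B")
    case True
    have "\<bar>inner (gradient f z) u\<bar> \<le> L * norm u"
      using Cauchy_Schwarz_ineq2[of "gradient f z" u] mult_right_mono[OF b(3)[of z] norm_ge_zero[of u]] by simp
    then have "(inner (gradient f z) u)\<^sup>2 \<le> (L * norm u)\<^sup>2" by (metis abs_ge_zero power2_abs power_mono)
    then show ?thesis using True mult_right_mono[of "(inner (gradient f z) u)\<^sup>2" "(L * norm u)\<^sup>2" "(\<phi> u)\<^sup>2"]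
      by (simp add: power_mult_distrib mult.assoc)
  qed (use b(4) in simp)
  have int: "integrable lborel (?i u)" for u
  proof (rule Bochner_Integration.integrable_bound)
    show "integrable lborel (\<lambda>z. indicator ?B z * (L\<^sup>2 * ((norm u)\<^sup>2 * (\<phi> u)\<^sup>2)))"
      by (intro integrable_mult_left integrable_real_indicator) (use finB in simp_all)
    show "AE z in lborel. norm (?i u z) \<le> norm (indicator ?B z * (L\<^sup>2 * ((norm u)\<^sup>2 * (\<phi> u)\<^sup>2)))"
      using le by (auto intro!: AE_I2 order_trans[OF le abs_ge_self])
  qed measurable
  have I0: "?I u \<ge> 0" for u by (intro integral_nonneg_AE AE_I2) auto
  have I_le: "?I u \<le> measure lborel ?B * (L\<^sup>2 * ((norm u)\<^sup>2 * (\<phi> u)\<^sup>2))" for u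
  proof -
    have "?I u \<le> (LINT z|lborel. indicator ?B z * (L\<^sup>2 * ((norm u)\<^sup>2 * (\<phi> u)\<^sup>2)))"
      by (intro integral_mono int le integrable_mult_left integrable_real_indicator) (use finB in simp_all)
    then show ?thesis by simp
  qed
  have intI: "integrable lborel ?I"
  proof (rule Bochner_Integration.integrable_bound)
    show "integrable lborel (\<lambda>u. measure lborel ?B * (L\<^sup>2 * ((norm u)\<^sup>2 * (\<phi> u)\<^sup>2)))"
      by (intro integrable_mult_right moments_integrable)
    show "AE u in lborel. norm (?I u) \<le> norm (measure lborel ?B * (L\<^sup>2 * ((norm u)\<^sup>2 * (\<phi> u)\<^sup>2)))"
      using I0 I_le by (auto intro!: AE_I2 order_trans[OF I_le abs_ge_self])
  qed measurable
  have lv: "limit_variance \<phi> f = 1 / 2 * (LINT u|lborel. ?I u)" by (simp add: limit_variance_def)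
  show "limit_variance \<phi> f \<ge> 0" unfolding lv using I0 by (auto intro!: integral_nonneg_AE)
  have inner: "(\<integral>\<^sup>+z. ennreal ((t * inner (gradient f z) u)\<^sup>2 * (\<phi> u)\<^sup>2) \<partial>lborel) = ennreal (t\<^sup>2 * ?I u)" for u
  proof -
    have "(t * inner (gradient f z) u)\<^sup>2 * (\<phi> u)\<^sup>2 = t\<^sup>2 * ?i u z" for z by (simp add: power_mult_distrib mult.assoc)
    then have "(\<integral>\<^sup>+z. ennreal ((t * inner (gradient f z) u)\<^sup>2 * (\<phi> u)\<^sup>2) \<partial>lborel) = (\<integral>\<^sup>+z. ennreal (t\<^sup>2 * ?i u z) \<partial>lborel)"
      by (simp only:)
    also have "\<dots> = ennreal (LINT z|lborel. t\<^sup>2 * ?i u z)"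
      by (intro nn_integral_eq_integral integrable_mult_right int) auto
    finally show ?thesis by simp
  qed
  have "(\<integral>\<^sup>+u. ennreal (t\<^sup>2 * ?I u) \<partial>lborel) = ennreal (LINT u|lborel. t\<^sup>2 * ?I u)"
    using I0 by (intro nn_integral_eq_integral integrable_mult_right intI) auto
  then show "(\<integral>\<^sup>+u. \<integral>\<^sup>+z. ennreal ((t * inner (gradient f z) u)\<^sup>2 * (\<phi> u)\<^sup>2) \<partial>lborel \<partial>lborel) = ennreal (2 * t\<^sup>2 * limit_variance \<phi> f)"
    unfolding inner lv by simp
qed

text \<open>Dominated convergence in z for fixed u, then in u. The majorant in z lives on a ball of
  radius R + |u|, whose area grows like |u|^2 and would demand a fourth moment in the second step.
  There, translation invariance bounds the area of the support by twice that of the ball of radius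
  R.\<close>

lemma energy_tendsto:
  assumes \<rho>: "\<And>n. \<rho> n \<ge> 1" "filterlim \<rho> at_top sequentially" and t: "\<And>x. \<bar>t * f x\<bar> \<le> 1 / 3"
  shows "(\<lambda>n. energy (\<rho> n) (\<lambda>x. exp (t * f x) - 1)) \<longlonglongrightarrow> 2 * t\<^sup>2 * limit_variance \<phi> f"
proof -
  obtain L F R where b: "L \<ge> 0" "R \<ge> 0" "\<And>x. x \<notin> cball 0 R \<Longrightarrow> f x = 0" "\<And>z w. \<bar>f z - f w\<bar> \<le> L * norm (z - w)"
    using bounds by metis
  let ?B = "cball (0::complex) R"
  define s where "s n = 1 / sqrt (\<rho> n)" for n
  have s0: "s n > 0" "s n \<le> 1" for n using \<rho>(1)[of n] by (auto simp: s_def)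
  have slim: "s \<longlonglongrightarrow> 0"
    unfolding s_def[abs_def] using filterlim_compose[OF sqrt_at_top \<rho>(2)] by (intro tendsto_divide_0[OF tendsto_const] filterlim_at_top_imp_at_infinity)
  define h where "h n u z = ((1 - exp (t * (f (z - s n *\<^sub>R u) - f z))) / s n)\<^sup>2 * (\<phi> u)\<^sup>2" for n u z
  \<comment> \<open>One factor 3 / 2 bounds exp (- t f z), the other is the Lipschitz constant from
    \<open>abs_exp_diff_le\<close>.\<close>
  define \<Gamma> where "\<Gamma> = 9 / 4 * (\<bar>t\<bar> * L)"
  have \<Gamma>: "\<Gamma> \<ge> 0" using b by (simp add: \<Gamma>_def)
  have h0: "h n u z \<ge> 0" for n u z by (simp add: h_def)
  have dq: "\<bar>(1 - exp (t * (f (z - s n *\<^sub>R u) - f z))) / s n\<bar> \<le> \<Gamma> * norm u" for n u z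
  proof -
    let ?w = "z - s n *\<^sub>R u"
    have e: "1 - exp (t * (f ?w - f z)) = exp (- (t * f z)) * (exp (t * f z) - exp (t * f ?w))"
      by (simp add: right_diff_distrib exp_diff exp_minus field_simps)
    have "exp (- (t * f z)) \<le> 3 / 2"
    proof -
      have "\<bar>exp (- (t * f z)) - exp 0\<bar> \<le> 3 / 2 * \<bar>- (t * f z) - 0\<bar>" by (rule abs_exp_diff_le) (use t[of z] in auto)
      then have "\<bar>exp (- (t * f z)) - 1\<bar> \<le> 3 / 2 * \<bar>t * f z\<bar>" by simp
      then show ?thesis using t[of z] by linarith
    qed
    then have "\<bar>1 - exp (t * (f ?w - f z))\<bar> \<le> 3 / 2 * (3 / 2 * \<bar>t * f z - t * f ?w\<bar>)"
      unfolding e abs_mult by (intro mult_mono abs_exp_diff_le t) auto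
    also have "\<bar>t * f z - t * f ?w\<bar> = \<bar>t\<bar> * \<bar>f z - f ?w\<bar>" by (simp add: abs_mult flip: right_diff_distrib)
    also have "3 / 2 * (3 / 2 * (\<bar>t\<bar> * \<bar>f z - f ?w\<bar>)) \<le> 3 / 2 * (3 / 2 * (\<bar>t\<bar> * (L * norm (z - ?w))))"
      by (intro mult_left_mono b) auto
    also have "\<dots> = \<Gamma> * norm u * s n" using s0[of n] by (simp add: \<Gamma>_def)
    finally show ?thesis using s0[of n] by (simp add: abs_divide pos_divide_le_eq)
  qed
  have hz: "h n u z = 0" if "z \<notin> ?B" "z - s n *\<^sub>R u \<notin> ?B" for n u z
    using that b(3) by (simp add: h_def)
  have h_le: "h n u z \<le> \<Gamma>\<^sup>2 * ((norm u)\<^sup>2 * (\<phi> u)\<^sup>2)" for n u z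
  proof -
    have "((1 - exp (t * (f (z - s n *\<^sub>R u) - f z))) / s n)\<^sup>2 \<le> (\<Gamma> * norm u)\<^sup>2"
      using power_mono[OF dq[of z n u] abs_ge_zero, of 2] unfolding power2_abs .
    then show ?thesis unfolding h_def
      using mult_right_mono[of "((1 - exp (t * (f (z - s n *\<^sub>R u) - f z))) / s n)\<^sup>2" "(\<Gamma> * norm u)\<^sup>2" "(\<phi> u)\<^sup>2"]
      by (simp add: power_mult_distrib mult.assoc)
  qed
  have h_meas[measurable]: "(\<lambda>x. h n (fst x) (snd x)) \<in> borel_measurable (borel \<Otimes>\<^sub>M borel)" "h n u \<in> borel_measurable borel" for n u
    unfolding h_def[abs_def] by measurable
  have finB: "emeasure lborel (cball (0::complex) r) < \<infinity>" for r by (rule emeasure_bounded_finite) simp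
  have [measurable]: "?B \<in> sets borel" by simp
  have inner_lim: "(\<lambda>n. \<integral>\<^sup>+z. ennreal (h n u z) \<partial>lborel) \<longlonglongrightarrow> (\<integral>\<^sup>+z. ennreal ((t * inner (gradient f z) u)\<^sup>2 * (\<phi> u)\<^sup>2) \<partial>lborel)" for u
  proof (rule nn_integral_dominated_convergence[where w = "\<lambda>z. ennreal (\<Gamma>\<^sup>2 * ((norm u)\<^sup>2 * (\<phi> u)\<^sup>2)) * indicator (cball (0::complex) (R + norm u)) z"])
    show "AE z in lborel. ennreal (h n u z) \<le> ennreal (\<Gamma>\<^sup>2 * ((norm u)\<^sup>2 * (\<phi> u)\<^sup>2)) * indicator (cball (0::complex) (R + norm u)) z" for n
    proof (intro AE_I2)
      fix z
      show "ennreal (h n u z) \<le> ennreal (\<Gamma>\<^sup>2 * ((norm u)\<^sup>2 * (\<phi> u)\<^sup>2)) * indicator (cball (0::complex) (R + norm u)) z"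
      proof (cases "z \<in> cball 0 (R + norm u)")
        case False
        have "norm z \<le> norm (z - s n *\<^sub>R u) + norm (s n *\<^sub>R u)" using norm_triangle_ineq[of "z - s n *\<^sub>R u" "s n *\<^sub>R u"] by simp
        moreover have "norm (s n *\<^sub>R u) \<le> norm u" using s0[of n] by (simp add: mult_left_le_one_le)
        moreover have "norm z > R + norm u" using False by simp
        ultimately have "norm z > R" "norm (z - s n *\<^sub>R u) > R" using norm_ge_zero[of u] by linarith+
        then have "z \<notin> ?B" "z - s n *\<^sub>R u \<notin> ?B" by simp_all
        then show ?thesis by (simp add: hz)
      qed (simp add: h_le ennreal_leI)
    qed
    show "(\<lambda>z. ennreal (\<Gamma>\<^sup>2 * ((norm u)\<^sup>2 * (\<phi> u)\<^sup>2)) * indicator (cball (0::complex) (R + norm u)) z) \<in> borel_measurable lborel"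
      by (intro borel_measurable_times_ennreal borel_measurable_const borel_measurable_indicator) simp
    show "(\<integral>\<^sup>+z. ennreal (\<Gamma>\<^sup>2 * ((norm u)\<^sup>2 * (\<phi> u)\<^sup>2)) * indicator (cball (0::complex) (R + norm u)) z \<partial>lborel) < \<infinity>"
      using finB[of "R + norm u"] by (subst nn_integral_cmult_indicator) (simp_all add: ennreal_mult_less_top)
    show "AE z in lborel. (\<lambda>n. ennreal (h n u z)) \<longlonglongrightarrow> ennreal ((t * inner (gradient f z) u)\<^sup>2 * (\<phi> u)\<^sup>2)"
      unfolding h_def using s0 by (intro AE_I2 tendsto_ennrealI tendsto_mult tendsto_power difference_quotient_tendsto slim tendsto_const) (simp add: less_imp_neq[symmetric])
  qed measurable
  have outer_lim: "(\<lambda>n. \<integral>\<^sup>+u. \<integral>\<^sup>+z. ennreal (h n u z) \<partial>lborel \<partial>lborel) \<longlonglongrightarrow>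
     (\<integral>\<^sup>+u. \<integral>\<^sup>+z. ennreal ((t * inner (gradient f z) u)\<^sup>2 * (\<phi> u)\<^sup>2) \<partial>lborel \<partial>lborel)"
  proof (rule nn_integral_dominated_convergence[where w = "\<lambda>u. (2 * emeasure lborel ?B) * ennreal (\<Gamma>\<^sup>2 * ((norm u)\<^sup>2 * (\<phi> u)\<^sup>2))"])
    show "AE u in lborel. (\<integral>\<^sup>+z. ennreal (h n u z) \<partial>lborel) \<le> (2 * emeasure lborel ?B) * ennreal (\<Gamma>\<^sup>2 * ((norm u)\<^sup>2 * (\<phi> u)\<^sup>2))" for n
    proof (intro AE_I2)
      fix u
      let ?c = "ennreal (\<Gamma>\<^sup>2 * ((norm u)\<^sup>2 * (\<phi> u)\<^sup>2))"
      have "(\<integral>\<^sup>+z. ennreal (h n u z) \<partial>lborel) \<le> (\<integral>\<^sup>+z. indicator ?B z * ?c + indicator ?B (z - s n *\<^sub>R u) * ?c \<partial>lborel)"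
      proof (intro nn_integral_mono)
        fix z
        show "ennreal (h n u z) \<le> indicator ?B z * ?c + indicator ?B (z - s n *\<^sub>R u) * ?c"
        proof (cases "z \<in> ?B \<or> z - s n *\<^sub>R u \<in> ?B")
          case True
          have "ennreal (h n u z) \<le> ?c" by (rule ennreal_leI[OF h_le])
          then show ?thesis using True by (auto simp: indicator_def intro: order_trans add_increasing add_increasing2)
        qed (simp add: hz)
      qed
      also have "\<dots> = (\<integral>\<^sup>+z. indicator ?B z * ?c \<partial>lborel) + (\<integral>\<^sup>+z. indicator ?B (z - s n *\<^sub>R u) * ?c \<partial>lborel)"
        by (rule nn_integral_add) measurable
      also have "(\<integral>\<^sup>+z. indicator ?B (z - s n *\<^sub>R u) * ?c \<partial>lborel) = (\<integral>\<^sup>+z. indicator ?B z * ?c \<partial>lborel)"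
        by (rule nn_integral_lborel_reflect(2)[of "\<lambda>z. indicator ?B z * ?c"]) measurable
      also have "(\<integral>\<^sup>+z. indicator ?B z * ?c \<partial>lborel) = emeasure lborel ?B * ?c"
        by (subst mult.commute, subst nn_integral_cmult_indicator) (simp_all add: mult.commute)
      finally show "(\<integral>\<^sup>+z. ennreal (h n u z) \<partial>lborel) \<le> (2 * emeasure lborel ?B) * ?c" by (simp add: mult_2 distrib_right)
    qed
    show "(\<integral>\<^sup>+u. (2 * emeasure lborel ?B) * ennreal (\<Gamma>\<^sup>2 * ((norm u)\<^sup>2 * (\<phi> u)\<^sup>2)) \<partial>lborel) < \<infinity>"
    proof -
      have "(\<integral>\<^sup>+u. ennreal (\<Gamma>\<^sup>2 * ((norm u)\<^sup>2 * (\<phi> u)\<^sup>2)) \<partial>lborel) = ennreal (LINT u|lborel. \<Gamma>\<^sup>2 * ((norm u)\<^sup>2 * (\<phi> u)\<^sup>2))"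
        by (intro nn_integral_eq_integral integrable_mult_right moments_integrable) auto
      then show ?thesis using finB[of R] by (simp add: nn_integral_cmult ennreal_mult_less_top)
    qed
    show "AE u in lborel. (\<lambda>n. \<integral>\<^sup>+z. ennreal (h n u z) \<partial>lborel) \<longlonglongrightarrow> (\<integral>\<^sup>+z. ennreal ((t * inner (gradient f z) u)\<^sup>2 * (\<phi> u)\<^sup>2) \<partial>lborel)"
      using inner_lim by simp
  qed (unfold h_def, measurable)
  have "(\<lambda>n. enn2real (\<integral>\<^sup>+u. \<integral>\<^sup>+z. ennreal (h n u z) \<partial>lborel \<partial>lborel)) \<longlonglongrightarrow> 2 * t\<^sup>2 * limit_variance \<phi> f"
    using outer_lim unfolding gradient_energy by (rule tendsto_enn2real) (simp add: limit_variance_nonneg)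
  moreover have "energy (\<rho> n) (\<lambda>x. exp (t * f x) - 1) = enn2real (\<integral>\<^sup>+u. \<integral>\<^sup>+z. ennreal (h n u z) \<partial>lborel \<partial>lborel)" for n
  proof -
    have r: "\<rho> n > 0" using \<rho>(1)[of n] by linarith
    note [measurable (raw)] = plane.schur_measurable'[OF schur_dilated[OF r]]
    show ?thesis
      unfolding energy_def h_def s_def energy_substitution[OF r, symmetric]
      by (rule integral_eq_nn_integral) auto
  qed
  ultimately show ?thesis by simp
qed

end

section \<open>The central limit theorem\<close>

context clt_setting begin

lemma point_process_determinantal: "determinantal_process N X k \<Longrightarrow> point_process N X"
  by (simp add: determinantal_process_def simple_point_process_def)

lemma linear_statistic_f_measurable:
  assumes "determinantal_process N X k"
  shows "(\<lambda>s. linear_statistic f (X s)) \<in> borel_measurable N"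
proof -
  obtain R where R: "\<And>x. x \<notin> cball 0 R \<Longrightarrow> f x = 0" using bounds by metis
  show ?thesis
    by (rule linear_statistic_measurable[OF point_process_determinantal[OF assms] f_continuous, of "cball 0 R"]) (use R in auto)
qed

text \<open>Stated along sequences because the compactness argument in the strip and Levy's theorem
  are sequential. The assumption \<rho> n \<ge> 1 keeps the step 1 / sqrt (\<rho> n) at most 1, as
  the majorants for the energy require.\<close>

theorem clt_sequence:
  fixes M :: "nat \<Rightarrow> 'w measure" and X :: "nat \<Rightarrow> 'w \<Rightarrow> complex measure"
  assumes \<rho>: "\<And>n. \<rho> n \<ge> 1" "filterlim \<rho> at_top sequentially"
    and X: "\<And>n. determinantal_process (M n) (X n) (dilated_kernel (\<rho> n) K)"
  shows "weak_conv_m (\<lambda>n. distr (M n) borel (\<lambda>s. linear_statistic f (X n s) - \<rho> n * limit_mean \<phi> f))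
    (normal_law 0 (limit_variance \<phi> f))"
proof -
  obtain L F R where b: "L \<ge> 0" "F \<ge> 0" "\<And>x. \<bar>f x\<bar> \<le> F" "\<And>x. x \<notin> cball 0 R \<Longrightarrow> f x = 0" "\<And>z w. \<bar>f z - f w\<bar> \<le> L * norm (z - w)"
    using bounds by metis
  let ?B = "cball (0::complex) R" and ?\<mu> = "limit_mean \<phi> f" and ?v = "limit_variance \<phi> f"
  \<comment> \<open>Ensures |t f| \<le> 1 / 3 for |t| < r; adding 1 to \<open>F\<close> excludes
    division by 0.\<close>
  define r where "r = 1 / (3 * (1 + F))"
  have r: "r > 0" using b by (simp add: r_def)
  have small: "\<bar>t * f x\<bar> \<le> 1 / 3" if "\<bar>t\<bar> < r" for t x
  proof -
    have "\<bar>t * f x\<bar> \<le> r * (1 + F)"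
      unfolding abs_mult using that b(3)[of x] r by (intro mult_mono) auto
    also have "\<dots> = 1 / 3" using b by (simp add: r_def field_simps)
    finally show ?thesis .
  qed
  have r0: "\<rho> n > 0" for n using \<rho>(1)[of n] by linarith
  have lin_meas: "(\<lambda>s. linear_statistic f (X n s)) \<in> borel_measurable (M n)" for n
    by (rule linear_statistic_f_measurable[OF X])
  have Y_meas: "(\<lambda>s. linear_statistic f (X n s) - \<rho> n * ?\<mu>) \<in> borel_measurable (M n)" for n
    using lin_meas[of n] by simp
  have prob: "prob_space (M n)" for n
    using point_process_determinantal[OF X[of n]] by (simp add: point_process_def)
  define \<Lambda> where "\<Lambda> t = 3 / 2 * (\<bar>t\<bar> * L)" for t
  define A where "A t = sqrt (2 * measure lborel ?B * ((\<Lambda> t)\<^sup>2 * moment2))" for t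
  define E where "E n t = sqrt (2 * measure lborel ?B * (\<Lambda> t ^ 3 / sqrt (\<rho> n) * moment3))" for n t
  define err where "err n t = series_constant (1 / 2) * (2 * A t * E n t + \<Lambda> t / sqrt (\<rho> n) * moment1 * (A t)\<^sup>2)" for n t
  have B: "bounded ?B" "?B \<in> sets borel" by simp_all
  have int: "integrable (M n) (\<lambda>s. exp (t * linear_statistic f (X n s)))" if t: "\<bar>t\<bar> < r" for n t
    by (rule laplace_functional_estimate(1)[OF r0 X B f_continuous b(4,5) small[OF t]])
  have ex: "\<exists>l::complex. of_real (LINT s|M n. exp (t * linear_statistic f (X n s))) = exp l \<and>
      norm (l - of_real (t * (\<rho> n * ?\<mu>)) - of_real (energy (\<rho> n) (\<lambda>x. exp (t * f x) - 1)) / 4) \<le> err n t"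
    if t: "\<bar>t\<bar> < r" for n t
    unfolding err_def A_def E_def \<Lambda>_def by (rule laplace_functional_estimate(2)[OF r0 X B f_continuous b(4,5) small[OF t]])
  have eq: "exp (t * (linear_statistic f (X n s) - \<rho> n * ?\<mu>)) = exp (- (t * (\<rho> n * ?\<mu>))) * exp (t * linear_statistic f (X n s))" for n t s
    by (simp add: right_diff_distrib flip: exp_add)
  have err_lim: "(\<lambda>n. err n t) \<longlonglongrightarrow> 0" for t
  proof -
    have q: "filterlim (\<lambda>n. sqrt (\<rho> n)) at_top sequentially" by (rule filterlim_compose[OF sqrt_at_top \<rho>(2)])
    have d: "(\<lambda>n. c / sqrt (\<rho> n)) \<longlonglongrightarrow> 0" for c :: real
      by (rule tendsto_divide_0[OF tendsto_const filterlim_at_top_imp_at_infinity[OF q]])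
    have "(\<lambda>n. E n t) \<longlonglongrightarrow> sqrt (2 * measure lborel ?B * (0 * moment3))"
      unfolding E_def by (intro tendsto_real_sqrt tendsto_mult tendsto_const d)
    then have "(\<lambda>n. err n t) \<longlonglongrightarrow> series_constant (1 / 2) * (2 * A t * sqrt (2 * measure lborel ?B * (0 * moment3)) + 0 * moment1 * (A t)\<^sup>2)"
      unfolding err_def by (intro tendsto_add tendsto_mult tendsto_const d)
    then show ?thesis by simp
  qed
  show ?thesis
  proof (rule weak_conv_normal_of_laplace[OF _ r limit_variance_nonneg])
    show "real_distribution (distr (M n) borel (\<lambda>s. linear_statistic f (X n s) - \<rho> n * ?\<mu>))" for n
      using prob_space.real_distribution_distr[OF prob Y_meas] .
    show "integrable (distr (M n) borel (\<lambda>s. linear_statistic f (X n s) - \<rho> n * ?\<mu>)) (\<lambda>x. exp (t * x))" if t: "\<bar>t\<bar> < r" for n t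
      using integrable_mult_right[OF int[OF t, of n], of "exp (- (t * (\<rho> n * ?\<mu>)))"]
      by (subst integrable_distr_eq[OF Y_meas]) (simp_all add: eq)
    fix t assume t: "\<bar>t\<bar> < r"
    obtain l :: "nat \<Rightarrow> complex" where l: "\<And>n. of_real (LINT s|M n. exp (t * linear_statistic f (X n s))) = exp (l n)"
      "\<And>n. norm (l n - of_real (t * (\<rho> n * ?\<mu>)) - of_real (energy (\<rho> n) (\<lambda>x. exp (t * f x) - 1)) / 4) \<le> err n t"
      using ex[OF t] by metis
    let ?e = "\<lambda>n. energy (\<rho> n) (\<lambda>x. exp (t * f x) - 1)"
    have "(\<lambda>n. l n - of_real (t * (\<rho> n * ?\<mu>)) - of_real (?e n) / 4) \<longlonglongrightarrow> 0"
      by (rule Lim_null_comparison[OF always_eventually err_lim]) (use l(2) in auto)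
    \<comment> \<open>The quarter of the limiting energy is t^2 / 2 times the variance, the exponent
      of the normal Laplace transform.\<close>
    moreover have "(\<lambda>n. of_real (?e n) / 4 :: complex) \<longlonglongrightarrow> of_real (2 * t\<^sup>2 * ?v) / 4"
      by (intro tendsto_divide tendsto_of_real tendsto_const energy_tendsto[OF \<rho> small[OF t]]) simp
    ultimately have "(\<lambda>n. (l n - of_real (t * (\<rho> n * ?\<mu>)) - of_real (?e n) / 4) + of_real (?e n) / 4) \<longlonglongrightarrow> 0 + of_real (2 * t\<^sup>2 * ?v) / 4"
      by (rule tendsto_add)
    then have "(\<lambda>n. l n - of_real (t * (\<rho> n * ?\<mu>))) \<longlonglongrightarrow> of_real (?v * t\<^sup>2 / 2)"
      by (simp add: mult_ac)
    then have "(\<lambda>n. exp (l n - of_real (t * (\<rho> n * ?\<mu>)))) \<longlonglongrightarrow> exp (of_real (?v * t\<^sup>2 / 2))"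
      by (rule tendsto_exp)
    moreover have "exp (l n - of_real (t * (\<rho> n * ?\<mu>))) = complex_of_real (LINT x|distr (M n) borel (\<lambda>s. linear_statistic f (X n s) - \<rho> n * ?\<mu>). exp (t * x))" for n
    proof -
      have "(LINT x|distr (M n) borel (\<lambda>s. linear_statistic f (X n s) - \<rho> n * ?\<mu>). exp (t * x)) =
         exp (- (t * (\<rho> n * ?\<mu>))) * (LINT s|M n. exp (t * linear_statistic f (X n s)))"
        by (subst integral_distr[OF Y_meas]) (simp_all add: eq)
      then have "complex_of_real (LINT x|distr (M n) borel (\<lambda>s. linear_statistic f (X n s) - \<rho> n * ?\<mu>). exp (t * x)) =
         exp (- of_real (t * (\<rho> n * ?\<mu>))) * exp (l n)"
        by (simp only: of_real_mult l(1) exp_of_real[symmetric] of_real_minus)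
      then show ?thesis by (simp only: exp_diff exp_minus divide_inverse mult.commute)
    qed
    ultimately have "(\<lambda>n. complex_of_real (LINT x|distr (M n) borel (\<lambda>s. linear_statistic f (X n s) - \<rho> n * ?\<mu>). exp (t * x)))
       \<longlonglongrightarrow> complex_of_real (exp (?v * t\<^sup>2 / 2))" by (simp only: exp_of_real)
    then show "(\<lambda>n. LINT x|distr (M n) borel (\<lambda>s. linear_statistic f (X n s) - \<rho> n * ?\<mu>). exp (t * x)) \<longlonglongrightarrow> exp (?v * t\<^sup>2 / 2)"
      by (simp only: tendsto_of_real_iff)
  qed
qed

end

text \<open>At each continuity point of the limiting distribution function, the limit along
  \<open>at_top\<close> is tested on arbitrary sequences tending to infinity, where
  \<open>clt_sequence\<close> applies.\<close>

theorem corollary2p3: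
  fixes K :: "complex \<Rightarrow> complex \<Rightarrow> complex"
    and \<phi> :: "complex \<Rightarrow> real"
    and f :: "complex \<Rightarrow> real"
    and M :: "real \<Rightarrow> 'w measure"
    and X :: "real \<Rightarrow> 'w \<Rightarrow> complex measure"
  assumes "hermitian_reproducing_kernel K"
    and "\<And>z. 0 \<le> \<phi> z"
    and "continuous_on UNIV \<phi>"
    and "bounded (range \<phi>)"
    and "\<And>z w. norm (K z w) = \<phi> (z - w)"
    and "integrable lborel (\<lambda>z. (1 + norm z ^ 3) * \<phi> z)"
    and "\<And>\<rho>. \<rho> > 0 \<Longrightarrow> determinantal_process (M \<rho>) (X \<rho>) (dilated_kernel \<rho> K)"
    and "C_k 3 f"
    and "compactly_supported f"
  shows "converges_in_distribution M
           (\<lambda>\<rho> \<omega>. linear_statistic f (X \<rho> \<omega>) - \<rho> * limit_mean \<phi> f)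
           (normal_law 0 (limit_variance \<phi> f)) at_top"
proof -
  interpret clt_setting K \<phi> f
    by unfold_locales (use assms in auto)
  let ?Y = "\<lambda>\<rho> s. linear_statistic f (X \<rho> s) - \<rho> * limit_mean \<phi> f"
  let ?c = "\<lambda>\<rho>. cdf (distr (M \<rho>) borel (?Y \<rho>))"
  let ?\<nu> = "normal_law 0 (limit_variance \<phi> f)"
  show ?thesis
    unfolding converges_in_distribution_def
  proof (intro conjI allI impI)
    show "\<forall>\<^sub>F \<rho> in at_top. ?Y \<rho> \<in> borel_measurable (M \<rho>)"
      using eventually_gt_at_top[of 0]
    proof eventually_elim
      case (elim \<rho>)
      then show ?case using linear_statistic_f_measurable[OF assms(7)[OF elim]] by simp
    qed
    fix x assume x: "isCont (cdf ?\<nu>) x"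
    show "((\<lambda>\<rho>. ?c \<rho> x) \<longlongrightarrow> cdf ?\<nu> x) at_top"
    proof (rule tendsto_at_topI_sequentially)
      fix \<rho> :: "nat \<Rightarrow> real" assume \<rho>: "filterlim \<rho> at_top sequentially"
      \<comment> \<open>Raising values below 1 to 1 changes only finitely many terms and meets the
        hypothesis of \<open>clt_sequence\<close>.\<close>
      define \<rho>' where "\<rho>' n = max 1 (\<rho> n)" for n
      have ev: "\<forall>\<^sub>F n in sequentially. \<rho>' n = \<rho> n"
        using \<rho>[unfolded filterlim_at_top, rule_format, of 1] by eventually_elim (simp add: \<rho>'_def)
      have \<rho>': "filterlim \<rho>' at_top sequentially"
        by (rule filterlim_at_top_mono[OF \<rho>]) (simp add: \<rho>'_def)
      have "weak_conv_m (\<lambda>n. distr (M (\<rho>' n)) borel (?Y (\<rho>' n))) ?\<nu>"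
        by (rule clt_sequence[OF _ \<rho>']) (auto intro!: assms(7) simp: \<rho>'_def)
      then have "(\<lambda>n. ?c (\<rho>' n) x) \<longlonglongrightarrow> cdf ?\<nu> x"
        using x by (simp add: weak_conv_m_def weak_conv_def)
      then show "(\<lambda>n. ?c (\<rho> n) x) \<longlonglongrightarrow> cdf ?\<nu> x"
        by (rule Lim_transform_eventually) (use ev in eventually_elim, simp)
    qed
  qed
qed

end
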